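(* Let $m\ge0$ and $\mu\ge0$ be integers and $g\in C^\infty[-1,1]$. Let $\lambda>-\frac12$; for $\lambda\neq0$ let $\mathcal P_N^{f,Ge}$ be the Gegenbauer orthogonal projection of $f$ with parameter $\lambda$, and let $\mathcal P_N^{f,Ch}$ be the Chebyshev orthogonal projection of $f$. Then, as $N\to\infty$: (a) (Gegenbauer, $\lambda\ne0$, with $\alpha=\beta=\lambda-\frac12$) (i) if $f(x)=(1-x)^{\gamma}\ln^{\mu}(1-x)g(x)$ with $\min\{\lambda+\gamma,\lambda+2\gamma\}>m-\frac12$, then $\|f-\mathcal P_N^{f,Ge}\|_{H^{m,\alpha,\beta}(\Omega)}=O(N^{m-\lambda-2\gamma-1/2}\ln^{\mu}(N))$; (ii) if $f(x)=|x-z_0|^{s}\ln^{\mu}|x-z_0|g(x)$ with $z_0\in(-1,1)$, $s>m-\frac12$ and $\lambda\ge0$, then $\|f-\mathcal P_N^{f,Ge}\|_{H^{m,\alpha,\beta}(\Omega)}=O(N^{m-s-1/2}\ln^{\mu}(N))$; (iii) if $f(x)=(1+x)^{\delta}\ln^{\mu}(1+x)g(x)$ with $\min\{\lambda+\delta,\lambda+2\delta\}>m-\frac12$, then $\|f-\mathcal P_N^{f,Ge}\|_{H^{m,\alpha,\beta}(\Omega)}=O(N^{m-\lambda-2\delta-1/2}\ln^{\mu}(N))$. (b) (Chebyshev, corresponding to $\lambda=0$, with $\alpha=\beta=-\frac12$) (i) if $f(x)=(1-x)^{\gamma}\ln^{\mu}(1-x)g(x)$ with $\min\{\gamma,2\gamma\}>m-\frac12$,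 then $\|f-\mathcal P_N^{f,Ch}\|_{H^{m,\alpha,\beta}(\Omega)}=O(N^{m-1/2-2\gamma}\ln^{\mu}(N))$; (ii) if $f(x)=|x-z_0|^{s}\ln^{\mu}|x-z_0|g(x)$ with $z_0\in(-1,1)$ and $s>m-\frac12$, then $\|f-\mathcal P_N^{f,Ch}\|_{H^{m,\alpha,\beta}(\Omega)}=O(N^{m-s-1/2}\ln^{\mu}(N))$; (iii) if $f(x)=(1+x)^{\delta}\ln^{\mu}(1+x)g(x)$ with $\min\{\delta,2\delta\}>m-\frac12$, then $\|f-\mathcal P_N^{f,Ch}\|_{H^{m,\alpha,\beta}(\Omega)}=O(N^{m-1/2-2\delta}\ln^{\mu}(N))$. In particular, if $\mu\ge1$ and $\gamma$ (respectively $\delta$) is an integer, then in cases (a)(i), (b)(i) (respectively (a)(iii), (b)(iii)) the factor $\ln^\mu(N)$ may be replaced by $\ln^{\mu-1}(N)$.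
   Context: $\Omega=(-1,1)$ and $$\|u\|_{H^{m,\alpha,\beta}(\Omega)}=\Big\{\sum_{q=0}^m\int_{-1}^1(1-x)^{\alpha+q}(1+x)^{\beta+q}[u^{(q)}(x)]^2\,dx\Big\}^{1/2}.$$ $C_n^{(\lambda)}$ is the Gegenbauer polynomial of degree $n$ and $T_n$ the Chebyshev polynomial of the first kind. $\mathcal P_N^{f,Ge}=\sum_{n=0}^N a_n(\lambda)C_n^{(\lambda)}$ with $a_n(\lambda)=\frac1{h_n}\int_{-1}^1(1-x^2)^{\lambda-1/2}C_n^{(\lambda)}(x)f(x)\,dx$, $h_n=\int_{-1}^1(1-x^2)^{\lambda-1/2}[C_n^{(\lambda)}(x)]^2dx$. $\mathcal P_N^{f,Ch}=\sum_{n=0}^N c_nT_n$, with $c_0=\frac1\pi\int_{-1}^1\frac{f(x)}{\sqrt{1-x^2}}dx$ and $c_n=\frac2\pi\int_{-1}^1\frac{f(x)T_n(x)}{\sqrt{1-x^2}}dx$ for $n\ge1$. The exponents $\gamma,\delta,s$ are real. Constants in the $O$-terms may depend on everything except $N$.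
   Formalization: In the last sentence, for cases (a)(i) and (a)(iii), "integer" is read as nonnegative integer; for negative integers the claim fails, e.g. λ=2, m=0, μ=1, g=1, γ=−1, where the error is of exact order N^{-1/2} ln N. *)

theory Defs
  imports "HOL-Analysis.Analysis" "HOL-Library.Landau_Symbols"
begin

(* D k is the k-th derivative on [-1,1], one-sided at the two end points; the values of g
   outside [-1,1] are irrelevant. *)
definition smooth_on_Icc :: "(real \<Rightarrow> real) \<Rightarrow> bool" where
  "smooth_on_Icc g \<longleftrightarrow> (\<exists>D :: nat \<Rightarrow> real \<Rightarrow> real.
     (\<forall>x\<in>{-1..1}. D 0 x = g x) \<and>
     (\<forall>k. \<forall>x\<in>{-1..1}. (D k has_real_derivative D (Suc k) x) (at x within {-1..1})))"

fun gegenbauer :: "real \<Rightarrow> nat \<Rightarrow> real \<Rightarrow> real" where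
  "gegenbauer lam 0 x = 1"
| "gegenbauer lam (Suc 0) x = 2 * lam * x"
| "gegenbauer lam (Suc (Suc n)) x =
     (2 * (real n + 1 + lam) * x * gegenbauer lam (Suc n) x
      - (real n + 2 * lam) * gegenbauer lam n x) / (real n + 2)"

fun chebyshev_T :: "nat \<Rightarrow> real \<Rightarrow> real" where
  "chebyshev_T 0 x = 1"
| "chebyshev_T (Suc 0) x = x"
| "chebyshev_T (Suc (Suc n)) x = 2 * x * chebyshev_T (Suc n) x - chebyshev_T n x"

definition gegenbauer_h :: "real \<Rightarrow> nat \<Rightarrow> real" where
  "gegenbauer_h lam n =
     (LINT x:{-1<..<1}|lborel. (1 - x\<^sup>2) powr (lam - 1/2) * (gegenbauer lam n x)\<^sup>2)"

definition gegenbauer_coeff :: "real \<Rightarrow> (real \<Rightarrow> real) \<Rightarrow> nat \<Rightarrow> real" where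
  "gegenbauer_coeff lam f n = 1 / gegenbauer_h lam n *
     (LINT x:{-1<..<1}|lborel. (1 - x\<^sup>2) powr (lam - 1/2) * gegenbauer lam n x * f x)"

definition gegenbauer_proj :: "real \<Rightarrow> (real \<Rightarrow> real) \<Rightarrow> nat \<Rightarrow> real \<Rightarrow> real" where
  "gegenbauer_proj lam f N x = (\<Sum>n\<le>N. gegenbauer_coeff lam f n * gegenbauer lam n x)"

definition chebyshev_coeff :: "(real \<Rightarrow> real) \<Rightarrow> nat \<Rightarrow> real" where
  "chebyshev_coeff f n = (if n = 0 then 1 / pi else 2 / pi) *
     (LINT x:{-1<..<1}|lborel. f x * chebyshev_T n x / sqrt (1 - x\<^sup>2))"

definition chebyshev_proj :: "(real \<Rightarrow> real) \<Rightarrow> nat \<Rightarrow> real \<Rightarrow> real" where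
  "chebyshev_proj f N x = (\<Sum>n\<le>N. chebyshev_coeff f n * chebyshev_T n x)"

definition sobolev_integrand ::
    "real \<Rightarrow> real \<Rightarrow> (real \<Rightarrow> real) \<Rightarrow> nat \<Rightarrow> real \<Rightarrow> real" where
  "sobolev_integrand \<alpha> \<beta> u q x =
     (1 - x) powr (\<alpha> + real q) * (1 + x) powr (\<beta> + real q) * ((deriv ^^ q) u x)\<^sup>2"

definition sobolev_norm :: "nat \<Rightarrow> real \<Rightarrow> real \<Rightarrow> (real \<Rightarrow> real) \<Rightarrow> real" where
  "sobolev_norm m \<alpha> \<beta> u =
     sqrt (\<Sum>q\<le>m. (LINT x:{-1<..<1}|lborel. sobolev_integrand \<alpha> \<beta> u q x))"

(* The space on which sobolev_norm is meaningful.  For q < m the q-th derivative is locally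
   absolutely continuous on (-1,1), so that the pointwise derivatives up to order m, which may
   fail to exist on a null set for order m, are the weak ones; and the integrals in the norm
   are finite.  The last clause matters because the Bochner integral of a non-integrable
   function is 0. *)
definition sobolev_space :: "nat \<Rightarrow> real \<Rightarrow> real \<Rightarrow> (real \<Rightarrow> real) set" where
  "sobolev_space m \<alpha> \<beta> = {u.
     (\<forall>q<m. \<forall>a b. -1 < a \<longrightarrow> a \<le> b \<longrightarrow> b < 1 \<longrightarrow>
        set_integrable lborel {a..b} ((deriv ^^ Suc q) u) \<and>
        (LINT x:{a..b}|lborel. (deriv ^^ Suc q) u x) = (deriv ^^ q) u b - (deriv ^^ q) u a) \<and>
     (\<forall>q\<le>m. set_borel_measurable lborel {-1<..<1} ((deriv ^^ q) u) \<and>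
        set_integrable lborel {-1<..<1} (sobolev_integrand \<alpha> \<beta> u q))}"

definition sobolev_error_bigo ::
    "nat \<Rightarrow> real \<Rightarrow> real \<Rightarrow> (real \<Rightarrow> real) \<Rightarrow> (nat \<Rightarrow> real \<Rightarrow> real) \<Rightarrow> real \<Rightarrow> nat \<Rightarrow> bool" where
  "sobolev_error_bigo m \<alpha> \<beta> f P e k \<longleftrightarrow>
     (\<forall>N. (\<lambda>x. f x - P N x) \<in> sobolev_space m \<alpha> \<beta>) \<and>
     (\<lambda>N. sobolev_norm m \<alpha> \<beta> (\<lambda>x. f x - P N x))
       \<in> O(\<lambda>N. real N powr e * ln (real N) ^ k)"

end

(* An orthogonal projection realises the best approximation, so only one good polynomial has to
   be exhibited.  Moreover differentiation maps the projection for the weight (1 - x^2)^b to the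
   projection of the derivative for the weight (1 - x^2)^(b + 1), so every term of the Sobolev norm
   is again a distance to polynomials.  With e = N^-2 at an end point and e = N^-1 inside, write
   ln|x - z| = ln(|x - z| / e) + ln e and expand by the binomial theorem.  This leaves
   e^s a_j((x - z) / e) g(x) with a_j(y) = |y|^s ln^j|y| and coefficients of size ln^(mu - j) N.
   Split off the part near z by a cut-off on the scale e: its norm is computed by scaling.
   The rest is smooth, and a weighted Poincare inequality, iterated r times, bounds its distance to
   polynomials by N^-r times the norm of its r-th derivative, which is again found by scaling.
   If the exponent at an end point is a natural number, the term j = 0, the only one carrying
   ln^mu N, is smooth and its approximation error decays faster than any power of N. *)

theory Submission
  imports Defs
begin

section \<open>Jacobi weights\<close>

text \<open>The scales are forced. One more derivative together with one more power of the weight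
  multiplies a squared norm at scale e by e^-1 inside and at an end point by e^-1 times a
  correction: precisely e^-2 inside and e^-2 e = e^-1 at an end point, where the extra weight is
  itself of size e. This factor must equal the N^2 of the Poincare inequality; then the parts near z
  and away from z contribute equally, and all derivatives fit one rate. The logarithm is rescaled
  before anything is estimated: replacing ln|y| by powers |y|^eta and |y|^-eta in the scaled
  variable y costs only a constant, while the same estimate in x would cost a power of N. Exact
  powers of ln N therefore survive, carried by the coefficients alone. The classical polynomials
  enter at two places: as eigenfunctions behind the Poincare inequality, and where the partial sums
  of the theorem are recognised as projections. No asymptotics of expansion coefficients is
  used.\<close>

definition jac :: "real \<Rightarrow> real measure" where
  "jac b = density (restrict_space lborel {-1<..<1}) (\<lambda>x. ennreal ((1 - x\<^sup>2) powr b))"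

lemma space_jac [simp]: "space (jac b) = {-1<..<1}"
  by (simp add: jac_def space_restrict_space)

text \<open>The sigma-algebra does not depend on \<open>b\<close>, so measurability is settled once
  for all the weights \<open>b + q\<close> that differentiation produces.\<close>

lemma sets_jac: "sets (jac b) = sets (restrict_space borel {-1<..<1::real})"
  unfolding jac_def by (simp add: sets_restrict_space)

lemma measurable_jac: "borel_measurable (jac b) = borel_measurable (restrict_space borel {-1<..<1::real})"
  by (rule measurable_cong_sets) (simp_all add: sets_jac)

lemma measurable_jac_borel [intro]:
  "f \<in> borel_measurable borel \<Longrightarrow> f \<in> borel_measurable (jac b)"
  unfolding measurable_jac by (rule measurable_restrict_space1)

lemma measurable_jac_continuous:
  fixes f :: "real \<Rightarrow> real"
  assumes "continuous_on {-1..1} f"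
  shows "f \<in> borel_measurable (jac b)"
  unfolding measurable_jac
  by (rule borel_measurable_continuous_on_restrict, rule continuous_on_subset[OF assms]) auto

lemma measurable_jac_iff:
  fixes f :: "real \<Rightarrow> real"
  shows "f \<in> borel_measurable (jac b) \<longleftrightarrow> set_borel_measurable lborel {-1<..<1} f"
  unfolding measurable_jac set_borel_measurable_def
  by (subst borel_measurable_restrict_space_iff) auto

lemma integrable_jac_iff:
  fixes f :: "real \<Rightarrow> real"
  assumes "f \<in> borel_measurable (jac b)"
  shows "integrable (jac b) f \<longleftrightarrow> set_integrable lborel {-1<..<1} (\<lambda>x. (1 - x\<^sup>2) powr b * f x)"
proof -
  have f: "f \<in> borel_measurable (restrict_space lborel {-1<..<1})"
    using assms unfolding measurable_jac by (simp cong: measurable_cong_sets)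
  have "integrable (jac b) f \<longleftrightarrow>
      integrable (restrict_space lborel {-1<..<1}) (\<lambda>x. (1 - x\<^sup>2) powr b *\<^sub>R f x)"
    unfolding jac_def
    by (rule integrable_density[OF f]) (auto intro!: measurable_restrict_space1)
  also have "\<dots> \<longleftrightarrow> set_integrable lborel {-1<..<1} (\<lambda>x. (1 - x\<^sup>2) powr b * f x)"
    by (subst integrable_restrict_space) (auto simp: set_integrable_def)
  finally show ?thesis .
qed

lemma integral_jac:
  fixes f :: "real \<Rightarrow> real"
  assumes "f \<in> borel_measurable (jac b)"
  shows "integral\<^sup>L (jac b) f = (LINT x:{-1<..<1}|lborel. (1 - x\<^sup>2) powr b * f x)"
proof -
  have f: "f \<in> borel_measurable (restrict_space lborel {-1<..<1})"
    using assms unfolding measurable_jac by (simp cong: measurable_cong_sets)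
  have "integral\<^sup>L (jac b) f =
      integral\<^sup>L (restrict_space lborel {-1<..<1}) (\<lambda>x. (1 - x\<^sup>2) powr b *\<^sub>R f x)"
    unfolding jac_def
    by (rule integral_density[OF f]) (auto intro!: measurable_restrict_space1)
  also have "\<dots> = (LINT x:{-1<..<1}|lborel. (1 - x\<^sup>2) powr b * f x)"
    by (subst integral_restrict_space) (auto simp: set_lebesgue_integral_def)
  finally show ?thesis .
qed

text \<open>Singular functions are controlled only away from \<open>z\<close>; at \<open>z\<close>
  their formulas take conventional values.\<close>

lemma AE_jac_neq: "AE x in jac b. x \<noteq> z"
proof -
  have "AE x in lborel. x \<noteq> z" by (rule AE_lborel_singleton)
  then have "AE x in restrict_space lborel {-1<..<1}. x \<noteq> z"
    by (subst AE_restrict_space_iff) auto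
  then show ?thesis unfolding jac_def
    by (subst AE_density) (auto intro!: measurable_restrict_space1)
qed

section \<open>Power majorants and the scaling of their integrals\<close>

lemma set_integrable_powr_unit:
  fixes p :: real assumes "p > -1"
  shows "set_integrable lborel {0<..1} (\<lambda>x::real. x powr p)"
proof -
  have "(\<lambda>x. x powr p) integrable_on {0<..1}"
    by (rule integrable_on_powr_from_0') (use assms in auto)
  then have "(\<lambda>x::real. x powr p) absolutely_integrable_on {0<..1}"
    by (subst absolutely_integrable_on_iff_nonneg) auto
  then show ?thesis
    unfolding set_integrable_def by (subst (asm) integrable_completion) auto
qed

lemma set_integrable_powr_inf:
  fixes p :: real assumes "p < -1"
  shows "set_integrable lborel {1<..} (\<lambda>x::real. x powr p)"
proof -
  have "(\<lambda>x. x powr p) integrable_on {1..}"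
    using has_integral_powr_to_inf[of p 1] assms by (auto simp: integrable_on_def)
  then have "(\<lambda>x::real. x powr p) absolutely_integrable_on {1..}"
    by (subst absolutely_integrable_on_iff_nonneg) auto
  then have "set_integrable lborel {1..} (\<lambda>x::real. x powr p)"
    unfolding set_integrable_def by (subst (asm) integrable_completion) auto
  then show ?thesis by (rule set_integrable_subset) auto
qed

text \<open>The universal majorant in the scaled variable: \<open>a1\<close> decides integrability
  at 0 and \<open>a2\<close> at infinity, and the two requirements can be met independently.\<close>

definition twopow :: "real \<Rightarrow> real \<Rightarrow> real \<Rightarrow> real" where
  "twopow a1 a2 t = (if t \<le> 1 then t powr a1 else t powr a2)"

lemma twopow_nonneg [simp]: "twopow a1 a2 t \<ge> 0"
  by (simp add: twopow_def)

lemma twopow_measurable [measurable]: "twopow a1 a2 \<in> borel_measurable borel"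
  unfolding twopow_def by measurable

lemma integrable_twopow:
  assumes "a1 > -1" "a2 < -1"
  shows "integrable lborel (\<lambda>y::real. twopow a1 a2 \<bar>y\<bar>)"
proof -
  let ?f = "\<lambda>y::real. indicator {0<..1} y *\<^sub>R y powr a1 + indicator {1<..} y *\<^sub>R y powr a2"
  have i: "integrable lborel ?f"
    using set_integrable_powr_unit[OF assms(1)] set_integrable_powr_inf[OF assms(2)]
    unfolding set_integrable_def by (rule Bochner_Integration.integrable_add)
  have "integrable lborel (\<lambda>y. ?f (0 + (-1) * y))"
    by (rule lborel_integrable_real_affine[OF i]) simp
  with i have "integrable lborel (\<lambda>y. ?f y + ?f (0 + (-1) * y))"
    by (rule Bochner_Integration.integrable_add)
  also have "(\<lambda>y. ?f y + ?f (0 + (-1) * y)) = (\<lambda>y. twopow a1 a2 \<bar>y\<bar>)"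
    by (rule ext) (auto simp: twopow_def indicator_def)
  finally show ?thesis .
qed

lemma integrable_twopow_scaled:
  assumes "a1 > -1" "a2 < -1" "e > 0"
  shows "integrable lborel (\<lambda>x::real. twopow a1 a2 (\<bar>x - z\<bar> / e))"
    and "(LINT x|lborel. twopow a1 a2 (\<bar>x - z\<bar> / e)) = e * (LINT y|lborel. twopow a1 a2 \<bar>y\<bar>)"
proof -
  have *: "(\<lambda>x::real. twopow a1 a2 (\<bar>x - z\<bar> / e)) = (\<lambda>x. twopow a1 a2 \<bar>- z / e + (1 / e) * x\<bar>)"
  proof
    fix x :: real
    have "- z / e + (1 / e) * x = (x - z) / e" by (simp add: diff_divide_distrib)
    then show "twopow a1 a2 (\<bar>x - z\<bar> / e) = twopow a1 a2 \<bar>- z / e + (1 / e) * x\<bar>"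
      using assms(3) by (simp only: abs_divide abs_of_pos)
  qed
  show "integrable lborel (\<lambda>x::real. twopow a1 a2 (\<bar>x - z\<bar> / e))"
    unfolding * by (rule lborel_integrable_real_affine[OF integrable_twopow]) (use assms in auto)
  show "(LINT x|lborel. twopow a1 a2 (\<bar>x - z\<bar> / e)) = e * (LINT y|lborel. twopow a1 a2 \<bar>y\<bar>)"
    unfolding * using lborel_integral_real_affine[of "1/e" "\<lambda>y. twopow a1 a2 \<bar>y\<bar>" "-z/e"] assms(3)
    by simp
qed

text \<open>On each half of the interval one of the factors 1 - x and 1 + x lies in [1, 2], so its
  power is at most \<open>2 powr \<bar>b\<bar>\<close> whatever the sign of
  \<open>b\<close>.\<close>

lemma powr_one_minus_sq_le:
  fixes b x :: real
  assumes "x \<in> {-1<..<1}"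
  shows "(1 - x\<^sup>2) powr b \<le> 2 powr \<bar>b\<bar> * ((1 - x) powr b + (1 + x) powr b)"
proof -
  have e: "(1 - x\<^sup>2) powr b = (1 - x) powr b * (1 + x) powr b"
    using assms by (subst powr_mult[symmetric]) (auto simp: power2_eq_square algebra_simps)
  have k: "t powr b \<le> 2 powr \<bar>b\<bar>" if "1 \<le> t" "t \<le> 2" for t :: real
  proof -
    have "t powr b \<le> t powr \<bar>b\<bar>" using that by (intro powr_mono) auto
    also have "\<dots> \<le> 2 powr \<bar>b\<bar>" using that by (intro powr_mono2) auto
    finally show ?thesis .
  qed
  show ?thesis
  proof (cases "x \<ge> 0")
    case True
    then have "(1 - x) powr b * (1 + x) powr b \<le> (1 - x) powr b * 2 powr \<bar>b\<bar>"
      using assms by (intro mult_left_mono k) auto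
    also have "\<dots> \<le> 2 powr \<bar>b\<bar> * ((1 - x) powr b + (1 + x) powr b)"
      by (simp add: algebra_simps)
    finally show ?thesis using e by simp
  next
    case False
    then have "(1 - x) powr b * (1 + x) powr b \<le> 2 powr \<bar>b\<bar> * (1 + x) powr b"
      using assms by (intro mult_right_mono k) auto
    also have "\<dots> \<le> 2 powr \<bar>b\<bar> * ((1 - x) powr b + (1 + x) powr b)"
      by (simp add: algebra_simps)
    finally show ?thesis using e by simp
  qed
qed

lemma set_integrable_jac_weight:
  assumes "b > -1"
  shows "set_integrable lborel {-1<..<1} (\<lambda>x::real. (1 - x\<^sup>2) powr b)"
proof -
  \<comment> \<open>Halving keeps both distances to the end points below 1, where
    \<open>twopow\<close> has exponent \<open>b\<close>; the exponent -2 makes the majorant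
    integrable on the whole line.\<close>
  let ?g = "\<lambda>x::real. 2 powr \<bar>b\<bar> * (2 powr \<bar>b\<bar> * (twopow b (-2) (\<bar>x - 1\<bar> / 2) + twopow b (-2) (\<bar>x - (-1)\<bar> / 2)))"
  have i: "integrable lborel ?g"
    by (intro integrable_mult_right Bochner_Integration.integrable_add integrable_twopow_scaled) (use assms in auto)
  have le: "norm (indicator {-1<..<1} x *\<^sub>R (1 - x\<^sup>2) powr b) \<le> norm (?g x)" for x :: real
  proof (cases "x \<in> {-1<..<1}")
    case True
    have s: "t powr b \<le> 2 powr \<bar>b\<bar> * (t / 2) powr b" if "t \<ge> 0" for t :: real
    proof -
      have "t powr b = (2 * (t/2)) powr b" by simp
      also have "\<dots> = 2 powr b * (t/2) powr b" using that by (subst powr_mult) auto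
      also have "\<dots> \<le> 2 powr \<bar>b\<bar> * (t / 2) powr b"
        by (intro mult_right_mono powr_mono) auto
      finally show ?thesis .
    qed
    have a: "\<bar>x - 1\<bar> = 1 - x" "\<bar>x - (-1)\<bar> = 1 + x" using True by auto
    have "(1 - x\<^sup>2) powr b \<le> 2 powr \<bar>b\<bar> * ((1 - x) powr b + (1 + x) powr b)"
      by (rule powr_one_minus_sq_le[OF True])
    also have "\<dots> \<le> 2 powr \<bar>b\<bar> * (2 powr \<bar>b\<bar> * ((1 - x) / 2) powr b + 2 powr \<bar>b\<bar> * ((1 + x) / 2) powr b)"
      using True by (intro mult_left_mono add_mono s) auto
    also have "\<dots> = ?g x" unfolding a twopow_def using True by (simp add: algebra_simps)
    finally show ?thesis using True by (simp add: algebra_simps)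
  qed auto
  show ?thesis unfolding set_integrable_def
    by (rule Bochner_Integration.integrable_bound[OF i _ AE_I2[OF le]]) measurable
qed

lemma integrable_jac_const:
  assumes "b > -1"
  shows "integrable (jac b) (\<lambda>x. c :: real)"
proof -
  have "set_integrable lborel {-1<..<1} (\<lambda>x::real. (1 - x\<^sup>2) powr b * c)"
    using set_integrable_jac_weight[OF assms] by (rule set_integrable_mult_left)
  then show ?thesis by (subst integrable_jac_iff) auto
qed

lemma integrable_jac_bounded:
  fixes f :: "real \<Rightarrow> real"
  assumes "b > -1" "f \<in> borel_measurable (jac b)" "\<And>x. x \<in> {-1<..<1} \<Longrightarrow> \<bar>f x\<bar> \<le> C"
  shows "integrable (jac b) f"
proof (rule Bochner_Integration.integrable_bound[OF integrable_jac_const[OF assms(1), of C] assms(2)])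
  show "AE x in jac b. norm (f x) \<le> norm C"
    using assms(3) by (intro AE_I2) (force simp: space_jac)
qed

text \<open>Near \<open>z\<close> the weight behaves as if the ball of radius \<open>r\<close> had mass of order \<open>r\<^sup>d\<close>.\<close>
definition weight_growth :: "real \<Rightarrow> real \<Rightarrow> real \<Rightarrow> bool" where
  "weight_growth z b d \<longleftrightarrow> (\<exists>r C. 0 < r \<and> r \<le> 1 \<and>
     (\<forall>x\<in>{-1<..<1}. x \<noteq> z \<longrightarrow> \<bar>x - z\<bar> \<le> r \<longrightarrow> (1 - x\<^sup>2) powr b \<le> C * \<bar>x - z\<bar> powr (d - 1)))"

text \<open>Within distance \<open>r\<close> of \<open>z\<close> the weight is absorbed into the
  exponents, which shift by \<open>d - 1\<close>, and substitution yields \<open>e powr d\<close>.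
  Farther away the majorant is at most \<open>(r / e) powr a2\<close>, which is multiplied by the
  finite total mass; since \<open>e \<le> 1\<close> and \<open>- a2 > d\<close>, this is again of
  order \<open>e powr d\<close>.\<close>

lemma integral_jac_twopow:
  assumes b: "b > -1" and wg: "weight_growth z b d" and d: "d > 0"
    and a: "a1 + d > 0" "a2 + d < 0"
  obtains r C where "0 < r" "r \<le> 1" "C \<ge> 0"
    "\<And>e. 0 < e \<Longrightarrow> e \<le> r \<Longrightarrow> integrable (jac b) (\<lambda>x. twopow a1 a2 (\<bar>x - z\<bar> / e))"
    "\<And>e. 0 < e \<Longrightarrow> e \<le> r \<Longrightarrow> (LINT x|jac b. twopow a1 a2 (\<bar>x - z\<bar> / e)) \<le> C * e powr d"
proof -
  obtain r C0 where r: "0 < r" "r \<le> 1"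
    and C0: "\<And>x. x \<in> {-1<..<1} \<Longrightarrow> x \<noteq> z \<Longrightarrow> \<bar>x - z\<bar> \<le> r \<Longrightarrow> (1 - x\<^sup>2) powr b \<le> C0 * \<bar>x - z\<bar> powr (d - 1)"
    using wg unfolding weight_growth_def by blast
  define W where "W = (LINT x:{-1<..<1}|lborel. (1 - x\<^sup>2) powr b)"
  define I where "I = (LINT y|lborel. twopow (a1 + d - 1) (a2 + d - 1) \<bar>y\<bar>)"
  have W: "W \<ge> 0" unfolding W_def set_lebesgue_integral_def by (intro Bochner_Integration.integral_nonneg) auto
  have I: "I \<ge> 0" unfolding I_def by (intro Bochner_Integration.integral_nonneg) auto
  define C where "C = \<bar>C0\<bar> * I + r powr a2 * W"
  have main: "integrable (jac b) (\<lambda>x. twopow a1 a2 (\<bar>x - z\<bar> / e)) \<and>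
     (LINT x|jac b. twopow a1 a2 (\<bar>x - z\<bar> / e)) \<le> C * e powr d" if e: "0 < e" "e \<le> r" for e
  proof -
    let ?T = "\<lambda>x. twopow a1 a2 (\<bar>x - z\<bar> / e)"
    let ?h = "\<lambda>x. \<bar>C0\<bar> * e powr (d - 1) * twopow (a1 + d - 1) (a2 + d - 1) (\<bar>x - z\<bar> / e)
       + (r / e) powr a2 * (indicator {-1<..<1} x *\<^sub>R (1 - x\<^sup>2) powr b)"
    have i1: "integrable lborel (\<lambda>x. twopow (a1 + d - 1) (a2 + d - 1) (\<bar>x - z\<bar> / e))"
      by (rule integrable_twopow_scaled) (use a e in auto)
    have i2: "integrable lborel (\<lambda>x::real. indicator {-1<..<1} x *\<^sub>R (1 - x\<^sup>2) powr b)"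
      using set_integrable_jac_weight[OF b] by (simp add: set_integrable_def)
    have ih: "integrable lborel ?h"
      by (intro Bochner_Integration.integrable_add integrable_mult_right i1 i2)
    have le: "norm (indicator {-1<..<1} x *\<^sub>R ((1 - x\<^sup>2) powr b * ?T x)) \<le> ?h x" if "x \<noteq> z" for x
    proof (cases "x \<in> {-1<..<1}")
      case x: True
      have t: "\<bar>x - z\<bar> / e > 0" using that e by auto
      show ?thesis
      proof (cases "\<bar>x - z\<bar> \<le> r")
        case True
        have "(1 - x\<^sup>2) powr b * ?T x \<le> (C0 * \<bar>x - z\<bar> powr (d - 1)) * ?T x"
          by (intro mult_right_mono C0 x that True) simp
        also have "\<dots> \<le> (\<bar>C0\<bar> * \<bar>x - z\<bar> powr (d - 1)) * ?T x"
          by (intro mult_right_mono) auto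
        also have "\<bar>x - z\<bar> powr (d - 1) = e powr (d - 1) * (\<bar>x - z\<bar> / e) powr (d - 1)"
          using e by (subst powr_mult[symmetric]) auto
        also have "\<bar>C0\<bar> * (e powr (d - 1) * (\<bar>x - z\<bar> / e) powr (d - 1)) * ?T x =
           \<bar>C0\<bar> * e powr (d - 1) * twopow (a1 + d - 1) (a2 + d - 1) (\<bar>x - z\<bar> / e)"
        proof -
          have "(\<bar>x - z\<bar> / e) powr (d - 1) * ?T x = twopow (a1 + d - 1) (a2 + d - 1) (\<bar>x - z\<bar> / e)"
            unfolding twopow_def using powr_add[of "\<bar>x - z\<bar> / e" "d - 1" a1] powr_add[of "\<bar>x - z\<bar> / e" "d - 1" a2] by (simp add: algebra_simps)
          then show ?thesis by (simp only: mult.assoc)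
        qed
        also have "\<dots> \<le> ?h x" by simp
        finally show ?thesis using x by (simp add: abs_mult)
      next
        case False
        then have "\<bar>x - z\<bar> / e > 1" using e by (auto simp: field_simps)
        then have "?T x = (\<bar>x - z\<bar> / e) powr a2" by (simp add: twopow_def)
        also have "\<dots> \<le> (r / e) powr a2"
          using False e r a d by (intro powr_mono2') (auto simp: field_simps)
        finally have "(1 - x\<^sup>2) powr b * ?T x \<le> (1 - x\<^sup>2) powr b * (r / e) powr a2"
          by (intro mult_left_mono) auto
        also have "\<dots> \<le> ?h x" using x by (simp add: mult_ac)
        finally show ?thesis using x by (simp add: abs_mult)
      qed
    next
      case False then show ?thesis by simp
    qed
    have AE: "AE x in lborel. norm (indicator {-1<..<1} x *\<^sub>R ((1 - x\<^sup>2) powr b * ?T x)) \<le> ?h x"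
      using AE_lborel_singleton[of z] by eventually_elim (rule le)
    have meas: "?T \<in> borel_measurable (jac b)" by (intro measurable_jac_borel) measurable
    have int: "integrable lborel (\<lambda>x. indicator {-1<..<1} x *\<^sub>R ((1 - x\<^sup>2) powr b * ?T x))"
      by (rule Bochner_Integration.integrable_bound[OF ih])
        (measurable, rule eventually_mono[OF AE], unfold real_norm_def, erule order_trans, rule abs_ge_self)
    have 1: "integrable (jac b) ?T" using int by (simp add: integrable_jac_iff[OF meas] set_integrable_def)
    have "integral\<^sup>L (jac b) ?T = (LINT x|lborel. indicator {-1<..<1} x *\<^sub>R ((1 - x\<^sup>2) powr b * ?T x))"
      by (simp add: integral_jac[OF meas] set_lebesgue_integral_def)
    also have "\<dots> \<le> integral\<^sup>L lborel ?h"
    proof (rule integral_mono_AE[OF int ih])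
      show "AE x in lborel. indicator {-1<..<1} x *\<^sub>R ((1 - x\<^sup>2) powr b * ?T x) \<le> ?h x"
        using AE unfolding real_norm_def by eventually_elim (rule abs_le_D1)
    qed
    also have "\<dots> = \<bar>C0\<bar> * e powr (d - 1) * (e * I) + (r / e) powr a2 * W"
      using i1 i2 integrable_twopow_scaled(2)[of "a1+d-1" "a2+d-1" e z] a e
      by (simp add: I_def W_def set_lebesgue_integral_def)
    also have "e powr (d - 1) * (e * I) = e powr d * I"
      using e by (simp add: powr_diff)
    then have "\<bar>C0\<bar> * e powr (d - 1) * (e * I) = \<bar>C0\<bar> * I * e powr d"
      by (simp only: mult.assoc) (simp only: mult.commute)
    also have "(r / e) powr a2 = r powr a2 * e powr (- a2)"
      using e r by (simp add: powr_divide powr_minus_divide)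
    also have "\<dots> \<le> r powr a2 * e powr d"
      using e r a by (intro mult_left_mono powr_mono') auto
    finally have "integral\<^sup>L (jac b) ?T \<le> C * e powr d"
      using W by (simp add: C_def distrib_right mult_right_mono mult.assoc mult.commute[of W])
    with 1 show ?thesis by blast
  qed
  have "C \<ge> 0" using W I by (auto simp: C_def)
  with main r show thesis using that by blast
qed

section \<open>Square-integrable functions and orthogonal projection\<close>

definition L2 :: "real \<Rightarrow> (real \<Rightarrow> real) \<Rightarrow> bool" where
  "L2 b u \<longleftrightarrow> u \<in> borel_measurable (jac b) \<and> integrable (jac b) (\<lambda>x. (u x)\<^sup>2)"

definition ip :: "real \<Rightarrow> (real \<Rightarrow> real) \<Rightarrow> (real \<Rightarrow> real) \<Rightarrow> real" where
  "ip b u v = (LINT x|jac b. u x * v x)"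

lemma L2_measurable: "L2 b u \<Longrightarrow> u \<in> borel_measurable (jac b)"
  by (simp add: L2_def)

lemma L2_mult_integrable:
  assumes "L2 b u" "L2 b v"
  shows "integrable (jac b) (\<lambda>x. u x * v x)"
proof (rule Bochner_Integration.integrable_bound)
  show "integrable (jac b) (\<lambda>x. (u x)\<^sup>2 + (v x)\<^sup>2)"
    using assms by (auto simp: L2_def)
  show "(\<lambda>x. u x * v x) \<in> borel_measurable (jac b)"
    using assms by (intro borel_measurable_times) (auto simp: L2_def)
  have "\<bar>a * c\<bar> \<le> a\<^sup>2 + c\<^sup>2" for a c :: real
    using sum_squares_bound[of "\<bar>a\<bar>" "\<bar>c\<bar>"] mult_nonneg_nonneg[OF abs_ge_zero abs_ge_zero, of a c]
    unfolding abs_mult power2_abs mult.assoc by linarith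
  then show "AE x in jac b. norm (u x * v x) \<le> norm ((u x)\<^sup>2 + (v x)\<^sup>2)" by simp
qed

lemma L2_add: assumes "L2 b u" "L2 b v" shows "L2 b (\<lambda>x. u x + v x)"
proof -
  have "integrable (jac b) (\<lambda>x. (u x)\<^sup>2 + (v x)\<^sup>2 + 2 * (u x * v x))"
    using assms L2_mult_integrable[OF assms] by (auto simp: L2_def)
  then have "integrable (jac b) (\<lambda>x. (u x + v x)\<^sup>2)" by (simp add: power2_sum mult.assoc)
  then show ?thesis using assms by (auto simp: L2_def)
qed

lemma L2_cmult: assumes "L2 b u" shows "L2 b (\<lambda>x. c * u x)"
  using assms by (auto simp: L2_def power_mult_distrib)

lemma L2_diff: assumes "L2 b u" "L2 b v" shows "L2 b (\<lambda>x. u x - v x)"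
  using L2_add[OF assms(1) L2_cmult[OF assms(2), of "-1"]] by simp

lemma L2_zero: "L2 b (\<lambda>x. 0)" by (simp add: L2_def)

lemma L2_sum: "(\<And>i. i \<in> I \<Longrightarrow> L2 b (u i)) \<Longrightarrow> L2 b (\<lambda>x. \<Sum>i\<in>I. u i x)"
  by (induction I rule: infinite_finite_induct) (auto simp: L2_zero L2_add)

lemma L2_cong:
  assumes "\<And>x. x \<in> {-1<..<1} \<Longrightarrow> u x = v x"
  shows "L2 b u \<longleftrightarrow> L2 b v"
proof -
  have "u \<in> borel_measurable (jac b) \<longleftrightarrow> v \<in> borel_measurable (jac b)"
    by (rule measurable_cong) (use assms in auto)
  moreover have "integrable (jac b) (\<lambda>x. (u x)\<^sup>2) \<longleftrightarrow> integrable (jac b) (\<lambda>x. (v x)\<^sup>2)"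
    by (rule Bochner_Integration.integrable_cong) (use assms in auto)
  ultimately show ?thesis by (simp add: L2_def)
qed

lemma ip_commute: "ip b u v = ip b v u" by (simp add: ip_def mult.commute)

lemma ip_cong:
  assumes "\<And>x. x \<in> {-1<..<1} \<Longrightarrow> u x = u' x" "\<And>x. x \<in> {-1<..<1} \<Longrightarrow> v x = v' x"
  shows "ip b u v = ip b u' v'"
  unfolding ip_def by (rule Bochner_Integration.integral_cong) (use assms in auto)

lemma ip_cong_neq:
  assumes "\<And>x. x \<in> {-1<..<1} \<Longrightarrow> x \<noteq> z \<Longrightarrow> u x = u' x" "\<And>x. x \<in> {-1<..<1} \<Longrightarrow> x \<noteq> z \<Longrightarrow> v x = v' x"
    "L2 b u" "L2 b v" "L2 b u'" "L2 b v'"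
  shows "ip b u v = ip b u' v'"
  unfolding ip_def
proof (rule integral_cong_AE)
  show "(\<lambda>x. u x * v x) \<in> borel_measurable (jac b)" "(\<lambda>x. u' x * v' x) \<in> borel_measurable (jac b)"
    using assms(3-6) by (auto simp: L2_def)
  show "AE x in jac b. u x * v x = u' x * v' x"
    using AE_jac_neq[of z b] AE_space[of "jac b"] by eventually_elim (use assms(1,2) in auto)
qed

lemma ip_add_left: "L2 b u \<Longrightarrow> L2 b v \<Longrightarrow> L2 b w \<Longrightarrow> ip b (\<lambda>x. u x + v x) w = ip b u w + ip b v w"
  unfolding ip_def by (simp add: distrib_right L2_mult_integrable)

lemma ip_diff_left: "L2 b u \<Longrightarrow> L2 b v \<Longrightarrow> L2 b w \<Longrightarrow> ip b (\<lambda>x. u x - v x) w = ip b u w - ip b v w"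
  unfolding ip_def by (simp add: left_diff_distrib L2_mult_integrable)

lemma ip_cmult_left: "ip b (\<lambda>x. c * u x) w = c * ip b u w"
  unfolding ip_def by (simp add: mult.assoc)

lemma ip_zero_left [simp]: "ip b (\<lambda>x. 0) w = 0" by (simp add: ip_def)

lemma ip_sum_left:
  "(\<And>i. i \<in> I \<Longrightarrow> L2 b (u i)) \<Longrightarrow> L2 b w \<Longrightarrow> ip b (\<lambda>x. \<Sum>i\<in>I. u i x) w = (\<Sum>i\<in>I. ip b (u i) w)"
  by (induction I rule: infinite_finite_induct) (auto simp: ip_add_left L2_sum)

lemmas ip_add_right = ip_add_left[of b u v w, unfolded ip_commute[of b _ w]] for b u v w
lemmas ip_diff_right = ip_diff_left[of b u v w, unfolded ip_commute[of b _ w]] for b u v w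
lemmas ip_cmult_right = ip_cmult_left[of b c u w, unfolded ip_commute[of b _ w]] for b c u w

abbreviation sqn :: "real \<Rightarrow> (real \<Rightarrow> real) \<Rightarrow> real" where
  "sqn b u \<equiv> ip b u u"

abbreviation sqd :: "real \<Rightarrow> (real \<Rightarrow> real) \<Rightarrow> (real \<Rightarrow> real) \<Rightarrow> real" where
  "sqd b u v \<equiv> sqn b (\<lambda>x. u x - v x)"

lemma ip_self_nonneg: "sqn b u \<ge> 0"
  unfolding ip_def by (rule Bochner_Integration.integral_nonneg) auto

lemma ip_self: "sqn b u = (LINT x|jac b. (u x)\<^sup>2)"
  by (simp add: ip_def power2_eq_square)

lemma ip_self_add:
  assumes "L2 b u" "L2 b v"
  shows "sqn b (\<lambda>x. u x + v x) = sqn b u + 2 * ip b u v + sqn b v"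
  using assms by (simp add: ip_add_left ip_add_right L2_add ip_commute[of b v u])

lemma ip_self_add_le:
  assumes "L2 b u" "L2 b v"
  shows "sqn b (\<lambda>x. u x + v x) \<le> 2 * sqn b u + 2 * sqn b v"
proof -
  have "0 \<le> sqd b u v" by (rule ip_self_nonneg)
  also have "\<dots> = sqn b u - 2 * ip b u v + sqn b v"
    using assms by (simp add: ip_diff_left ip_diff_right L2_diff ip_commute[of b v u])
  finally show ?thesis using ip_self_add[OF assms] by simp
qed

lemma ip_Cauchy_Schwarz:
  assumes "L2 b u" "L2 b v"
  shows "(ip b u v)\<^sup>2 \<le> sqn b u * sqn b v"
proof -
  have q: "0 \<le> sqn b u + 2 * t * ip b u v + t\<^sup>2 * sqn b v" for t
    using ip_self_nonneg[of b "\<lambda>x. u x + t * v x"] ip_self_add[OF assms(1) L2_cmult[OF assms(2), of t]]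
    by (simp add: ip_cmult_left ip_cmult_right power2_eq_square mult_ac)
  show ?thesis
  proof (cases "sqn b v = 0")
    case True
    have "ip b u v = 0"
    proof (rule ccontr)
      assume n: "ip b u v \<noteq> 0"
      \<comment> \<open>When \<open>sqn b v = 0\<close> the quadratic in \<open>t\<close> is affine,
        and this value of \<open>t\<close> gives it the value -1.\<close>
      show False using q[of "- (sqn b u + 1) / (2 * ip b u v)"] n True by (simp add: field_simps)
    qed
    then show ?thesis by (simp add: ip_self_nonneg)
  next
    case False
    then have p: "sqn b v > 0" using ip_self_nonneg[of b v] by simp
    have "0 \<le> sqn b u + 2 * (- ip b u v / sqn b v) * ip b u v + (- ip b u v / sqn b v)\<^sup>2 * sqn b v"
      by (rule q)
    also have "\<dots> = sqn b u - (ip b u v)\<^sup>2 / sqn b v"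
      using p by (simp add: field_simps power2_eq_square)
    finally show ?thesis using p by (simp add: field_simps)
  qed
qed

lemma L2_bounded:
  assumes "b > -1" "u \<in> borel_measurable (jac b)" "\<And>x. x \<in> {-1<..<1} \<Longrightarrow> \<bar>u x\<bar> \<le> C"
  shows "L2 b u"
proof -
  have "integrable (jac b) (\<lambda>x. (u x)\<^sup>2)"
  proof (rule integrable_jac_bounded[OF assms(1), where C = "C\<^sup>2"])
    show "(\<lambda>x. (u x)\<^sup>2) \<in> borel_measurable (jac b)" using assms(2) by measurable
    show "\<bar>(u x)\<^sup>2\<bar> \<le> C\<^sup>2" if "x \<in> {-1<..<1}" for x
      using assms(3)[OF that] by (simp add: abs_le_square_iff[symmetric])
  qed
  then show ?thesis using assms(2) by (simp add: L2_def)
qed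

lemma L2_continuous:
  assumes "b > -1" "continuous_on {-1..1} u"
  shows "L2 b u"
proof -
  have "bounded (u ` {-1..1})"
    by (intro compact_imp_bounded compact_continuous_image assms) auto
  then obtain C where "\<And>x. x \<in> {-1..1} \<Longrightarrow> \<bar>u x\<bar> \<le> C" unfolding bounded_iff real_norm_def by blast
  then show ?thesis
    by (intro L2_bounded[OF assms(1) measurable_jac_continuous[OF assms(2)], of C]) auto
qed

lemma L2_poly: "b > -1 \<Longrightarrow> L2 b (poly p)"
  by (rule L2_continuous) (auto intro!: continuous_intros)

definition mass :: "real \<Rightarrow> real" where "mass b = (LINT x|jac b. 1)"

lemma ip_self_bounded:
  assumes "b > -1" "u \<in> borel_measurable (jac b)" "\<And>x. x \<in> {-1<..<1} \<Longrightarrow> \<bar>u x\<bar> \<le> C"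
  shows "sqn b u \<le> C\<^sup>2 * mass b"
proof -
  have "sqn b u \<le> (LINT x|jac b. C\<^sup>2 * 1)"
    unfolding ip_self
  proof (rule integral_mono)
    show "integrable (jac b) (\<lambda>x. (u x)\<^sup>2)" using L2_bounded[OF assms] by (simp add: L2_def)
    show "integrable (jac b) (\<lambda>x. C\<^sup>2 * 1)" using integrable_jac_const[OF assms(1)] by simp
    show "(u x)\<^sup>2 \<le> C\<^sup>2 * 1" if "x \<in> space (jac b)" for x
      using assms(3)[of x] that by (simp add: abs_le_square_iff[symmetric])
  qed
  also have "\<dots> = C\<^sup>2 * mass b" unfolding mass_def by (rule integral_mult_right_zero)
  finally show ?thesis .
qed

lemma mass_nonneg: "mass b \<ge> 0"
  unfolding mass_def by (rule Bochner_Integration.integral_nonneg) simp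

text \<open>If the norm were 0, almost every point of the interval would be one of the finitely many
  roots.\<close>

lemma ip_poly_self_pos:
  assumes "b > -1" "p \<noteq> 0"
  shows "sqn b (poly p) > 0"
proof (rule ccontr)
  assume "\<not> ?thesis"
  then have z: "(LINT x|jac b. (poly p x)\<^sup>2) = 0"
    using ip_self_nonneg[of b "poly p"] unfolding ip_self by linarith
  have "integrable (jac b) (\<lambda>x. (poly p x)\<^sup>2)" using L2_poly[OF assms(1)] by (simp add: L2_def)
  then have "AE x in jac b. (poly p x)\<^sup>2 = 0"
    using z integral_nonneg_eq_0_iff_AE[of "jac b" "\<lambda>x. (poly p x)\<^sup>2"] by auto
  then have "AE x in restrict_space lborel {-1<..<1}. (1 - x\<^sup>2) powr b > 0 \<longrightarrow> poly p x = 0"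
    unfolding jac_def by (subst (asm) AE_density) (auto intro!: measurable_restrict_space1)
  then have "AE x in lborel. x \<in> {-1<..<1} \<longrightarrow> (1 - x\<^sup>2) powr b > 0 \<longrightarrow> poly p x = 0"
    by (subst (asm) AE_restrict_space_iff) auto
  then have "AE x in lborel. x \<notin> {-1<..<1::real}"
  proof -
    have "finite {x. poly p x = 0}" using assms(2) by (rule poly_roots_finite)
    then have "{x. poly p x = 0} \<in> null_sets lborel" by (rule finite_imp_null_set_lborel)
    then have "AE x in lborel. x \<notin> {x. poly p x = 0}" by (rule AE_not_in)
    with \<open>AE x in lborel. x \<in> {-1<..<1} \<longrightarrow> _\<close> show ?thesis
      by eventually_elim (auto simp: power2_eq_1_iff)
  qed
  then have "emeasure lborel {-1<..<1::real} = 0"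
    by (subst (asm) AE_iff_measurable[of "{-1<..<1::real}"]) (auto simp: greaterThanLessThan_def)
  then show False by simp
qed

text \<open>Characterising the projection by orthogonality, not by coefficients, makes it
  independent of any basis; this is what allows it to be differentiated.\<close>

definition proj_of :: "real \<Rightarrow> nat \<Rightarrow> (real \<Rightarrow> real) \<Rightarrow> real poly \<Rightarrow> bool" where
  "proj_of b N u p \<longleftrightarrow> degree p \<le> N \<and>
     (\<forall>r. degree r \<le> N \<longrightarrow> ip b (\<lambda>x. u x - poly p x) (poly r) = 0)"

lemma proj_of_Pythagoras:
  assumes "b > -1" "L2 b u" "proj_of b N u p" "degree r \<le> N"
  shows "sqd b u (poly r) =
    sqd b u (poly p) + sqn b (poly (p - r))"
proof -
  have "ip b (\<lambda>x. u x - poly p x) (poly (p - r)) = 0"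
    using assms degree_diff_le by (auto simp: proj_of_def)
  moreover have "(\<lambda>x. u x - poly r x) = (\<lambda>x. (u x - poly p x) + poly (p - r) x)" by auto
  ultimately show ?thesis
    using ip_self_add[of b "\<lambda>x. u x - poly p x" "poly (p - r)"] assms(1,2)
    by (simp add: L2_diff L2_poly)
qed

lemma proj_of_best:
  assumes "b > -1" "L2 b u" "proj_of b N u p" "degree r \<le> N"
  shows "sqd b u (poly p) \<le> sqd b u (poly r)"
  using proj_of_Pythagoras[OF assms] ip_self_nonneg[of b "poly (p - r)"] by simp

text \<open>The total mass is finite, so uniform approximation on the closed interval implies
  approximation in the weighted norm.\<close>

lemma Weierstrass_jac:
  assumes b: "b > -1" and u: "continuous_on {-1..1} u" and e: "e > 0"
  shows "\<exists>p. sqd b u (poly p) < e"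
proof -
  define d where "d = sqrt (e / (2 * (mass b + 1)))"
  have d: "d > 0" using e mass_nonneg[of b] by (auto simp: d_def)
  have dm: "d\<^sup>2 * mass b < e"
  proof -
    have "d\<^sup>2 = e / (2 * (mass b + 1))" using e mass_nonneg[of b] by (simp add: d_def)
    also have "\<dots> * mass b < e" using e mass_nonneg[of b] by (simp add: field_simps add_nonneg_pos)
    finally show ?thesis .
  qed
  obtain g where g: "real_polynomial_function g" "\<And>x. x \<in> {-1..1} \<Longrightarrow> \<bar>u x - g x\<bar> < d"
    using Stone_Weierstrass_real_polynomial_function[OF _ u d] by auto
  obtain a n where a: "g = (\<lambda>x. \<Sum>i\<le>n. a i * x ^ i)"
    using g(1) unfolding real_polynomial_function_iff_sum by blast
  define p where "p = (\<Sum>i\<le>n. monom (a i) i)"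
  have "poly p x = g x" for x by (simp add: p_def a poly_sum poly_monom)
  moreover have "sqd b u g \<le> d\<^sup>2 * mass b"
  proof (rule ip_self_bounded[OF b])
    show "(\<lambda>x. u x - g x) \<in> borel_measurable (jac b)"
      by (rule measurable_jac_continuous) (auto intro!: continuous_intros u simp: a)
    show "\<bar>u x - g x\<bar> \<le> d" if "x \<in> {-1<..<1}" for x using g(2)[of x] that by simp
  qed
  ultimately show ?thesis using dm by (intro exI[of _ p]) simp
qed

section \<open>Eigenpolynomials and the weighted Poincare inequality\<close>

text \<open>\<open>jop b\<close> is the adjoint of differentiation:
  \<open>((1 - x\<^sup>2)\<^bsup>b + 1\<^esup> p)' = - (1 - x\<^sup>2)\<^sup>b jop b p\<close>.\<close>
definition jop :: "real \<Rightarrow> real poly \<Rightarrow> real poly" where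
  "jop b p = [:0, 2 * b + 2:] * p - [:1, 0, -1:] * pderiv p"

lemma poly_jop: "poly (jop b p) x = (2 * b + 2) * x * poly p x - (1 - x\<^sup>2) * poly (pderiv p) x"
  by (simp add: jop_def power2_eq_square algebra_simps)

lemma degree_jop_le: "degree p \<le> n \<Longrightarrow> degree (jop b p) \<le> Suc n"
proof -
  assume p: "degree p \<le> n"
  have "degree ([:0, 2 * b + 2:] * p) \<le> Suc n"
    by (rule order_trans[OF degree_mult_le]) (use p in auto)
  moreover have "degree ([:1, 0, -1:] * pderiv p) \<le> Suc n"
  proof (cases "degree p = 0")
    case True then show ?thesis by (simp add: pderiv_eq_0_iff[THEN iffD2])
  next
    case False
    show ?thesis
      by (rule order_trans[OF degree_mult_le]) (use p False in \<open>auto simp: degree_pderiv\<close>)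
  qed
  ultimately show ?thesis unfolding jop_def by (rule degree_diff_le)
qed

text \<open>Testing against polynomials suffices, since only projections onto polynomials are compared.\<close>
definition weakder :: "real \<Rightarrow> (real \<Rightarrow> real) \<Rightarrow> (real \<Rightarrow> real) \<Rightarrow> bool" where
  "weakder b u u1 \<longleftrightarrow> (\<forall>p. ip (b + 1) u1 (poly p) = ip b u (poly (jop b p)))"

lemma ip_lebesgue:
  assumes "L2 b u" "L2 b v"
  shows "set_integrable lborel {-1<..<1} (\<lambda>x. (1 - x\<^sup>2) powr b * (u x * v x))"
    "ip b u v = (LINT x:{-1<..<1}|lborel. (1 - x\<^sup>2) powr b * (u x * v x))"
proof -
  have m: "(\<lambda>x. u x * v x) \<in> borel_measurable (jac b)"
    using assms by (intro borel_measurable_times L2_measurable)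
  show "set_integrable lborel {-1<..<1} (\<lambda>x. (1 - x\<^sup>2) powr b * (u x * v x))"
    using L2_mult_integrable[OF assms] by (simp add: integrable_jac_iff[OF m])
  show "ip b u v = (LINT x:{-1<..<1}|lborel. (1 - x\<^sup>2) powr b * (u x * v x))"
    unfolding ip_def by (rule integral_jac[OF m])
qed

text \<open>Integration by parts for \<open>H\<close>, the weight of exponent \<open>b + 1\<close>
  times \<open>p u\<close>. As \<open>b + 1 > 0\<close>, \<open>H\<close> is continuous up to the
  end points and vanishes there, so no boundary term appears and differentiability is needed only
  inside.\<close>

lemma weakder_C1:
  assumes b: "b > -1" and u: "continuous_on {-1..1} u" and u1: "continuous_on {-1..1} u1"
    and d: "\<And>x. x \<in> {-1<..<1} \<Longrightarrow> (u has_real_derivative u1 x) (at x)"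
  shows "weakder b u u1"
  unfolding weakder_def
proof
  fix p
  define H where "H = (\<lambda>x. (1 - x\<^sup>2) powr (b + 1) * poly p x * u x)"
  define h where "h = (\<lambda>x. (1 - x\<^sup>2) powr (b + 1) * (u1 x * poly p x) - (1 - x\<^sup>2) powr b * (u x * poly (jop b p) x))"
  have pos: "1 - x\<^sup>2 > 0" if "x \<in> {-1<..<1}" for x :: real
    using that by (simp add: abs_square_less_1 abs_less_iff)
  have dH: "(H has_real_derivative h x) (at x)" if x: "x \<in> {-1<..<1}" for x
  proof -
    have "((\<lambda>x. (1 - x\<^sup>2) powr (b + 1)) has_real_derivative (b + 1) * (1 - x\<^sup>2) powr b * (- (2 * x))) (at x)"
      using pos[OF x] by (auto intro!: derivative_eq_intros simp: has_real_derivative_powr powr_diff field_simps)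
    then have "(H has_real_derivative
        ((b + 1) * (1 - x\<^sup>2) powr b * (- (2 * x)) * poly p x + poly (pderiv p) x * (1 - x\<^sup>2) powr (b + 1)) * u x
          + u1 x * ((1 - x\<^sup>2) powr (b + 1) * poly p x)) (at x)"
      unfolding H_def by (intro DERIV_mult d x poly_DERIV)
    moreover have W: "(1 - x\<^sup>2) powr (b + 1) = (1 - x\<^sup>2) powr b * (1 - x\<^sup>2)"
      using pos[OF x] by (simp add: powr_add)
    ultimately show ?thesis
      unfolding h_def poly_jop W by (elim DERIV_cong) (simp add: algebra_simps)
  qed
  have "continuous_on {-1..1} (\<lambda>x::real. (1 - x\<^sup>2) powr (b + 1))"
    using b by (intro continuous_on_powr' continuous_intros) (auto simp: abs_square_le_1 abs_le_iff)
  then have cH: "continuous_on {-1..1} H"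
    unfolding H_def by (intro continuous_on_mult u) (auto intro!: continuous_intros)
  have "(h has_integral (H 1 - H (-1))) {-1..1}"
    by (rule fundamental_theorem_of_calculus_interior[OF _ cH])
      (use dH in \<open>auto simp: has_real_derivative_iff_has_vector_derivative\<close>)
  then have hi: "(h has_integral 0) {-1<..<1}"
    using b by (simp add: H_def has_integral_Icc_iff_Ioo)
  have b1: "b + 1 > -1" using b by simp
  have L: "L2 (b + 1) u1" "L2 (b + 1) (poly p)" "L2 b u" "L2 b (poly (jop b p))"
    by (intro L2_continuous L2_poly b b1 u u1)+
  note i = ip_lebesgue[OF L(1,2)] ip_lebesgue[OF L(3,4)]
  have "ip (b + 1) u1 (poly p) - ip b u (poly (jop b p)) = (LINT x:{-1<..<1}|lborel. h x)"
    unfolding i(2,4) h_def by (rule set_integral_diff(2)[symmetric]) (use i in auto)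
  also have "\<dots> = integral {-1<..<1} h"
    unfolding h_def by (rule set_borel_integral_eq_integral(2)[OF set_integral_diff(1)]) (use i in auto)
  also have "\<dots> = 0" using hi by (rule integral_unique)
  finally show "ip (b + 1) u1 (poly p) = ip b u (poly (jop b p))" by simp
qed

lemma weakder_poly: "b > -1 \<Longrightarrow> weakder b (poly q) (poly (pderiv q))"
  by (rule weakder_C1) (auto intro!: continuous_intros)

text \<open>\<open>jop\<close> raises the degree by at most one, so testing the derivative of the
  error against degree \<open>N - 1\<close> is testing the error itself against degree
  \<open>N\<close>.\<close>

lemma proj_of_pderiv:
  assumes b: "b > -1" and L: "L2 b u" "L2 (b + 1) u1" and w: "weakder b u u1"
    and p: "proj_of b N u p" and N: "N \<ge> 1"
  shows "proj_of (b + 1) (N - 1) u1 (pderiv p)"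
  unfolding proj_of_def
proof (intro conjI allI impI)
  show "degree (pderiv p) \<le> N - 1" using p by (simp add: degree_pderiv proj_of_def diff_le_mono)
  fix r :: "real poly" assume r: "degree r \<le> N - 1"
  have b1: "b + 1 > -1" using b by simp
  have "ip (b + 1) (\<lambda>x. u1 x - poly (pderiv p) x) (poly r) =
      ip b (\<lambda>x. u x - poly p x) (poly (jop b r))"
    using w weakder_poly[OF b, of p] b b1 L
    by (simp add: ip_diff_left L2_poly weakder_def)
  also have "\<dots> = 0" using p degree_jop_le[OF r] N by (simp add: proj_of_def)
  finally show "ip (b + 1) (\<lambda>x. u1 x - poly (pderiv p) x) (poly r) = 0" .
qed

text \<open>The equation is the Gegenbauer differential equation (1 - x^2) y'' - (2 b + 2) x y' + n
  (n + 2 b + 1) y = 0 with parameter b + 1/2. No normalisation is imposed, so that the Chebyshev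
  family fits as well.\<close>

definition eigpolys :: "real \<Rightarrow> (nat \<Rightarrow> real poly) \<Rightarrow> bool" where
  "eigpolys b e \<longleftrightarrow> (\<forall>n. degree (e n) = n \<and> e n \<noteq> 0 \<and>
     jop b (pderiv (e n)) = smult (real n * (real n + 2 * b + 1)) (e n))"

lemma pderiv_sum: "pderiv (\<Sum>i\<in>I. f i) = (\<Sum>i\<in>I. pderiv (f i))"
  by (induction I rule: infinite_finite_induct) (auto simp: pderiv_add)

lemma poly_smult_fun: "poly (smult c p) = (\<lambda>x. c * poly p x)" by auto

lemma eigpolys_energy:
  assumes "b > -1" "eigpolys b e"
  shows "real n * (real n + 2 * b + 1) * ip b (poly q) (poly (e n)) =
    ip (b + 1) (poly (pderiv q)) (poly (pderiv (e n)))"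
proof -
  have "ip (b + 1) (poly (pderiv q)) (poly (pderiv (e n))) = ip b (poly q) (poly (jop b (pderiv (e n))))"
    using weakder_poly[OF assms(1)] by (simp add: weakder_def)
  also have "jop b (pderiv (e n)) = smult (real n * (real n + 2 * b + 1)) (e n)"
    using assms(2) by (simp add: eigpolys_def)
  finally show ?thesis by (simp add: poly_smult_fun ip_cmult_right)
qed

text \<open>The energy form is symmetric, so the difference of the eigenvalues annihilates the inner
  product. It factors as (n - m)(n + m + 2 b + 1), and the second factor is positive because n + m
  is at least 1 and b > -1.\<close>

lemma eigpolys_orthogonal:
  assumes b: "b > -1" and e: "eigpolys b e" and mn: "m \<noteq> n"
  shows "ip b (poly (e m)) (poly (e n)) = 0"
proof -
  have "real n * (real n + 2 * b + 1) * ip b (poly (e m)) (poly (e n)) =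
      real m * (real m + 2 * b + 1) * ip b (poly (e m)) (poly (e n))"
    using eigpolys_energy[OF b e, of n "e m"] eigpolys_energy[OF b e, of m "e n"]
    by (simp add: ip_commute[of b "poly (e n)"] ip_commute[of "b+1" "poly (pderiv (e n))"])
  then have "(real n - real m) * (real n + real m + 2 * b + 1) * ip b (poly (e m)) (poly (e n)) = 0"
    by (simp add: algebra_simps)
  moreover have "real n + real m + 2 * b + 1 > 0"
  proof -
    have "real n + real m \<ge> 1" using mn by (cases n; cases m) auto
    then show ?thesis using b by linarith
  qed
  ultimately show ?thesis using mn by simp
qed

lemma eigpolys_span:
  assumes e: "eigpolys b e" and p: "degree p \<le> N"
  shows "\<exists>c. p = (\<Sum>n\<le>N. smult (c n) (e n))"
  using p
proof (induction N arbitrary: p)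
  case 0
  obtain a where a: "p = [:a:]" using 0 by (metis degree_eq_zeroE le_zero_eq)
  have "degree (e 0) = 0" "e 0 \<noteq> 0" using e by (auto simp: eigpolys_def)
  then obtain a0 where a0: "e 0 = [:a0:]" "a0 \<noteq> 0" by (metis degree_eq_zeroE pCons_0_0)
  show ?case by (rule exI[of _ "\<lambda>_. a / a0"]) (simp add: a a0)
next
  case (Suc N)
  have dE: "degree (e (Suc N)) = Suc N" "e (Suc N) \<noteq> 0" using e by (auto simp: eigpolys_def)
  then have lc: "coeff (e (Suc N)) (Suc N) \<noteq> 0" by (metis leading_coeff_0_iff)
  define a where "a = coeff p (Suc N) / coeff (e (Suc N)) (Suc N)"
  have "degree (p - smult a (e (Suc N))) \<le> N"
  proof (rule degree_le, intro allI impI)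
    fix i assume "N < i"
    show "coeff (p - smult a (e (Suc N))) i = 0"
    proof (cases "i = Suc N")
      case True then show ?thesis using lc by (simp add: a_def)
    next
      case False
      then have "coeff p i = 0" "coeff (e (Suc N)) i = 0"
        using \<open>N < i\<close> Suc.prems dE by (auto intro!: coeff_eq_0)
      then show ?thesis by simp
    qed
  qed
  from Suc.IH[OF this] obtain c where c: "p - smult a (e (Suc N)) = (\<Sum>n\<le>N. smult (c n) (e n))" by blast
  have "p = (\<Sum>n\<le>N. smult (c n) (e n)) + smult a (e (Suc N))" using c by (simp add: algebra_simps)
  also have "\<dots> = (\<Sum>n\<le>Suc N. smult ((c(Suc N := a)) n) (e n))" by simp
  finally show ?case by blast
qed

lemma poly_sum_smult_fun: "poly (\<Sum>n\<in>I. smult (c n) (e n)) = (\<lambda>x. \<Sum>n\<in>I. c n * poly (e n) x)"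
  by (auto simp: poly_sum)

lemma ip_eigpolys_sum:
  assumes "b > -1" "eigpolys b e"
  shows "ip b (poly (\<Sum>n\<le>N. smult (c n) (e n))) (poly (e k)) =
    (if k \<le> N then c k * sqn b (poly (e k)) else 0)"
proof -
  have "ip b (poly (\<Sum>n\<le>N. smult (c n) (e n))) (poly (e k)) = (\<Sum>n\<le>N. c n * ip b (poly (e n)) (poly (e k)))"
    unfolding poly_sum_smult_fun using assms(1)
    by (subst ip_sum_left) (auto intro: L2_cmult L2_poly simp: ip_cmult_left)
  also have "\<dots> = (\<Sum>n\<le>N. if n = k then c k * sqn b (poly (e k)) else 0)"
    using eigpolys_orthogonal[OF assms] by (intro sum.cong) auto
  finally show ?thesis by simp
qed

lemma eigpolys_proj_of:
  assumes b: "b > -1" and e: "eigpolys b e" and u: "L2 b u"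
  shows "proj_of b N u (\<Sum>n\<le>N. smult (ip b u (poly (e n)) / sqn b (poly (e n))) (e n))"
    (is "proj_of b N u ?p")
  unfolding proj_of_def
proof (intro conjI allI impI)
  have deg: "degree (e n) = n" "e n \<noteq> 0" for n using e by (auto simp: eigpolys_def)
  show "degree ?p \<le> N"
    by (intro degree_sum_le) (auto intro: order_trans[OF degree_smult_le] simp: deg)
  fix r :: "real poly" assume "degree r \<le> N"
  then obtain c where r: "r = (\<Sum>n\<le>N. smult (c n) (e n))" using eigpolys_span[OF e] by blast
  have z: "ip b (\<lambda>x. u x - poly ?p x) (poly (e k)) = 0" if "k \<le> N" for k
    using that ip_poly_self_pos[OF b deg(2)[of k]]
    by (simp add: ip_diff_left u L2_poly b ip_eigpolys_sum[OF b e])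
  have "ip b (\<lambda>x. u x - poly ?p x) (poly r) = (\<Sum>n\<le>N. c n * ip b (poly (e n)) (\<lambda>x. u x - poly ?p x))"
    unfolding r poly_sum_smult_fun[of c] ip_commute[of b "\<lambda>x. u x - poly ?p x"] using b u
    by (subst ip_sum_left) (auto intro: L2_cmult L2_diff L2_poly simp: ip_cmult_left)
  also have "\<dots> = 0" using z by (intro sum.neutral) (auto simp: ip_commute[of b _ "\<lambda>x. u x - poly ?p x"])
  finally show "ip b (\<lambda>x. u x - poly ?p x) (poly r) = 0" .
qed

lemma proj_of_0_Pythagoras:
  assumes "b > -1" "L2 b u" "proj_of b N u p"
  shows "sqn b u = sqd b u (poly p) + sqn b (poly p)"
  using proj_of_Pythagoras[OF assms, of 0] by simp

text \<open>In the eigenbasis the energy of the component of degree \<open>n\<close> is \<open>n (n + 2 b + 1)\<close>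
  times its squared norm; Weierstrass' theorem replaces completeness.\<close>
lemma Poincare_orthogonal:
  assumes b: "b > -1" and e: "eigpolys b e"
    and u: "continuous_on {-1..1} u" and u1: "continuous_on {-1..1} u1"
    and d: "\<And>x. x \<in> {-1<..<1} \<Longrightarrow> (u has_real_derivative u1 x) (at x)"
    and orth: "\<And>r. degree r \<le> N \<Longrightarrow> ip b u (poly r) = 0"
  shows "(real N)\<^sup>2 * sqn b u \<le> sqn (b + 1) u1"
proof (rule field_le_epsilon)
  fix eps :: real assume eps: "eps > 0"
  have b1: "b + 1 > -1" using b by simp
  have Lu: "L2 b u" and Lu1: "L2 (b + 1) u1" by (intro L2_continuous u u1 b b1)+
  have deg: "degree (e n) = n" "e n \<noteq> 0" for n using e by (auto simp: eigpolys_def)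
  obtain r where r: "sqd b u (poly r) < eps / ((real N)\<^sup>2 + 1)"
    using Weierstrass_jac[OF b u, of "eps / ((real N)\<^sup>2 + 1)"] eps by (auto simp: add_nonneg_pos)
  \<comment> \<open>Large enough for the Weierstrass polynomial \<open>r\<close> to compete with the
    projection \<open>v\<close>; the successor makes \<open>M\<close> positive, so that
    \<open>v\<close> can be differentiated as a projection.\<close>
  define M where "M = Suc (max (degree r) N)"
  define c where "c = (\<lambda>n. ip b u (poly (e n)) / sqn b (poly (e n)))"
  define v where "v = (\<Sum>n\<le>M. smult (c n) (e n))"
  have pv: "proj_of b M u v" unfolding v_def c_def by (rule eigpolys_proj_of[OF b e Lu])
  \<comment> \<open>The derivative of the projection is itself a projection of \<open>u1\<close>,
    hence its norm is at most that of \<open>u1\<close>.\<close>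
  have pv1: "proj_of (b + 1) (M - 1) u1 (pderiv v)"
    by (rule proj_of_pderiv[OF b Lu Lu1 weakder_C1[OF b u u1 d] pv]) (auto simp: M_def)
  have c0: "c n = 0" if "n \<le> N" for n using orth[of "e n"] that by (simp add: c_def deg)
  have "sqn (b + 1) (poly (pderiv v)) =
      (\<Sum>n\<le>M. c n * ip (b + 1) (poly (pderiv v)) (poly (pderiv (e n))))"
  proof -
    have "poly (pderiv v) = (\<lambda>x. \<Sum>n\<le>M. c n * poly (pderiv (e n)) x)"
      by (simp add: v_def pderiv_sum pderiv_smult poly_sum fun_eq_iff)
    then have "sqn (b + 1) (poly (pderiv v)) =
       ip (b + 1) (\<lambda>x. \<Sum>n\<le>M. c n * poly (pderiv (e n)) x) (poly (pderiv v))" by simp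
    also have "\<dots> = (\<Sum>n\<le>M. c n * ip (b + 1) (poly (pderiv (e n))) (poly (pderiv v)))"
      by (subst ip_sum_left) (rule L2_cmult L2_poly[OF b1] | simp only: ip_cmult_left)+
    also have "\<dots> = (\<Sum>n\<le>M. c n * ip (b + 1) (poly (pderiv v)) (poly (pderiv (e n))))"
      by (intro sum.cong refl arg_cong2[where f = "(*)"] ip_commute)
    finally show ?thesis .
  qed
  also have "\<dots> = (\<Sum>n\<le>M. real n * (real n + 2 * b + 1) * ((c n)\<^sup>2 * sqn b (poly (e n))))"
  proof (rule sum.cong[OF refl])
    fix n assume "n \<in> {..M}"
    then have "ip b (poly v) (poly (e n)) = c n * sqn b (poly (e n))"
      by (simp add: v_def ip_eigpolys_sum[OF b e])
    with eigpolys_energy[OF b e, of n v]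
    show "c n * ip (b + 1) (poly (pderiv v)) (poly (pderiv (e n))) =
      real n * (real n + 2 * b + 1) * ((c n)\<^sup>2 * sqn b (poly (e n)))"
      by (simp add: power2_eq_square mult_ac)
  qed
  also have "\<dots> \<ge> (\<Sum>n\<le>M. (real N)\<^sup>2 * ((c n)\<^sup>2 * sqn b (poly (e n))))"
  proof (rule sum_mono)
    fix n
    show "(real N)\<^sup>2 * ((c n)\<^sup>2 * sqn b (poly (e n)))
       \<le> real n * (real n + 2 * b + 1) * ((c n)\<^sup>2 * sqn b (poly (e n)))"
    proof (cases "n \<le> N")
      case True then show ?thesis by (simp add: c0)
    next
      case False
      \<comment> \<open>The strict inequality \<open>n > N\<close> gains one, which pays for
        \<open>2 * b + 1 > -1\<close>.\<close>
      then have "real N \<le> real n" "real N \<le> real n + 2 * b + 1" using b by linarith+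
      then have "(real N)\<^sup>2 \<le> real n * (real n + 2 * b + 1)"
        unfolding power2_eq_square by (intro mult_mono) auto
      then show ?thesis by (intro mult_right_mono) (auto simp: ip_self_nonneg)
    qed
  qed
  also have "(\<Sum>n\<le>M. (real N)\<^sup>2 * ((c n)\<^sup>2 * sqn b (poly (e n)))) = (real N)\<^sup>2 * sqn b (poly v)"
  proof -
    have "sqn b (poly v) = ip b (\<lambda>x. \<Sum>n\<le>M. c n * poly (e n) x) (poly v)"
      by (simp add: v_def poly_sum_smult_fun)
    also have "\<dots> = (\<Sum>n\<le>M. c n * ip b (poly (e n)) (poly v))"
      using b by (subst ip_sum_left) (auto intro: L2_cmult L2_poly simp: ip_cmult_left)
    also have "\<dots> = (\<Sum>n\<le>M. c n * ip b (poly v) (poly (e n)))"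
      by (intro sum.cong refl arg_cong2[where f = "(*)"] ip_commute)
    also have "\<dots> = (\<Sum>n\<le>M. (c n)\<^sup>2 * sqn b (poly (e n)))"
      by (intro sum.cong) (auto simp: v_def ip_eigpolys_sum[OF b e] power2_eq_square mult_ac)
    finally show ?thesis by (simp add: sum_distrib_left)
  qed
  finally have 1: "(real N)\<^sup>2 * sqn b (poly v) \<le> sqn (b + 1) (poly (pderiv v))" .
  have 2: "sqn (b + 1) (poly (pderiv v)) \<le> sqn (b + 1) u1"
    using proj_of_0_Pythagoras[OF b1 Lu1 pv1]
      ip_self_nonneg[of "b+1" "\<lambda>x. u1 x - poly (pderiv v) x"] by simp
  have "degree r \<le> M" by (simp add: M_def)
  from proj_of_best[OF b Lu pv this] r
  have "sqd b u (poly v) \<le> eps / ((real N)\<^sup>2 + 1)" by simp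
  then have "(real N)\<^sup>2 * sqd b u (poly v) \<le> (real N)\<^sup>2 * (eps / ((real N)\<^sup>2 + 1))"
    by (rule mult_left_mono) simp
  also have "\<dots> \<le> eps"
  proof -
    have "(real N)\<^sup>2 + 1 > 0" by (simp add: add_nonneg_pos)
    then show ?thesis using eps by (simp add: field_simps)
  qed
  finally show "(real N)\<^sup>2 * sqn b u \<le> sqn (b + 1) u1 + eps"
    using 1 2 proj_of_0_Pythagoras[OF b Lu pv] by (simp add: distrib_left)
qed

section \<open>Gegenbauer and Chebyshev polynomials\<close>

lemma real_poly_ext: "(\<And>x::real. poly p x = poly q x) \<Longrightarrow> p = q"
  by (simp add: poly_eq_poly_eq_iff[symmetric] fun_eq_iff)

text \<open>Differentiating the raising relation brings in the derivative of
  \<open>e (Suc n)\<close>, which the lowering relation removes; the raising relation itself then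
  removes \<open>e (Suc n)\<close>. Only the product \<open>c n * d n\<close> enters, so the two
  factors may reflect any normalisation.\<close>

lemma eigpolys_ladder:
  fixes e :: "nat \<Rightarrow> real poly"
  assumes deg: "\<And>n. degree (e n) = n \<and> e n \<noteq> 0"
    and lower: "\<And>n x. (1 - x\<^sup>2) * poly (pderiv (e (Suc n))) x = c n * poly (e n) x - real (Suc n) * x * poly (e (Suc n)) x"
    and raise: "\<And>n x. (1 - x\<^sup>2) * poly (pderiv (e n)) x = (real n + 2 * b + 1) * x * poly (e n) x - d n * poly (e (Suc n)) x"
    and cd: "\<And>n. c n * d n = real (Suc n) * (real n + 2 * b + 1)"
  shows "eigpolys b e"
  unfolding eigpolys_def
proof (intro allI conjI)
  fix n
  show "degree (e n) = n" "e n \<noteq> 0" using deg by auto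
  let ?W = "[:1, 0, -1:] :: real poly"
  have W: "poly ?W x = 1 - x\<^sup>2" for x by (simp add: power2_eq_square)
  have "?W * pderiv (e n) = smult (real n + 2 * b + 1) ([:0, 1:] * e n) - smult (d n) (e (Suc n))"
    by (rule real_poly_ext) (simp only: poly_mult poly_diff poly_smult W raise, simp)
  then have P: "pderiv (?W * pderiv (e n)) = pderiv (smult (real n + 2 * b + 1) ([:0, 1:] * e n) - smult (d n) (e (Suc n)))"
    by simp
  have pW: "pderiv ?W = [:0, -2:]" and pX: "pderiv [:0, 1:] = [:1 :: real:]" by (simp_all add: pderiv_pCons)
  have der: "(1 - x\<^sup>2) * poly (pderiv (pderiv (e n))) x - 2 * x * poly (pderiv (e n)) x =
     (real n + 2 * b + 1) * (poly (e n) x + x * poly (pderiv (e n)) x) - d n * poly (pderiv (e (Suc n))) x" for x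
    using arg_cong[OF P[unfolded pderiv_mult[of ?W] pderiv_diff pderiv_smult pderiv_mult[of "[:0, 1:]"] pW pX],
        of "\<lambda>p. poly p x"]
    by (simp add: power2_eq_square algebra_simps)
  \<comment> \<open>The ladder relations determine derivatives only after multiplication by 1 - x^2;
    the factor is cancelled at the end in the polynomial ring.\<close>
  have "?W * jop b (pderiv (e n)) = ?W * smult (real n * (real n + 2 * b + 1)) (e n)"
  proof (rule real_poly_ext)
    fix x
    define w p p1 p2 q q1 k where defs: "w = 1 - x\<^sup>2" "p = poly (e n) x" "p1 = poly (pderiv (e n)) x"
      "p2 = poly (pderiv (pderiv (e n))) x" "q = poly (e (Suc n)) x" "q1 = poly (pderiv (e (Suc n))) x" "k = real n + 2 * b + 1"
    have 1: "w * p2 = 2 * x * p1 + k * (p + x * p1) - d n * q1"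
      using der[of x] unfolding defs by simp
    have 2: "w * q1 = c n * p - (real n + 1) * x * q"
      using lower[of x n] unfolding defs by simp
    have 3: "d n * q = k * x * p - w * p1"
      using raise[of x n] unfolding defs by simp
    have "w * (d n * q1) = d n * (w * q1)" by simp
    also have "\<dots> = (c n * d n) * p - (real n + 1) * x * (d n * q)" unfolding 2 by (simp add: algebra_simps)
    also have "\<dots> = (real n + 1) * k * p - (real n + 1) * x * (k * x * p - w * p1)"
      unfolding 3 cd by (simp add: defs)
    also have "\<dots> = w * ((real n + 1) * k * p + (real n + 1) * x * p1)"
      unfolding defs(1) by (simp add: algebra_simps power2_eq_square)
    finally have 4: "w * (d n * q1) = w * ((real n + 1) * k * p + (real n + 1) * x * p1)" .
    have "w * ((2 * b + 2) * x * p1 - w * p2) = w * ((2 * b + 2) * x * p1 - (2 * x * p1 + k * (p + x * p1))) + w * (d n * q1)"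
      unfolding 1 by (simp add: algebra_simps)
    also have "\<dots> = w * (real n * k * p)"
      unfolding 4 by (simp add: defs(7) algebra_simps)
    finally show "poly (?W * jop b (pderiv (e n))) x = poly (?W * smult (real n * (real n + 2 * b + 1)) (e n)) x"
      unfolding poly_mult W poly_jop poly_smult by (simp add: defs)
  qed
  moreover have "?W \<noteq> 0" by simp
  ultimately show "jop b (pderiv (e n)) = smult (real n * (real n + 2 * b + 1)) (e n)"
    by (metis mult_left_cancel)
qed

lemma degree_three_term:
  fixes e :: "nat \<Rightarrow> real poly"
  assumes e0: "degree (e 0) = 0" "coeff (e 0) 0 \<noteq> 0" and e1: "degree (e (Suc 0)) \<le> 1" "coeff (e (Suc 0)) 1 \<noteq> 0"
    and rec: "\<And>n. e (Suc (Suc n)) = smult (A n) ([:0, 1:] * e (Suc n)) - smult (B n) (e n)"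
    and A: "\<And>n. A n \<noteq> 0"
  shows "degree (e n) = n \<and> e n \<noteq> 0"
proof -
  have "(degree (e n) \<le> n \<and> coeff (e n) n \<noteq> 0) \<and> (degree (e (Suc n)) \<le> Suc n \<and> coeff (e (Suc n)) (Suc n) \<noteq> 0)"
  proof (induction n)
    case 0 then show ?case using e0 e1 by simp
  next
    case (Suc n)
    have z: "coeff (e n) (Suc (Suc n)) = 0" using Suc by (intro coeff_eq_0) auto
    have "degree (e (Suc (Suc n))) \<le> Suc (Suc n)"
      unfolding rec using Suc
      by (auto intro!: degree_diff_le order_trans[OF degree_smult_le] order_trans[OF degree_pCons_le])
    moreover have "coeff (e (Suc (Suc n))) (Suc (Suc n)) \<noteq> 0"
      unfolding rec using Suc z A by auto
    ultimately show ?case using Suc by blast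
  qed
  then have "degree (e n) \<le> n" "coeff (e n) n \<noteq> 0" by auto
  then show ?thesis by (metis antisym coeff_0 le_degree)
qed

section \<open>Gegenbauer polynomials with nonzero parameter\<close>

fun gpoly :: "real \<Rightarrow> nat \<Rightarrow> real poly" where
  "gpoly lam 0 = 1"
| "gpoly lam (Suc 0) = [:0, 2 * lam:]"
| "gpoly lam (Suc (Suc n)) = smult (1 / (real n + 2))
     (smult (2 * (real n + 1 + lam)) ([:0, 1:] * gpoly lam (Suc n)) - smult (real n + 2 * lam) (gpoly lam n))"

lemma poly_gpoly: "poly (gpoly lam n) x = gegenbauer lam n x"
  by (induction lam n rule: gpoly.induct) (simp_all add: field_simps)

text \<open>At \<open>lam = 0\<close> the polynomial of degree 1 would be zero, which is why the
  Chebyshev family needs its own treatment. The bound on \<open>lam\<close> keeps all leading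
  factors \<open>n + 1 + lam\<close> nonzero.\<close>

lemma degree_gpoly:
  assumes "lam > -1/2" "lam \<noteq> 0"
  shows "degree (gpoly lam n) = n \<and> gpoly lam n \<noteq> 0"
proof (rule degree_three_term)
  show "gpoly lam (Suc (Suc n)) = smult (2 * (real n + 1 + lam) / (real n + 2)) ([:0, 1:] * gpoly lam (Suc n))
      - smult ((real n + 2 * lam) / (real n + 2)) (gpoly lam n)" for n
    by (simp add: smult_diff_right)
  show "2 * (real n + 1 + lam) / (real n + 2) \<noteq> 0" for n
    using assms by auto
qed (use assms in auto)

text \<open>The two relations are proved together because the next lowering relation needs both of
  the preceding ones.\<close>

lemma gpoly_ladder:
  fixes lam :: real
  shows "(1 - x\<^sup>2) * poly (pderiv (gpoly lam (Suc n))) x =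
      (real n + 2 * lam) * poly (gpoly lam n) x - real (Suc n) * x * poly (gpoly lam (Suc n)) x \<and>
    (1 - x\<^sup>2) * poly (pderiv (gpoly lam n)) x =
      (real n + 2 * lam) * x * poly (gpoly lam n) x - real (Suc n) * poly (gpoly lam (Suc n)) x"
proof (induction n)
  case 0
  then show ?case by (simp add: pderiv_pCons power2_eq_square algebra_simps)
next
  case (Suc n)
  define w p p1 q q1 r r1 k where defs: "w = 1 - x\<^sup>2" "p = poly (gpoly lam n) x" "p1 = poly (pderiv (gpoly lam n)) x"
    "q = poly (gpoly lam (Suc n)) x" "q1 = poly (pderiv (gpoly lam (Suc n))) x"
    "r = poly (gpoly lam (Suc (Suc n))) x" "r1 = poly (pderiv (gpoly lam (Suc (Suc n)))) x" "k = real n"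
  have k: "k + 2 \<noteq> 0" unfolding defs by simp
  have r: "(k + 2) * r = 2 * (k + 1 + lam) * (x * q) - (k + 2 * lam) * p"
    using k unfolding defs by simp
  have r1: "(k + 2) * r1 = 2 * (k + 1 + lam) * (q + x * q1) - (k + 2 * lam) * p1"
    using k unfolding defs by (simp add: pderiv_smult pderiv_diff pderiv_mult pderiv_pCons distrib_left)
  have A: "w * q1 = (k + 2 * lam) * p - (k + 1) * x * q" and B: "w * p1 = (k + 2 * lam) * x * p - (k + 1) * q"
    using Suc unfolding defs by auto
  have "(k + 2) * (w * r1) = w * ((k + 2) * r1)" by simp
  also have "\<dots> = 2 * (k + 1 + lam) * (w * q + x * (w * q1)) - (k + 2 * lam) * (w * p1)"
    unfolding r1 by (simp add: algebra_simps)
  also have "\<dots> = (k + 2) * ((k + 1 + 2 * lam) * q) - (k + 2) * x * (2 * (k + 1 + lam) * (x * q) - (k + 2 * lam) * p)"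
    unfolding A B unfolding defs(1) by (simp add: algebra_simps power2_eq_square)
  also have "\<dots> = (k + 2) * ((k + 1 + 2 * lam) * q - (k + 2) * x * r)"
    unfolding r[symmetric] by (simp add: algebra_simps)
  finally have "w * r1 = (k + 1 + 2 * lam) * q - (k + 2) * x * r" using k by simp
  moreover have "w * q1 = (k + 1 + 2 * lam) * x * q - (k + 2) * r"
    unfolding A r by (simp add: algebra_simps)
  ultimately show ?case unfolding defs by (simp add: add_ac)
qed

lemma eigpolys_gpoly:
  assumes "lam > -1/2" "lam \<noteq> 0"
  shows "eigpolys (lam - 1/2) (gpoly lam)"
  by (rule eigpolys_ladder[where c = "\<lambda>n. real n + 2 * lam" and d = "\<lambda>n. real (Suc n)"])
    (use degree_gpoly[OF assms] gpoly_ladder[THEN conjunct1] gpoly_ladder[THEN conjunct2] in auto)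

section \<open>Chebyshev polynomials\<close>

fun tpoly :: "nat \<Rightarrow> real poly" where
  "tpoly 0 = 1"
| "tpoly (Suc 0) = [:0, 1:]"
| "tpoly (Suc (Suc n)) = smult 2 ([:0, 1:] * tpoly (Suc n)) - tpoly n"

lemma poly_tpoly: "poly (tpoly n) x = chebyshev_T n x"
  by (induction n rule: tpoly.induct) simp_all

lemma degree_tpoly: "degree (tpoly n) = n \<and> tpoly n \<noteq> 0"
  by (rule degree_three_term[where A = "\<lambda>_. 2" and B = "\<lambda>_. 1"]) simp_all

lemma tpoly_ladder:
  "(1 - x\<^sup>2) * poly (pderiv (tpoly (Suc n))) x =
      real (Suc n) * poly (tpoly n) x - real (Suc n) * x * poly (tpoly (Suc n)) x \<and>
    (1 - x\<^sup>2) * poly (pderiv (tpoly n)) x =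
      real n * x * poly (tpoly n) x - real n * poly (tpoly (Suc n)) x"
proof (induction n)
  case 0
  then show ?case by (simp add: pderiv_pCons power2_eq_square algebra_simps)
next
  case (Suc n)
  define w p p1 q q1 k where defs: "w = 1 - x\<^sup>2" "p = poly (tpoly n) x" "p1 = poly (pderiv (tpoly n)) x"
    "q = poly (tpoly (Suc n)) x" "q1 = poly (pderiv (tpoly (Suc n))) x" "k = real n"
  have A: "w * q1 = (k + 1) * p - (k + 1) * x * q" and B: "w * p1 = k * x * p - k * q"
    using Suc unfolding defs by (auto simp: add.commute)
  have "w * (2 * (q + x * q1) - p1) = 2 * w * q + 2 * x * (w * q1) - w * p1"
    by (simp add: algebra_simps)
  also have "\<dots> = (k + 2) * q - (k + 2) * x * (2 * (x * q) - p)"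
    unfolding A B unfolding defs(1) by (simp add: algebra_simps power2_eq_square)
  finally have "w * (2 * (q + x * q1) - p1) = (k + 2) * q - (k + 2) * x * (2 * (x * q) - p)" .
  moreover have "w * q1 = (k + 1) * x * q - (k + 1) * (2 * (x * q) - p)"
    unfolding A by (simp add: algebra_simps)
  ultimately show ?case unfolding defs
    by (simp add: pderiv_smult pderiv_diff pderiv_mult pderiv_pCons add_ac distrib_left mult.left_commute)
qed

lemma eigpolys_tpoly: "eigpolys (-1/2) tpoly"
  by (rule eigpolys_ladder[where c = "\<lambda>n. real (Suc n)" and d = "\<lambda>n. real n"])
    (use degree_tpoly tpoly_ladder[THEN conjunct1] tpoly_ladder[THEN conjunct2] in auto)

text \<open>The two families together cover every weight with b > -1, hence also all weights
  \<open>b + r\<close> reached by iterating the Poincare inequality.\<close>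

lemma eigpolys_exists: "b > -1 \<Longrightarrow> \<exists>e. eigpolys b e"
  using eigpolys_gpoly[of "b + 1/2"] eigpolys_tpoly by (cases "b = -1/2") auto

section \<open>Partial sums as orthogonal projections\<close>

lemma gegenbauer_proj_of:
  assumes lam: "lam > -1/2" "lam \<noteq> 0" and f: "L2 (lam - 1/2) f"
  shows "\<exists>p. gegenbauer_proj lam f N = poly p \<and> proj_of (lam - 1/2) N f p"
proof -
  let ?b = "lam - 1/2" and ?e = "gpoly lam"
  have b: "?b > -1" using lam by simp
  have "gegenbauer_coeff lam f n = ip ?b f (poly (?e n)) / sqn ?b (poly (?e n))" for n
    unfolding gegenbauer_coeff_def gegenbauer_h_def ip_lebesgue(2)[OF f L2_poly[OF b]]
      ip_lebesgue(2)[OF L2_poly[OF b] L2_poly[OF b]]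
    by (simp add: poly_gpoly power2_eq_square mult_ac)
  then have "gegenbauer_proj lam f N =
      poly (\<Sum>n\<le>N. smult (ip ?b f (poly (?e n)) / sqn ?b (poly (?e n))) (?e n))"
    by (simp add: fun_eq_iff gegenbauer_proj_def poly_sum poly_gpoly)
  then show ?thesis using eigpolys_proj_of[OF b eigpolys_gpoly[OF lam] f] by blast
qed

lemma powr_minus_half: "x \<in> {-1<..<1} \<Longrightarrow> (1 - x\<^sup>2) powr (- (1 / 2)) = 1 / sqrt (1 - x\<^sup>2)" for x :: real
proof -
  assume "x \<in> {-1<..<1}"
  then have "1 - x\<^sup>2 > 0" by (simp add: abs_square_less_1 abs_less_iff)
  then show ?thesis using powr_minus_divide[of "1 - x\<^sup>2" "1/2"] by (simp add: powr_half_sqrt)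
qed

text \<open>The antiderivative is arcsin. The value is needed because the Chebyshev coefficients
  carry explicit factors 1/pi and 2/pi in place of a norm.\<close>

lemma mass_chebyshev: "sqn (-1/2) (\<lambda>x. 1) = pi"
proof -
  have A: "((arcsin \<circ> real_of_ereal) \<longlongrightarrow> - (pi/2)) (at_right (-1))"
    "((arcsin \<circ> real_of_ereal) \<longlongrightarrow> pi/2) (at_left 1)"
  proof -
    have c: "continuous_on {-1..1} arcsin" by (rule continuous_on_arcsin')
    have "(arcsin \<longlongrightarrow> arcsin 1) (at_left 1)" "(arcsin \<longlongrightarrow> arcsin (-1)) (at_right (-1))"
      using continuous_on_Icc_at_leftD[OF c] continuous_on_Icc_at_rightD[OF c] by auto
    then show "((arcsin \<circ> real_of_ereal) \<longlongrightarrow> - (pi/2)) (at_right (-1))"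
      "((arcsin \<circ> real_of_ereal) \<longlongrightarrow> pi/2) (at_left 1)"
      by (simp_all add: ereal_tendsto_simps1 one_ereal_def)
  qed
  have sq: "1 - x\<^sup>2 > 0" if "-1 < x" "x < 1" for x :: real
    using that by (simp add: abs_square_less_1 abs_less_iff)
  have "(LBINT x=-1..1. inverse (sqrt (1 - x\<^sup>2))) = pi/2 - (- (pi/2))"
  proof (rule interval_integral_FTC_nonneg(2)[where F = arcsin])
    show "DERIV arcsin x :> inverse (sqrt (1 - x\<^sup>2))" if "-1 < ereal x" "ereal x < 1" for x
      using that by (intro DERIV_arcsin) (auto simp: one_ereal_def)
    show "isCont (\<lambda>x. inverse (sqrt (1 - x\<^sup>2))) x" if "-1 < ereal x" "ereal x < 1" for x
    proof -
      have "1 - x\<^sup>2 > 0" using that by (intro sq) (auto simp: one_ereal_def)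
      then show ?thesis by (intro continuous_intros) auto
    qed
    show "AE x in lborel. -1 < ereal x \<longrightarrow> ereal x < 1 \<longrightarrow> 0 \<le> inverse (sqrt (1 - x\<^sup>2))"
      by (intro AE_I2) (use sq in \<open>force simp: one_ereal_def less_imp_le\<close>)
    show "(-1 :: ereal) < 1" by (simp add: one_ereal_def)
  qed (use A in auto)
  also have "(LBINT x=-1..1. inverse (sqrt (1 - x\<^sup>2))) = (LINT x:{-1<..<1}|lborel. inverse (sqrt (1 - x\<^sup>2)))"
    using interval_integral_Ioo[of "-1" 1] by (simp add: one_ereal_def)
  also have "\<dots> = (LINT x:{-1<..<1}|lborel. (1 - x\<^sup>2) powr (-1/2) * (1 * 1))"
    by (intro set_lebesgue_integral_cong) (auto simp: powr_minus_half inverse_eq_divide)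
  also have "\<dots> = sqn (-1/2) (\<lambda>x. 1)"
    by (rule ip_lebesgue(2)[symmetric]) (auto intro!: L2_continuous)
  finally show ?thesis by simp
qed

text \<open>The double angle formula gives T_n^2 = (1 + T_2n) / 2, and T_2n is orthogonal to
  constants for n > 0; no trigonometric substitution in the integral is required.\<close>

lemma ip_tpoly_self:
  "sqn (-1/2) (poly (tpoly n)) = (if n = 0 then pi else pi / 2)"
proof (cases "n = 0")
  case True
  then show ?thesis using mass_chebyshev by (simp add: one_pCons[symmetric] fun_eq_iff[symmetric] poly_1[abs_def])
next
  case False
  have cosn: "chebyshev_T n (cos t) = cos (real n * t)" for n t
  proof (induction n rule: tpoly.induct)
    case (3 n)
    have "cos (real (Suc (Suc n)) * t) + cos (real n * t) = 2 * cos t * cos (real (Suc n) * t)"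
      using cos_add[of "real (Suc n) * t" t] cos_diff[of "real (Suc n) * t" t]
      by (simp add: algebra_simps)
    then show ?case using 3 by simp
  qed auto
  have T2: "(chebyshev_T n x)\<^sup>2 = 1/2 * (1 + chebyshev_T (2 * n) x)" if "x \<in> {-1<..<1}" for x
  proof -
    have x: "x = cos (arccos x)" using that by (simp add: cos_arccos)
    show ?thesis
      apply (subst (1 2) x)
      unfolding cosn using cos_double_cos[of "real n * arccos x"] by (simp add: mult.assoc)
  qed
  have b: "(-1/2::real) > -1" by simp
  have one: "poly 1 = (\<lambda>x::real. 1)" by auto
  have L1: "L2 (-1/2) (\<lambda>x. 1)" using L2_poly[OF b, of 1] by (simp add: one)
  have "sqn (-1/2) (poly (tpoly n)) = ip (-1/2) (\<lambda>x. 1/2 * (1 + poly (tpoly (2 * n)) x)) (\<lambda>x. 1)"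
    unfolding ip_def poly_tpoly using T2
    by (intro Bochner_Integration.integral_cong) (auto simp: power2_eq_square)
  also have "\<dots> = 1/2 * (sqn (-1/2) (\<lambda>x. 1) + ip (-1/2) (poly (tpoly (2 * n))) (\<lambda>x. 1))"
    unfolding ip_cmult_left using L1 L2_poly[OF b] by (subst ip_add_left) auto
  also have "ip (-1/2) (poly (tpoly (2 * n))) (\<lambda>x. 1) = 0"
    using eigpolys_orthogonal[OF b eigpolys_tpoly, of "2 * n" 0] False by (simp add: one)
  finally show ?thesis using False mass_chebyshev by simp
qed

lemma chebyshev_proj_of:
  assumes f: "L2 (-1/2) f"
  shows "\<exists>p. chebyshev_proj f N = poly p \<and> proj_of (-1/2) N f p"
proof -
  let ?b = "-1/2 :: real"
  have b: "?b > -1" by simp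
  have "chebyshev_coeff f n = ip ?b f (poly (tpoly n)) / sqn ?b (poly (tpoly n))" for n
  proof -
    have "ip ?b f (poly (tpoly n)) = (LINT x:{-1<..<1}|lborel. f x * chebyshev_T n x / sqrt (1 - x\<^sup>2))"
      unfolding ip_lebesgue(2)[OF f L2_poly[OF b]] poly_tpoly
      by (intro set_lebesgue_integral_cong) (auto simp: powr_minus_half)
    then show ?thesis unfolding chebyshev_coeff_def ip_tpoly_self by simp
  qed
  then have "chebyshev_proj f N =
      poly (\<Sum>n\<le>N. smult (ip ?b f (poly (tpoly n)) / sqn ?b (poly (tpoly n))) (tpoly n))"
    by (simp add: fun_eq_iff chebyshev_proj_def poly_sum poly_tpoly)
  then show ?thesis using eigpolys_proj_of[OF b eigpolys_tpoly f] by blast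
qed

section \<open>Families of derivatives and cut-offs\<close>

text \<open>Leibniz' formula, with the derivatives supplied as two sequences. The product rule is
  kept as a recursion on shifted sequences, so binomial coefficients never appear and every property
  is a plain induction on \<open>q\<close>.\<close>

fun leib :: "nat \<Rightarrow> (nat \<Rightarrow> real) \<Rightarrow> (nat \<Rightarrow> real) \<Rightarrow> real" where
  "leib 0 a b = a 0 * b 0"
| "leib (Suc q) a b = leib q (\<lambda>i. a (Suc i)) b + leib q a (\<lambda>i. b (Suc i))"

lemma leib_deriv:
  assumes "\<And>i. (A i has_real_derivative A (Suc i) x) (at x within S)"
    and "\<And>i. (B i has_real_derivative B (Suc i) x) (at x within S)"
  shows "((\<lambda>x. leib q (\<lambda>i. A i x) (\<lambda>i. B i x)) has_real_derivative
    leib (Suc q) (\<lambda>i. A i x) (\<lambda>i. B i x)) (at x within S)"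
  using assms
proof (induction q arbitrary: A B)
  case 0
  have "((\<lambda>x. A 0 x * B 0 x) has_real_derivative A (Suc 0) x * B 0 x + B (Suc 0) x * A 0 x) (at x within S)"
    by (rule DERIV_mult[OF 0(1) 0(2)])
  then show ?case by (simp add: mult.commute)
next
  case (Suc q)
  have "((\<lambda>x. leib q (\<lambda>i. A (Suc i) x) (\<lambda>i. B i x)) has_real_derivative
    leib (Suc q) (\<lambda>i. A (Suc i) x) (\<lambda>i. B i x)) (at x within S)"
    by (rule Suc.IH[of "\<lambda>i. A (Suc i)" B]) (use Suc.prems in auto)
  moreover have "((\<lambda>x. leib q (\<lambda>i. A i x) (\<lambda>i. B (Suc i) x)) has_real_derivative
    leib (Suc q) (\<lambda>i. A i x) (\<lambda>i. B (Suc i) x)) (at x within S)"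
    by (rule Suc.IH[of A "\<lambda>i. B (Suc i)"]) (use Suc.prems in auto)
  ultimately show ?case by (auto dest: DERIV_add simp: add_ac)
qed

lemma leib_add_left: "leib q (\<lambda>i. a i + a' i) b = leib q a b + leib q a' b"
  by (induction q arbitrary: a a' b) (auto simp: algebra_simps)

lemma leib_add_right: "leib q a (\<lambda>i. b i + b' i) = leib q a b + leib q a b'"
  by (induction q arbitrary: a b b') (auto simp: algebra_simps)

lemma leib_zero_right [simp]: "leib q a (\<lambda>i. 0) = 0"
  by (induction q arbitrary: a) auto

lemma leib_delta: "leib q a (\<lambda>i. if i = 0 then 1 else 0) = a q"
  by (induction q arbitrary: a) auto

text \<open>Bounds that lose one power of \<open>r\<close> per derivative are stable under products,
  with a constant independent of \<open>\<alpha>\<close>, \<open>\<beta>\<close> and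
  \<open>r\<close>. This uniformity is what scaling uses.\<close>

lemma leib_bound:
  assumes "r > 0" "\<And>i. \<bar>a i\<bar> \<le> C i * \<alpha> / r ^ i" "\<And>i. \<bar>b i\<bar> \<le> D i * \<beta> / r ^ i"
  shows "\<bar>leib q a b\<bar> \<le> leib q C D * (\<alpha> * \<beta>) / r ^ q"
  using assms(2,3)
proof (induction q arbitrary: a b C D \<alpha> \<beta>)
  case 0
  have "\<bar>a 0\<bar> * \<bar>b 0\<bar> \<le> (C 0 * \<alpha>) * (D 0 * \<beta>)"
    using 0(1)[of 0] 0(2)[of 0] by (intro mult_mono) auto
  then show ?case by (simp add: abs_mult mult_ac)
next
  case (Suc q)
  have "\<bar>leib q (\<lambda>i. a (Suc i)) b\<bar> \<le> leib q (\<lambda>i. C (Suc i)) D * (\<alpha> / r * \<beta>) / r ^ q"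
    by (rule Suc.IH) (use Suc.prems(1)[of "Suc _"] Suc.prems(2) assms(1) in \<open>auto simp: field_simps\<close>)
  moreover have "\<bar>leib q a (\<lambda>i. b (Suc i))\<bar> \<le> leib q C (\<lambda>i. D (Suc i)) * (\<alpha> * (\<beta> / r)) / r ^ q"
    by (rule Suc.IH) (use Suc.prems(2)[of "Suc _"] Suc.prems(1) assms(1) in \<open>auto simp: field_simps\<close>)
  ultimately have "\<bar>leib (Suc q) a b\<bar> \<le> leib q (\<lambda>i. C (Suc i)) D * (\<alpha> / r * \<beta>) / r ^ q
      + leib q C (\<lambda>i. D (Suc i)) * (\<alpha> * (\<beta> / r)) / r ^ q" by simp
  also have "\<dots> = leib (Suc q) C D * (\<alpha> * \<beta>) / r ^ Suc q"
    using assms(1) by (simp add: field_simps)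
  finally show ?case .
qed

lemma leib_measurable:
  assumes "\<And>i. A i \<in> borel_measurable M" "\<And>i. B i \<in> borel_measurable M"
  shows "(\<lambda>x. leib q (\<lambda>i. A i x) (\<lambda>i. B i x)) \<in> borel_measurable M"
  using assms
proof (induction q arbitrary: A B)
  case (Suc q)
  have "(\<lambda>x. leib q (\<lambda>i. A (Suc i) x) (\<lambda>i. B i x)) \<in> borel_measurable M"
    by (rule Suc.IH) (use Suc.prems in auto)
  moreover have "(\<lambda>x. leib q (\<lambda>i. A i x) (\<lambda>i. B (Suc i) x)) \<in> borel_measurable M"
    by (rule Suc.IH[of A "\<lambda>i. B (Suc i)"]) (use Suc.prems in auto)
  ultimately show ?case by simp
qed auto

section \<open>Derivatives of powers and logarithms of the absolute value\<close>

lemma abs_powr_eq: "\<bar>y\<bar> powr s = (y\<^sup>2) powr (s / 2)" for y s :: real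
proof -
  have "\<bar>y\<bar> powr s = (\<bar>y\<bar> powr 2) powr (s / 2)" unfolding powr_powr by simp
  also have "\<bar>y\<bar> powr 2 = y\<^sup>2" by (subst powr_numeral) auto
  finally show ?thesis .
qed

text \<open>Writing the absolute value as the root of y^2 avoids a case distinction on the sign of
  y.\<close>

lemma abs_powr_deriv:
  fixes y s :: real assumes "y \<noteq> 0"
  shows "((\<lambda>y. \<bar>y\<bar> powr s) has_real_derivative s * \<bar>y\<bar> powr s / y) (at y)"
proof -
  have p: "y\<^sup>2 > 0" using assms by simp
  have "((\<lambda>y. (y\<^sup>2) powr (s / 2)) has_real_derivative (s / 2) * (y\<^sup>2) powr (s / 2 - 1) * (2 * y)) (at y)"
    using p by (auto intro!: derivative_eq_intros simp: has_real_derivative_powr)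
  moreover have "(s / 2) * (y\<^sup>2) powr (s / 2 - 1) * (2 * y) = s * (y\<^sup>2) powr (s / 2) / y"
    using assms by (simp add: powr_diff power2_eq_square)
  ultimately show ?thesis by (simp add: abs_powr_eq)
qed

lemma ln_abs_deriv:
  fixes y :: real assumes "y \<noteq> 0"
  shows "((\<lambda>y. ln \<bar>y\<bar>) has_real_derivative 1 / y) (at y)"
proof -
  have L: "ln \<bar>y\<bar> = ln (y\<^sup>2) / 2" for y :: real
    using ln_realpow[of "\<bar>y\<bar>" 2] by (cases "y = 0") auto
  have "((\<lambda>y. ln (y\<^sup>2) / 2) has_real_derivative 1 / y) (at y)"
  proof -
    have "((\<lambda>y. ln (y\<^sup>2) / 2) has_real_derivative (1 / y\<^sup>2 * (2 * y)) / 2) (at y)"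
      using assms by (auto intro!: derivative_eq_intros)
    then show ?thesis by (rule DERIV_cong) (use assms in \<open>simp add: power2_eq_square\<close>)
  qed
  then show ?thesis by (simp only: L)
qed

text \<open>The derivatives of \<open>\<bar>y\<bar>\<^sup>s Q(ln \<bar>y\<bar>)\<close> are \<open>y\<^bsup>-i\<^esup> \<bar>y\<bar>\<^sup>s Q\<^sub>i(ln \<bar>y\<bar>)\<close> with \<open>Q\<^sub>i = eulp s i Q\<close>.
  At \<open>y = 0\<close> the formula gives \<open>0\<close>.\<close>
fun eulp :: "real \<Rightarrow> nat \<Rightarrow> real poly \<Rightarrow> real poly" where
  "eulp s 0 Q = Q"
| "eulp s (Suc i) Q = smult (s - real i) (eulp s i Q) + pderiv (eulp s i Q)"

definition sfam :: "real \<Rightarrow> real poly \<Rightarrow> nat \<Rightarrow> real \<Rightarrow> real" where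
  "sfam s Q i y = \<bar>y\<bar> powr s * poly (eulp s i Q) (ln \<bar>y\<bar>) / y ^ i"

text \<open>Derivatives are kept in the form \<open>A1 / y\<close>: for functions homogeneous up to
  logarithms or cut-offs, y d/dy is the natural operator, and each derivative adds one power of
  1/y.\<close>

lemma DERIV_div_power:
  fixes A :: "real \<Rightarrow> real"
  assumes "(A has_real_derivative A1 / y) (at y)" "y \<noteq> 0"
  shows "((\<lambda>y. A y / y ^ i) has_real_derivative (A1 - real i * A y) / y ^ Suc i) (at y)"
proof -
  have "((\<lambda>y. A y / y ^ i) has_real_derivative (A1 / y * y ^ i - A y * (real i * y ^ (i - 1))) / (y ^ i * y ^ i)) (at y)"
    using assms by (auto intro!: derivative_eq_intros)
  moreover have "(A1 / y * y ^ i - A y * (real i * y ^ (i - 1))) / (y ^ i * y ^ i) = (A1 - real i * A y) / y ^ Suc i"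
    using assms(2) by (cases i) (simp_all add: field_simps)
  ultimately show ?thesis by simp
qed

lemma sfam_deriv:
  assumes "y \<noteq> 0"
  shows "(sfam s Q i has_real_derivative sfam s Q (Suc i) y) (at y)"
proof -
  let ?P = "eulp s i Q"
  have "((\<lambda>y. poly ?P (ln \<bar>y\<bar>)) has_real_derivative poly (pderiv ?P) (ln \<bar>y\<bar>) * (1 / y)) (at y)"
    by (rule DERIV_chain2[OF poly_DERIV ln_abs_deriv[OF assms]])
  from DERIV_mult[OF abs_powr_deriv[OF assms, of s] this]
  have "((\<lambda>y. \<bar>y\<bar> powr s * poly ?P (ln \<bar>y\<bar>)) has_real_derivative
     \<bar>y\<bar> powr s * (s * poly ?P (ln \<bar>y\<bar>) + poly (pderiv ?P) (ln \<bar>y\<bar>)) / y) (at y)"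
    by (rule DERIV_cong) (use assms in \<open>simp add: field_simps\<close>)
  from DERIV_div_power[OF this assms, of i] show ?thesis
    unfolding sfam_def by (rule DERIV_cong) (simp add: algebra_simps)
qed

lemma sfam_measurable: "sfam s Q i \<in> borel_measurable borel"
proof -
  have "poly P \<in> borel_measurable borel" for P :: "real poly"
    by (intro borel_measurable_continuous_onI continuous_intros)
  then show ?thesis unfolding sfam_def[abs_def] by measurable
qed

text \<open>The sum of the two powers dominates exp(\<eta> |ln y|), so one estimate covers both
  small and large \<open>y\<close>.\<close>

lemma poly_ln_bound:
  fixes \<eta> :: real assumes "\<eta> > 0"
  shows "\<exists>C\<ge>0. \<forall>y>0. \<bar>poly Q (ln y)\<bar> \<le> C * (y powr \<eta> + y powr (-\<eta>))"
proof (induction Q)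
  case 0 then show ?case by (intro exI[of _ 0]) auto
next
  case (pCons a Q)
  have mono: "\<bar>poly Q (ln y)\<bar> \<le> (\<Sum>k\<le>degree Q. \<bar>coeff Q k\<bar> * (fact k / \<eta> ^ k)) * (y powr \<eta> + y powr (-\<eta>))"
    if "y > 0" for y and Q :: "real poly"
  proof -
    have e: "exp (\<eta> * \<bar>ln y\<bar>) \<le> y powr \<eta> + y powr (-\<eta>)"
      using that by (auto simp: powr_def abs_if)
    have "\<bar>coeff Q k * ln y ^ k\<bar> \<le> \<bar>coeff Q k\<bar> * (fact k / \<eta> ^ k) * (y powr \<eta> + y powr (-\<eta>))" for k
    proof -
      \<comment> \<open>A single term of the exponential series is bounded by the whole
        series.\<close>
      have "(\<eta> * \<bar>ln y\<bar>) ^ k / fact k \<le> exp (\<eta> * \<bar>ln y\<bar>)"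
      proof -
        have "(\<Sum>n\<in>{k}. inverse (fact n) *\<^sub>R (\<eta> * \<bar>ln y\<bar>) ^ n) \<le> (\<Sum>n. inverse (fact n) *\<^sub>R (\<eta> * \<bar>ln y\<bar>) ^ n)"
          using assms by (intro sum_le_suminf summable_exp_generic) (auto intro!: mult_nonneg_nonneg)
        then show ?thesis by (simp add: exp_def divide_inverse mult.commute)
      qed
      then have "\<bar>ln y\<bar> ^ k \<le> (fact k / \<eta> ^ k) * exp (\<eta> * \<bar>ln y\<bar>)"
        using assms by (simp add: power_mult_distrib field_simps)
      also have "\<dots> \<le> (fact k / \<eta> ^ k) * (y powr \<eta> + y powr (-\<eta>))"
        using assms by (intro mult_left_mono e) auto
      finally have "\<bar>coeff Q k\<bar> * \<bar>ln y\<bar> ^ k \<le> \<bar>coeff Q k\<bar> * ((fact k / \<eta> ^ k) * (y powr \<eta> + y powr (-\<eta>)))"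
        by (intro mult_left_mono) auto
      then show ?thesis by (simp add: abs_mult power_abs mult.assoc)
    qed
    then have "(\<Sum>k\<le>degree Q. \<bar>coeff Q k * ln y ^ k\<bar>) \<le>
        (\<Sum>k\<le>degree Q. \<bar>coeff Q k\<bar> * (fact k / \<eta> ^ k) * (y powr \<eta> + y powr (-\<eta>)))"
      by (intro sum_mono)
    moreover have "\<bar>poly Q (ln y)\<bar> \<le> (\<Sum>k\<le>degree Q. \<bar>coeff Q k * ln y ^ k\<bar>)"
      unfolding poly_altdef by (rule sum_abs)
    ultimately show ?thesis by (simp add: sum_distrib_right)
  qed
  show ?case
    by (intro exI[of _ "\<Sum>k\<le>degree (pCons a Q). \<bar>coeff (pCons a Q) k\<bar> * (fact k / \<eta> ^ k)"] conjI allI impI mono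
        sum_nonneg mult_nonneg_nonneg) (use assms in auto)
qed

text \<open>A power of exponent \<open>s\<close> in which logarithms have been paid for with an
  arbitrarily small \<open>\<eta>\<close> at 0 and at infinity.\<close>

definition logb :: "real \<Rightarrow> real \<Rightarrow> real \<Rightarrow> real" where
  "logb s \<eta> y = \<bar>y\<bar> powr s * (\<bar>y\<bar> powr \<eta> + \<bar>y\<bar> powr (-\<eta>))"

lemma sfam_bound:
  assumes "\<eta> > 0"
  shows "\<exists>C. \<forall>y. y \<noteq> 0 \<longrightarrow> \<bar>sfam s Q i y\<bar> \<le> C * logb s \<eta> y / \<bar>y\<bar> ^ i"
proof -
  obtain C where C: "\<And>y. y > 0 \<Longrightarrow> \<bar>poly (eulp s i Q) (ln y)\<bar> \<le> C * (y powr \<eta> + y powr (-\<eta>))"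
    using poly_ln_bound[OF assms] by blast
  have "\<bar>sfam s Q i y\<bar> \<le> C * logb s \<eta> y / \<bar>y\<bar> ^ i" if "y \<noteq> 0" for y
  proof -
    have "\<bar>sfam s Q i y\<bar> = \<bar>y\<bar> powr s * \<bar>poly (eulp s i Q) (ln \<bar>y\<bar>)\<bar> / \<bar>y\<bar> ^ i"
      by (simp add: sfam_def abs_mult power_abs)
    also have "\<dots> \<le> \<bar>y\<bar> powr s * (C * (\<bar>y\<bar> powr \<eta> + \<bar>y\<bar> powr (-\<eta>))) / \<bar>y\<bar> ^ i"
      using that by (intro divide_right_mono mult_left_mono C) auto
    finally show ?thesis by (simp add: logb_def mult_ac)
  qed
  then show ?thesis by blast
qed

lemma leib_sfam_bound:
  assumes \<eta>: "\<eta> > 0"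
    and c: "\<And>i. \<exists>D. \<forall>y. y \<noteq> 0 \<longrightarrow> \<bar>c i y\<bar> \<le> D * \<beta> y / \<bar>y\<bar> ^ i"
  shows "\<exists>C. \<forall>y. y \<noteq> 0 \<longrightarrow>
    \<bar>leib q (\<lambda>k. sfam s Q k y) (\<lambda>k. c k y)\<bar> \<le> C * (logb s \<eta> y * \<beta> y) / \<bar>y\<bar> ^ q"
proof -
  obtain C where C: "\<And>i y. y \<noteq> 0 \<Longrightarrow> \<bar>sfam s Q i y\<bar> \<le> C i * logb s \<eta> y / \<bar>y\<bar> ^ i"
    using sfam_bound[OF \<eta>, of s Q] by metis
  obtain D where D: "\<And>i y. y \<noteq> 0 \<Longrightarrow> \<bar>c i y\<bar> \<le> D i * \<beta> y / \<bar>y\<bar> ^ i" using c by metis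
  show ?thesis by (intro exI[of _ "leib q C D"] allI impI leib_bound C D) auto
qed

section \<open>An algebraic cut-off and its derivatives\<close>

text \<open>With \<open>v = vcut K y\<close> one has \<open>y v' = - K v (1 - v)\<close>.  Hence the \<open>i\<close>-th derivative of \<open>v\<close> is
  \<open>y\<^bsup>-i\<^esup>\<close> times a polynomial in \<open>v\<close> divisible by \<open>v (1 - v)\<close>.  No compactly supported cut-off is
  needed because \<open>K\<close> can be taken large.\<close>
definition vcut :: "real \<Rightarrow> real \<Rightarrow> real" where "vcut K y = 1 / (1 + \<bar>y\<bar> powr K)"

text \<open>\<open>rpoly K k\<close> is the cofactor of v (1 - v) in the derivative of order
  \<open>k + 1\<close>. In the recursion the first term comes from differentiating the power of 1/y,
  the second from the chain rule.\<close>

fun rpoly :: "real \<Rightarrow> nat \<Rightarrow> real poly" where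
  "rpoly K 0 = [:-K:]"
| "rpoly K (Suc k) = smult (- (real k + 1)) (rpoly K k) - smult K (pderiv ([:0, 1, -1:] * rpoly K k))"

definition cutd :: "real \<Rightarrow> nat \<Rightarrow> real \<Rightarrow> real" where
  "cutd K i y = (if i = 0 then vcut K y else vcut K y * (1 - vcut K y) * poly (rpoly K (i - 1)) (vcut K y) / y ^ i)"

definition chid :: "real \<Rightarrow> nat \<Rightarrow> real \<Rightarrow> real" where
  "chid K i y = (if i = 0 then 1 - vcut K y else - cutd K i y)"

lemma vcut_bounds: "0 < vcut K y" "vcut K y \<le> 1"
  by (auto simp: vcut_def add_pos_nonneg)

lemma vcut_deriv:
  assumes "y \<noteq> 0"
  shows "(vcut K has_real_derivative (- K * (vcut K y * (1 - vcut K y))) / y) (at y)"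
proof -
  have p: "1 + \<bar>y\<bar> powr K > 0" by (simp add: add_pos_nonneg)
  have "(vcut K has_real_derivative - (K * \<bar>y\<bar> powr K / y) / (1 + \<bar>y\<bar> powr K)\<^sup>2) (at y)"
  proof -
    have "((\<lambda>y. 1 + \<bar>y\<bar> powr K) has_real_derivative 0 + K * \<bar>y\<bar> powr K / y) (at y)"
      by (intro DERIV_add DERIV_const abs_powr_deriv[OF assms])
    from DERIV_divide[OF DERIV_const[of 1] this] p show ?thesis
      unfolding vcut_def[abs_def] by (simp add: power2_eq_square)
  qed
  moreover have "- (K * \<bar>y\<bar> powr K / y) / (1 + \<bar>y\<bar> powr K)\<^sup>2 = (- K * (vcut K y * (1 - vcut K y))) / y"
    unfolding vcut_def using p by (simp add: power2_eq_square field_simps)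
  ultimately show ?thesis by simp
qed

lemma cutd_deriv:
  assumes y: "y \<noteq> 0"
  shows "(cutd K i has_real_derivative cutd K (Suc i) y) (at y)"
proof (cases i)
  case 0
  then show ?thesis using vcut_deriv[OF y, of K] by (simp add: cutd_def[abs_def] mult_ac)
next
  case (Suc k)
  define Q where "Q = [:0, 1, -1:] * rpoly K k"
  have Q: "v * (1 - v) * poly (rpoly K k) v = poly Q v" for v
    by (simp add: Q_def algebra_simps)
  have c: "cutd K i = (\<lambda>y. poly Q (vcut K y) / y ^ i)"
    by (simp add: cutd_def[abs_def] Suc Q)
  have "((\<lambda>y. poly Q (vcut K y)) has_real_derivative
      poly (pderiv Q) (vcut K y) * (- K * (vcut K y * (1 - vcut K y))) / y) (at y)"
    using DERIV_chain2[OF poly_DERIV vcut_deriv[OF y], of Q K] by (simp only: times_divide_eq_right)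
  from DERIV_div_power[OF this y, of i]
  show ?thesis unfolding c
  proof (rule DERIV_cong)
    have "poly (pderiv Q) (vcut K y) * (- K * (vcut K y * (1 - vcut K y))) - real i * poly Q (vcut K y)
      = vcut K y * (1 - vcut K y) * poly (rpoly K (Suc k)) (vcut K y)"
      unfolding rpoly.simps Q_def[symmetric] Q[symmetric] Suc by (simp add: algebra_simps)
    then show "(poly (pderiv Q) (vcut K y) * (- K * (vcut K y * (1 - vcut K y))) - real i * poly Q (vcut K y)) / y ^ Suc i
      = cutd K (Suc i) y" by (simp add: cutd_def Suc)
  qed
qed

lemma chid_deriv:
  assumes y: "y \<noteq> 0"
  shows "(chid K i has_real_derivative chid K (Suc i) y) (at y)"
proof (cases i)
  case 0
  have "((\<lambda>y. 1 - cutd K 0 y) has_real_derivative - cutd K (Suc 0) y) (at y)"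
    using cutd_deriv[OF y, of K 0] by (auto intro!: derivative_eq_intros)
  then show ?thesis using 0 by (simp add: chid_def[abs_def] cutd_def)
next
  case (Suc k)
  then show ?thesis using DERIV_minus[OF cutd_deriv[OF y, of K i]] by (simp add: chid_def[abs_def])
qed

lemma cutd_chid_measurable:
  "cutd K i \<in> borel_measurable borel" "chid K i \<in> borel_measurable borel"
proof -
  have [measurable]: "poly P \<in> borel_measurable borel" for P :: "real poly"
    by (intro borel_measurable_continuous_onI continuous_intros)
  have [measurable]: "vcut K \<in> borel_measurable borel" unfolding vcut_def[abs_def] by measurable
  show 1: "cutd K i \<in> borel_measurable borel"
    unfolding cutd_def[abs_def] by (cases "i = 0") (simp_all, measurable)
  show "chid K i \<in> borel_measurable borel"
    unfolding chid_def[abs_def] using 1 by (cases "i = 0") simp_all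
qed

text \<open>Every derivative of positive order contains both v and 1 - v. Either factor can thus be
  kept, and the derivatives of a cut-off inherit its smallness on the side where it is
  small.\<close>

lemma cutd_chid_bound:
  "\<exists>C. \<forall>y. y \<noteq> 0 \<longrightarrow> \<bar>cutd K i y\<bar> \<le> C * vcut K y / \<bar>y\<bar> ^ i"
  "\<exists>C. \<forall>y. y \<noteq> 0 \<longrightarrow> \<bar>chid K i y\<bar> \<le> C * (1 - vcut K y) / \<bar>y\<bar> ^ i"
proof -
  have "bounded (poly (rpoly K (i - 1)) ` {0..1})"
    by (intro compact_imp_bounded compact_continuous_image continuous_intros) auto
  then obtain C where C: "\<And>v. v \<in> {0..1} \<Longrightarrow> \<bar>poly (rpoly K (i - 1)) v\<bar> \<le> C"
    unfolding bounded_iff real_norm_def by blast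
  have C0: "C \<ge> 0" using C[of 0] by auto
  have b: "\<bar>cutd K i y\<bar> \<le> C * (vcut K y * (1 - vcut K y)) / \<bar>y\<bar> ^ i" if "i \<noteq> 0" for y
  proof -
    have "\<bar>cutd K i y\<bar> = (vcut K y * (1 - vcut K y)) * \<bar>poly (rpoly K (i - 1)) (vcut K y)\<bar> / \<bar>y\<bar> ^ i"
      using that vcut_bounds[of K y] by (simp add: cutd_def abs_mult power_abs)
    also have "\<dots> \<le> (vcut K y * (1 - vcut K y)) * C / \<bar>y\<bar> ^ i"
      using vcut_bounds[of K y] by (intro divide_right_mono mult_left_mono C) auto
    finally show ?thesis by (simp add: mult_ac)
  qed
  show "\<exists>C. \<forall>y. y \<noteq> 0 \<longrightarrow> \<bar>cutd K i y\<bar> \<le> C * vcut K y / \<bar>y\<bar> ^ i"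
  proof (cases "i = 0")
    case True then show ?thesis using less_imp_le[OF vcut_bounds(1)] by (intro exI[of _ 1]) (simp add: cutd_def)
  next
    case False
    have "C * (vcut K y * (1 - vcut K y)) / \<bar>y\<bar> ^ i \<le> C * vcut K y / \<bar>y\<bar> ^ i" for y
      using vcut_bounds[of K y] C0 by (intro divide_right_mono mult_left_mono mult_left_le) auto
    then show ?thesis using b[OF False] order_trans by blast
  qed
  show "\<exists>C. \<forall>y. y \<noteq> 0 \<longrightarrow> \<bar>chid K i y\<bar> \<le> C * (1 - vcut K y) / \<bar>y\<bar> ^ i"
  proof (cases "i = 0")
    case True then show ?thesis using vcut_bounds by (intro exI[of _ 1]) (simp add: chid_def)
  next
    case False
    have "C * (vcut K y * (1 - vcut K y)) / \<bar>y\<bar> ^ i \<le> C * (1 - vcut K y) / \<bar>y\<bar> ^ i" for y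
      using vcut_bounds[of K y] C0 by (intro divide_right_mono mult_left_mono mult_left_le_one_le) auto
    then have "\<bar>chid K i y\<bar> \<le> C * (1 - vcut K y) / \<bar>y\<bar> ^ i" for y
      using b[OF False, of y] False order_trans by (auto simp: chid_def)
    then show ?thesis by blast
  qed
qed

lemma cutd_plus_chid: "cutd K i y + chid K i y = (if i = 0 then 1 else 0)"
  by (simp add: cutd_def chid_def)

text \<open>\<open>fam a g z s e\<close> is the family of derivatives of \<open>e\<^sup>s a\<^sub>0((x - z)/e) g\<^sub>0(x)\<close>.\<close>
definition fam :: "(nat \<Rightarrow> real \<Rightarrow> real) \<Rightarrow> (nat \<Rightarrow> real \<Rightarrow> real) \<Rightarrow> real \<Rightarrow> real \<Rightarrow> real \<Rightarrow> nat \<Rightarrow> real \<Rightarrow> real" where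
  "fam a g z s e q x = leib q (\<lambda>i. e powr s * a i ((x - z) / e) / e ^ i) (\<lambda>i. g i x)"

lemma fam_deriv:
  assumes e: "e > 0" and a: "\<And>i y. y \<noteq> 0 \<Longrightarrow> (a i has_real_derivative a (Suc i) y) (at y)"
    and g: "\<And>i. (g i has_real_derivative g (Suc i) x) (at x within S)" and x: "x \<noteq> z"
  shows "(fam a g z s e q has_real_derivative fam a g z s e (Suc q) x) (at x within S)"
  unfolding fam_def[abs_def]
proof (rule leib_deriv)
  fix i
  have "((\<lambda>x. (x - z) / e) has_real_derivative 1 / e) (at x within S)"
    using e by (auto intro!: derivative_eq_intros)
  moreover have "(a i has_real_derivative a (Suc i) ((x - z) / e)) (at ((x - z) / e))"
    by (rule a) (use e x in auto)
  ultimately have "((\<lambda>x. a i ((x - z) / e)) has_real_derivative a (Suc i) ((x - z) / e) * (1 / e)) (at x within S)"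
    by (rule DERIV_chain2[rotated])
  then have "((\<lambda>x. e powr s * a i ((x - z) / e) / e ^ i) has_real_derivative
     e powr s * (a (Suc i) ((x - z) / e) * (1 / e)) / e ^ i) (at x within S)"
    by (intro DERIV_cdivide DERIV_cmult)
  then show "((\<lambda>x. e powr s * a i ((x - z) / e) / e ^ i) has_real_derivative
     e powr s * a (Suc i) ((x - z) / e) / e ^ Suc i) (at x within S)"
    by simp
qed (rule g)

lemma fam_add: "fam (\<lambda>i y. a i y + a' i y) g z s e q x = fam a g z s e q x + fam a' g z s e q x"
  unfolding fam_def leib_add_left[symmetric] by (simp add: algebra_simps add_divide_distrib)

lemma fam_measurable:
  assumes "\<And>i. a i \<in> borel_measurable borel" "\<And>i. g i \<in> borel_measurable (jac b)"
  shows "fam a g z s e q \<in> borel_measurable (jac b)"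
  unfolding fam_def[abs_def]
proof (rule leib_measurable)
  have [measurable]: "a i \<in> borel_measurable borel" for i by (rule assms)
  show "(\<lambda>x. e powr s * a i ((x - z) / e) / e ^ i) \<in> borel_measurable (jac b)" for i
    by (intro measurable_jac_borel) measurable
qed (rule assms)

lemma fam_bound:
  assumes a: "\<And>i. \<exists>C. \<forall>y. y \<noteq> 0 \<longrightarrow> \<bar>a i y\<bar> \<le> C * B y / \<bar>y\<bar> ^ i"
    and g: "\<And>i. \<exists>C. \<forall>x\<in>{-1..1}. \<bar>g i x\<bar> \<le> C" and z: "z \<in> {-1..1}" and B: "\<And>y. B y \<ge> 0"
  shows "\<exists>C\<ge>0. \<forall>e>0. \<forall>x\<in>{-1..1}. x \<noteq> z \<longrightarrow>
    \<bar>fam a g z s e q x\<bar> \<le> C * (e powr s * B ((x - z) / e) / \<bar>x - z\<bar> ^ q)"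
proof -
  obtain C where C: "\<And>i y. y \<noteq> 0 \<Longrightarrow> \<bar>a i y\<bar> \<le> C i * B y / \<bar>y\<bar> ^ i" using a by metis
  obtain D where D: "\<And>i x. x \<in> {-1..1} \<Longrightarrow> \<bar>g i x\<bar> \<le> D i" using g by metis
  let ?L = "leib q C (\<lambda>i. D i * 2 ^ i)"
  have "\<bar>fam a g z s e q x\<bar> \<le> \<bar>?L\<bar> * (e powr s * B ((x - z) / e) / \<bar>x - z\<bar> ^ q)"
    if e: "e > 0" and x: "x \<in> {-1..1}" "x \<noteq> z" for e x
  proof -
    have "\<bar>fam a g z s e q x\<bar> \<le> ?L * ((e powr s * B ((x - z) / e)) * 1) / \<bar>x - z\<bar> ^ q"
      unfolding fam_def
    proof (rule leib_bound)
      show "\<bar>x - z\<bar> > 0" using x by simp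
      fix i
      have "\<bar>a i ((x - z) / e)\<bar> \<le> C i * B ((x - z) / e) / \<bar>(x - z) / e\<bar> ^ i"
        by (rule C) (use x e in auto)
      then have "e powr s * \<bar>a i ((x - z) / e)\<bar> / e ^ i \<le> e powr s * (C i * B ((x - z) / e) / \<bar>(x - z) / e\<bar> ^ i) / e ^ i"
        using e by (intro divide_right_mono mult_left_mono) auto
      then show "\<bar>e powr s * a i ((x - z) / e) / e ^ i\<bar> \<le> C i * (e powr s * B ((x - z) / e)) / \<bar>x - z\<bar> ^ i"
        using e by (simp add: abs_mult abs_divide power_divide mult_ac)
      \<comment> \<open>The interval has length 2, so the bounded derivatives of \<open>g\<close>
        also satisfy bounds that lose a power of the distance to \<open>z\<close>, as the product
        estimate requires.\<close>
      have "\<bar>x - z\<bar> ^ i \<le> 2 ^ i" using x z by (intro power_mono) auto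
      then have "D i * 1 \<le> D i * (2 ^ i / \<bar>x - z\<bar> ^ i)"
        using D[OF x(1), of i] x by (intro mult_left_mono) (auto simp: field_simps)
      then show "\<bar>g i x\<bar> \<le> D i * 2 ^ i * 1 / \<bar>x - z\<bar> ^ i"
        using D[OF x(1), of i] by simp
    qed
    also have "\<dots> = ?L * (e powr s * B ((x - z) / e) / \<bar>x - z\<bar> ^ q)" by simp
    also have "\<dots> \<le> \<bar>?L\<bar> * (e powr s * B ((x - z) / e) / \<bar>x - z\<bar> ^ q)"
      using e x B by (intro mult_right_mono) auto
    finally show ?thesis .
  qed
  then show ?thesis by (intro exI[of _ "\<bar>?L\<bar>"]) auto
qed

section \<open>Jackson estimates\<close>

lemma leib_zero_left [simp]: "leib q (\<lambda>i. 0) b = 0"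
  by (induction q arbitrary: b) auto

lemma logb_nonneg: "logb s \<eta> y \<ge> 0" by (simp add: logb_def)

lemma logb_bounds:
  assumes y: "y \<noteq> 0" and \<eta>: "\<eta> \<ge> 0"
  shows "\<bar>y\<bar> \<le> 1 \<Longrightarrow> logb s \<eta> y / \<bar>y\<bar> ^ q \<le> 2 * \<bar>y\<bar> powr (s - \<eta> - real q)"
    and "\<bar>y\<bar> \<ge> 1 \<Longrightarrow> logb s \<eta> y / \<bar>y\<bar> ^ q \<le> 2 * \<bar>y\<bar> powr (s + \<eta> - real q)"
proof -
  have t: "\<bar>y\<bar> > 0" using y by simp
  have pq: "\<bar>y\<bar> ^ q = \<bar>y\<bar> powr real q" using t by (simp add: powr_realpow)
  { assume "\<bar>y\<bar> \<le> 1"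
    then have "\<bar>y\<bar> powr \<eta> \<le> \<bar>y\<bar> powr (-\<eta>)" using t \<eta> by (intro powr_mono') auto
    then have "logb s \<eta> y / \<bar>y\<bar> ^ q \<le> \<bar>y\<bar> powr s * (2 * \<bar>y\<bar> powr (-\<eta>)) / \<bar>y\<bar> ^ q"
      unfolding logb_def by (intro divide_right_mono mult_left_mono) auto
    also have "\<dots> = 2 * \<bar>y\<bar> powr (s - \<eta> - real q)"
      using t unfolding pq by (simp add: powr_diff powr_minus_divide)
    finally show "logb s \<eta> y / \<bar>y\<bar> ^ q \<le> 2 * \<bar>y\<bar> powr (s - \<eta> - real q)" . }
  { assume "\<bar>y\<bar> \<ge> 1"
    then have "\<bar>y\<bar> powr (-\<eta>) \<le> \<bar>y\<bar> powr \<eta>" using \<eta> by (intro powr_mono) auto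
    then have "logb s \<eta> y / \<bar>y\<bar> ^ q \<le> \<bar>y\<bar> powr s * (2 * \<bar>y\<bar> powr \<eta>) / \<bar>y\<bar> ^ q"
      unfolding logb_def by (intro divide_right_mono mult_left_mono) auto
    also have "\<dots> = 2 * \<bar>y\<bar> powr (s + \<eta> - real q)"
      using t unfolding pq by (simp add: powr_diff powr_add)
    finally show "logb s \<eta> y / \<bar>y\<bar> ^ q \<le> 2 * \<bar>y\<bar> powr (s + \<eta> - real q)" . }
qed

lemma vcut_power_bounds:
  assumes "y \<noteq> 0"
  shows "vcut K y \<le> \<bar>y\<bar> powr (-K)" "1 - vcut K y \<le> \<bar>y\<bar> powr K"
proof -
  have t: "\<bar>y\<bar> powr K > 0" using assms by simp
  show "vcut K y \<le> \<bar>y\<bar> powr (-K)"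
    using t unfolding vcut_def powr_minus_divide by (intro divide_left_mono mult_pos_pos add_pos_pos) auto
  have "1 - vcut K y = \<bar>y\<bar> powr K / (1 + \<bar>y\<bar> powr K)"
  proof -
    have "1 + \<bar>y\<bar> powr K > 0" by (rule add_pos_pos[OF zero_less_one t])
    then show ?thesis by (simp add: vcut_def field_simps)
  qed
  also have "\<dots> \<le> \<bar>y\<bar> powr K / 1" by (intro divide_left_mono) (auto simp: add_pos_nonneg)
  finally show "1 - vcut K y \<le> \<bar>y\<bar> powr K" by simp
qed

text \<open>The cut-off \<open>vcut K\<close> gains \<open>K\<close> powers at infinity and its
  complement gains \<open>K\<close> powers at 0; at the other end each is simply bounded by
  1.\<close>

lemma logb_cut_twopow:
  assumes y: "y \<noteq> 0" and \<eta>: "\<eta> \<ge> 0"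
  shows "logb s \<eta> y * vcut K y / \<bar>y\<bar> ^ q \<le> 2 * twopow (s - \<eta> - real q) (s + \<eta> - real q - K) \<bar>y\<bar>"
    and "logb s \<eta> y * (1 - vcut K y) / \<bar>y\<bar> ^ q \<le> 2 * twopow (s - \<eta> - real q + K) (s + \<eta> - real q) \<bar>y\<bar>"
proof -
  have t: "\<bar>y\<bar> > 0" using y by simp
  have v: "0 \<le> vcut K y" "vcut K y \<le> 1" "0 \<le> 1 - vcut K y" "1 - vcut K y \<le> 1"
    using vcut_bounds[of K y] by auto
  note p = vcut_power_bounds[OF y, of K]
  show "logb s \<eta> y * vcut K y / \<bar>y\<bar> ^ q \<le> 2 * twopow (s - \<eta> - real q) (s + \<eta> - real q - K) \<bar>y\<bar>"
  proof (cases "\<bar>y\<bar> \<le> 1")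
    case True
    have "logb s \<eta> y / \<bar>y\<bar> ^ q * vcut K y \<le> (2 * \<bar>y\<bar> powr (s - \<eta> - real q)) * 1"
      using v by (intro mult_mono logb_bounds(1)[OF y \<eta> True]) auto
    then show ?thesis using True by (simp add: twopow_def)
  next
    case False
    have "logb s \<eta> y / \<bar>y\<bar> ^ q * vcut K y \<le> (2 * \<bar>y\<bar> powr (s + \<eta> - real q)) * \<bar>y\<bar> powr (-K)"
      using v p False by (intro mult_mono logb_bounds(2)[OF y \<eta>]) auto
    then show ?thesis using False t by (simp add: twopow_def powr_diff powr_minus_divide)
  qed
  show "logb s \<eta> y * (1 - vcut K y) / \<bar>y\<bar> ^ q \<le> 2 * twopow (s - \<eta> - real q + K) (s + \<eta> - real q) \<bar>y\<bar>"
  proof (cases "\<bar>y\<bar> \<le> 1")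
    case True
    have "logb s \<eta> y / \<bar>y\<bar> ^ q * (1 - vcut K y) \<le> (2 * \<bar>y\<bar> powr (s - \<eta> - real q)) * \<bar>y\<bar> powr K"
      using v p by (intro mult_mono logb_bounds(1)[OF y \<eta> True]) auto
    then show ?thesis using True t by (simp add: twopow_def powr_add)
  next
    case False
    have "logb s \<eta> y / \<bar>y\<bar> ^ q * (1 - vcut K y) \<le> (2 * \<bar>y\<bar> powr (s + \<eta> - real q)) * 1"
      using v False by (intro mult_mono logb_bounds(2)[OF y \<eta>]) auto
    then show ?thesis using False by (simp add: twopow_def)
  qed
qed

lemma twopow_square: "t > 0 \<Longrightarrow> (twopow a1 a2 t)\<^sup>2 = twopow (2 * a1) (2 * a2) t"
  by (auto simp: twopow_def powr_power)

text \<open>In the final exponent, 2 s comes from the prefactor, - 2 q from the derivatives and d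
  from the mass of a ball of radius e around \<open>z\<close>.\<close>

lemma scaled_norm_bound:
  assumes b: "b > -1" and wg: "weight_growth z b d" and d: "d > 0"
    and a: "2 * a1 + d > 0" "2 * a2 + d < 0"
    and meas: "\<And>e. e > 0 \<Longrightarrow> F e \<in> borel_measurable (jac b)"
    and F: "\<And>e x. e > 0 \<Longrightarrow> x \<in> {-1<..<1} \<Longrightarrow> x \<noteq> z \<Longrightarrow>
      \<bar>F e x\<bar> \<le> C * (e powr s * B ((x - z) / e) / \<bar>x - z\<bar> ^ q)" and C: "C \<ge> 0"
    and B: "\<And>y. y \<noteq> 0 \<Longrightarrow> B y / \<bar>y\<bar> ^ q \<le> 2 * twopow a1 a2 \<bar>y\<bar>"
  shows "\<exists>r C'. 0 < r \<and> C' \<ge> 0 \<and> (\<forall>e. 0 < e \<longrightarrow> e \<le> r \<longrightarrow>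
    L2 b (F e) \<and> sqn b (F e) \<le> C' * e powr (2 * s - 2 * real q + d))"
proof -
  obtain r C0 where r: "0 < r" "r \<le> 1" "C0 \<ge> 0"
    and int: "\<And>e. 0 < e \<Longrightarrow> e \<le> r \<Longrightarrow> integrable (jac b) (\<lambda>x. twopow (2 * a1) (2 * a2) (\<bar>x - z\<bar> / e))"
    and le: "\<And>e. 0 < e \<Longrightarrow> e \<le> r \<Longrightarrow> (LINT x|jac b. twopow (2 * a1) (2 * a2) (\<bar>x - z\<bar> / e)) \<le> C0 * e powr d"
    using integral_jac_twopow[OF b wg d a] by blast
  define C' where "C' = (2 * C)\<^sup>2 * C0"
  have "L2 b (F e) \<and> sqn b (F e) \<le> C' * e powr (2 * s - 2 * real q + d)" if e: "0 < e" "e \<le> r" for e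
  proof -
    let ?k = "(2 * C)\<^sup>2 * e powr (2 * s - 2 * real q)"
    let ?T = "\<lambda>x. ?k * twopow (2 * a1) (2 * a2) (\<bar>x - z\<bar> / e)"
    have iT: "integrable (jac b) ?T" by (intro integrable_mult_right int e)
    have pt: "(F e x)\<^sup>2 \<le> ?T x" if x: "x \<in> {-1<..<1}" "x \<noteq> z" for x
    proof -
      let ?y = "(x - z) / e"
      have y: "?y \<noteq> 0" "\<bar>?y\<bar> = \<bar>x - z\<bar> / e" using x e by auto
      have h: "\<bar>x - z\<bar> ^ q = e ^ q * \<bar>?y\<bar> ^ q" using e by (simp add: power_divide)
      have "\<bar>F e x\<bar> \<le> C * (e powr s * B ?y / \<bar>x - z\<bar> ^ q)" by (rule F) (use e x in auto)
      also have "\<dots> = C * (e powr s / e ^ q * (B ?y / \<bar>?y\<bar> ^ q))" unfolding h by simp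
      also have "\<dots> \<le> C * (e powr s / e ^ q * (2 * twopow a1 a2 \<bar>?y\<bar>))"
        using C e by (intro mult_left_mono B[OF y(1)]) auto
      finally have "\<bar>F e x\<bar>\<^sup>2 \<le> (C * (e powr s / e ^ q * (2 * twopow a1 a2 \<bar>?y\<bar>)))\<^sup>2"
        by (intro power_mono) auto
      also have "\<dots> = (2 * C)\<^sup>2 * (e powr s / e ^ q)\<^sup>2 * (twopow a1 a2 \<bar>?y\<bar>)\<^sup>2"
      proof -
        have "(C * (E * (2 * T)))\<^sup>2 = (2 * C)\<^sup>2 * E\<^sup>2 * T\<^sup>2" for E T :: real
          by (simp add: power_mult_distrib)
        then show ?thesis .
      qed
      also have "(twopow a1 a2 \<bar>?y\<bar>)\<^sup>2 = twopow (2 * a1) (2 * a2) (\<bar>x - z\<bar> / e)"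
        using y by (subst twopow_square) auto
      also have "(e powr s / e ^ q)\<^sup>2 = e powr (2 * s - 2 * real q)"
      proof -
        have "e powr s / e ^ q = e powr (s - real q)" using e by (simp add: powr_diff powr_realpow)
        then show ?thesis using e by (simp add: powr_power algebra_simps)
      qed
      finally show ?thesis by simp
    qed
    have AE: "AE x in jac b. (F e x)\<^sup>2 \<le> ?T x"
      using AE_jac_neq[of z b] AE_space[of "jac b"] by eventually_elim (use pt in auto)
    have m2: "(\<lambda>x. (F e x)\<^sup>2) \<in> borel_measurable (jac b)"
      using meas[OF e(1)] by measurable
    have i: "integrable (jac b) (\<lambda>x. (F e x)\<^sup>2)"
    proof (rule Bochner_Integration.integrable_bound[OF iT m2])
      show "AE x in jac b. norm ((F e x)\<^sup>2) \<le> norm (?T x)"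
        using AE by eventually_elim simp
    qed
    have "sqn b (F e) \<le> integral\<^sup>L (jac b) ?T"
      unfolding ip_self by (rule integral_mono_AE[OF i iT AE])
    also have "\<dots> = ?k * (LINT x|jac b. twopow (2 * a1) (2 * a2) (\<bar>x - z\<bar> / e))"
      by (rule integral_mult_right_zero)
    also have "\<dots> \<le> ?k * (C0 * e powr d)" by (intro mult_left_mono le e) auto
    also have "\<dots> = C' * e powr (2 * s - 2 * real q + d)"
      by (simp add: C'_def powr_add mult_ac)
    finally show ?thesis using i meas[OF e(1)] by (simp add: L2_def)
  qed
  then show ?thesis using r by (intro exI[of _ r] exI[of _ C']) (auto simp: C'_def)
qed

text \<open>At \<open>z\<close> the explicit formulas evaluate to 0 by convention; vanishing of
  order above 1 shows that 0 is then the true derivative.\<close>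

lemma DERIV_zero_of_power_bound:
  fixes \<phi> :: "real \<Rightarrow> real"
  assumes "\<phi> z = 0" "p > 1" "\<delta> > 0"
    and "\<And>x. x \<in> S \<Longrightarrow> x \<noteq> z \<Longrightarrow> \<bar>x - z\<bar> \<le> \<delta> \<Longrightarrow> \<bar>\<phi> x\<bar> \<le> C * \<bar>x - z\<bar> powr p"
  shows "(\<phi> has_real_derivative 0) (at z within S)"
proof -
  have "((\<lambda>x. (\<phi> x - \<phi> z) / (x - z)) \<longlongrightarrow> 0) (at z within S)"
  proof (rule Lim_null_comparison)
    have "eventually (\<lambda>x. x \<in> S \<and> x \<noteq> z \<and> \<bar>x - z\<bar> \<le> \<delta>) (at z within S)"
      using assms(3) unfolding eventually_at by (intro exI[of _ \<delta>]) (auto simp: dist_real_def)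
    then show "eventually (\<lambda>x. norm ((\<phi> x - \<phi> z) / (x - z)) \<le> C * \<bar>x - z\<bar> powr (p - 1)) (at z within S)"
    proof eventually_elim
      case (elim x)
      then have "\<bar>\<phi> x\<bar> / \<bar>x - z\<bar> \<le> C * \<bar>x - z\<bar> powr p / \<bar>x - z\<bar>"
        by (intro divide_right_mono assms(4)) auto
      then show ?case using elim assms(1) by (simp add: abs_divide powr_diff)
    qed
    have "((\<lambda>x. \<bar>x - z\<bar> powr (p - 1)) \<longlongrightarrow> \<bar>z - z\<bar> powr (p - 1)) (at z within S)"
      using assms(2) by (intro tendsto_powr' tendsto_intros) auto
    then show "((\<lambda>x. C * \<bar>x - z\<bar> powr (p - 1)) \<longlongrightarrow> 0) (at z within S)"
      using tendsto_mult_left[of "\<lambda>x. \<bar>x - z\<bar> powr (p - 1)" 0 _ C] by simp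
  qed
  then show ?thesis by (simp add: has_field_derivative_iff)
qed

text \<open>The projection error is orthogonal to degree \<open>N\<close>, which gives a factor N^2;
  its derivative is the projection error for degree N - 1 and weight b + 1. The factors N, N - 1,
  ..., N + 1 - r that accumulate are all replaced by the smallest.\<close>

lemma Jackson:
  fixes u :: "nat \<Rightarrow> real \<Rightarrow> real"
  assumes "b > -1" "proj_of b N (u 0) p" "r \<le> N"
    and "\<And>i x. i \<le> r \<Longrightarrow> x \<in> {-1..1} \<Longrightarrow> (u i has_real_derivative u (Suc i) x) (at x within {-1..1})"
  shows "real (N + 1 - r) ^ (2 * r) * sqd b (u 0) (poly p)
    \<le> sqn (b + real r) (u r)"
  using assms
proof (induction r arbitrary: b u N p)
  case 0
  have "continuous_on {-1..1} (u 0)"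
    by (rule DERIV_continuous_on) (use 0(4) in auto)
  then have "L2 b (u 0)" by (rule L2_continuous[OF 0(1)])
  then show ?case using proj_of_0_Pythagoras[OF 0(1) _ 0(2)] ip_self_nonneg[of b "poly p"] by simp
next
  case (Suc r)
  have b1: "b + 1 > -1" using Suc.prems by simp
  have c: "continuous_on {-1..1} (u i)" if "i \<le> Suc r" for i
    by (rule DERIV_continuous_on) (use Suc.prems(4) that in auto)
  have L: "L2 b (u 0)" "L2 (b + 1) (u 1)" using c b1 Suc.prems(1) by (auto intro: L2_continuous)
  have D: "(u 0 has_real_derivative u 1 x) (at x)" if "x \<in> {-1<..<1}" for x
    using Suc.prems(4)[of 0 x] that by (simp add: at_within_Icc_at)
  have pr: "proj_of (b + 1) (N - 1) (u 1) (pderiv p)"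
    by (rule proj_of_pderiv[OF Suc.prems(1) L _ Suc.prems(2)])
      (use Suc.prems c D in \<open>auto intro!: weakder_C1\<close>)
  obtain e where e: "eigpolys b e" using eigpolys_exists Suc.prems(1) by blast
  have "real N ^ 2 * sqd b (u 0) (poly p)
      \<le> sqd (b + 1) (u 1) (poly (pderiv p))"
    by (rule Poincare_orthogonal[OF Suc.prems(1) e])
      (use c D Suc.prems(2) in \<open>auto intro!: continuous_intros derivative_eq_intros simp: proj_of_def\<close>)
  then have 1: "real (N - r) ^ (2 * r) * (real N ^ 2 * sqd b (u 0) (poly p))
      \<le> real (N - r) ^ (2 * r) * sqd (b + 1) (u 1) (poly (pderiv p))"
    by (rule mult_left_mono) simp
  have "real (N - 1 + 1 - r) ^ (2 * r) * sqd (b + 1) (u (Suc 0)) (poly (pderiv p))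
     \<le> sqn (b + 1 + real r) (u (Suc r))"
    by (rule Suc.IH[of "b + 1" "N - 1" "\<lambda>i. u (Suc i)" "pderiv p"])
      (use Suc.prems b1 pr in auto)
  then have 2: "real (N - r) ^ (2 * r) * sqd (b + 1) (u 1) (poly (pderiv p))
     \<le> sqn (b + real (Suc r)) (u (Suc r))" using Suc.prems(3) by (simp add: add_ac)
  have "real (N + 1 - Suc r) ^ (2 * Suc r) = real (N - r) ^ (2 * r) * real (N - r) ^ 2"
    by (simp add: power_add[symmetric] add.commute)
  also have "\<dots> \<le> real (N - r) ^ (2 * r) * real N ^ 2" by (intro mult_left_mono power_mono) auto
  finally have "real (N + 1 - Suc r) ^ (2 * Suc r) * sqd b (u 0) (poly p)
     \<le> real (N - r) ^ (2 * r) * real N ^ 2 * sqd b (u 0) (poly p)"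
    by (rule mult_right_mono[OF _ ip_self_nonneg])
  with 1 2 show ?case by (simp add: mult.assoc)
qed

lemma proj_of_exists: "b > -1 \<Longrightarrow> L2 b u \<Longrightarrow> \<exists>p. proj_of b N u p"
  using eigpolys_exists eigpolys_proj_of by blast

text \<open>The degree is \<open>N - q\<close> because the result is applied to a derivative of
  order \<open>q\<close>. The iteration lowers it further, and \<open>N \<ge> 4 * (q + r)\<close>
  keeps the last factor above N/4.\<close>

lemma Jackson_approx:
  fixes u :: "nat \<Rightarrow> real \<Rightarrow> real"
  assumes b: "b > -1" and N: "N \<ge> 4 * (q + r)" "N > 0"
    and D: "\<And>i x. i \<le> r \<Longrightarrow> x \<in> {-1..1} \<Longrightarrow> (u i has_real_derivative u (Suc i) x) (at x within {-1..1})"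
  shows "\<exists>p. degree p \<le> N - q \<and> sqd b (u 0) (poly p)
    \<le> 4 ^ (2 * r) * real N powr (- 2 * real r) * sqn (b + real r) (u r)"
proof -
  have "continuous_on {-1..1} (u 0)"
    by (rule DERIV_continuous_on) (use D in auto)
  then have "L2 b (u 0)" by (rule L2_continuous[OF b])
  then obtain p where p: "proj_of b (N - q) (u 0) p" using proj_of_exists[OF b] by blast
  let ?E = "sqd b (u 0) (poly p)"
  have "(real N / 4) ^ (2 * r) * ?E \<le> real (N - q + 1 - r) ^ (2 * r) * ?E"
    using N by (intro mult_right_mono power_mono ip_self_nonneg) auto
  also have "\<dots> \<le> sqn (b + real r) (u r)"
    by (rule Jackson[where u = u, OF b p]) (use N D in auto)
  finally have "?E \<le> sqn (b + real r) (u r) / (real N / 4) ^ (2 * r)"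
    using N by (simp add: field_simps)
  also have "\<dots> = 4 ^ (2 * r) * real N powr (- 2 * real r) * sqn (b + real r) (u r)"
  proof -
    have "real N powr (- 2 * real r) = 1 / real N ^ (2 * r)"
      using N powr_realpow[of "real N" "2 * r"] powr_minus_divide[of "real N" "2 * real r"] by simp
    then show ?thesis by (simp add: power_divide)
  qed
  finally show ?thesis using p by (auto simp: proj_of_def)
qed

section \<open>Approximation of the singular function\<close>

text \<open>The two geometries: at an end point the weights \<open>(1 - x\<^sup>2)\<^bsup>b + p\<^esup>\<close> grow with \<open>\<theta> = 1\<close> and the
  resolution of degree \<open>N\<close> is \<open>N\<^bsup>-2\<^esup>\<close>; at an interior point \<open>\<theta> = 0\<close> and it is \<open>N\<^bsup>-1\<^esup>\<close>.
  In both cases the resolution is \<open>N\<^bsup>-\<kappa>\<^esup>\<close> with \<open>\<kappa> (2 - \<theta>) = 2\<close>.\<close>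
locale singular_point =
  fixes b z \<kappa> \<theta> d0 s :: real and m :: nat and Dg :: "nat \<Rightarrow> real \<Rightarrow> real"
  assumes b: "b > -1" and z: "z \<in> {-1..1}" and kap: "\<kappa> > 0" "\<kappa> * (2 - \<theta>) = 2"
    and th: "\<theta> \<ge> 0" and d0: "d0 > 0"
    and wg: "\<And>p::nat. weight_growth z (b + real p) (d0 + \<theta> * real p)"
    and sm: "2 * s - 2 * real m + (d0 + \<theta> * real m) > 0"
    and Dg: "\<And>i x. x \<in> {-1..1} \<Longrightarrow> (Dg i has_real_derivative Dg (Suc i) x) (at x within {-1..1})"
begin

lemma th2: "2 - \<theta> > 0" using kap by (metis zero_less_mult_pos zero_less_numeral)

lemma b_plus: "b + real p > -1" using b by simp

lemma Dg_continuous: "continuous_on {-1..1} (Dg i)"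
  by (rule DERIV_continuous_on) (rule Dg)

lemma Dg_measurable: "Dg i \<in> borel_measurable (jac c)"
  by (rule measurable_jac_continuous[OF Dg_continuous])

lemma Dg_bounded: "\<exists>C. \<forall>x\<in>{-1..1}. \<bar>Dg i x\<bar> \<le> C"
proof -
  have "bounded (Dg i ` {-1..1})"
    by (intro compact_imp_bounded compact_continuous_image Dg_continuous) auto
  then show ?thesis unfolding bounded_iff real_norm_def by blast
qed

abbreviation F :: "real poly \<Rightarrow> real \<Rightarrow> nat \<Rightarrow> real \<Rightarrow> real" where
  "F Q e q x \<equiv> fam (sfam s Q) Dg z s e q x"

lemma F_deriv:
  assumes "e > 0" "x \<in> {-1..1}" "x \<noteq> z"
  shows "(F Q e q has_real_derivative F Q e (Suc q) x) (at x within {-1..1})"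
  by (rule fam_deriv) (use assms Dg sfam_deriv in auto)

lemma F_at_z: "F Q e q z = 0"
  by (simp add: fam_def sfam_def)

abbreviation smooth_upto :: "nat \<Rightarrow> (real \<Rightarrow> nat \<Rightarrow> real \<Rightarrow> real) \<Rightarrow> bool" where
  "smooth_upto k G \<equiv> \<forall>e>0. \<forall>i\<le>k. \<forall>x\<in>{-1..1}.
     (G e i has_real_derivative G e (Suc i) x) (at x within {-1..1})"

abbreviation decay :: "nat \<Rightarrow> (real \<Rightarrow> real \<Rightarrow> real) \<Rightarrow> bool" where
  "decay q u \<equiv> \<exists>r0 C. 0 < r0 \<and> 0 \<le> C \<and> (\<forall>e. 0 < e \<longrightarrow> e \<le> r0 \<longrightarrow>
     L2 (b + real q) (u e) \<and>
     sqn (b + real q) (u e) \<le> C * e powr (2 * s - 2 * real q + (d0 + \<theta> * real q)))"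

lemma split_F:
  "\<exists>G R r. (\<forall>e q x. F Q e q x = G e q x + R e q x) \<and>
    smooth_upto (m + r) G \<and>
    (\<forall>q\<le>m. decay q (\<lambda>e. R e q)) \<and>
    (\<forall>q\<le>m. decay (q + r) (\<lambda>e. G e (q + r)))"
proof -
  \<comment> \<open>A quarter of the slack in \<open>sm\<close>: the square of a logarithmic bound
    costs \<open>2 * \<eta>\<close>, so integrability at \<open>z\<close> survives for all orders up
    to \<open>m\<close>.\<close>
  define \<eta> where "\<eta> = (2 * s - 2 * real m + (d0 + \<theta> * real m)) / 4"
  have \<eta>: "\<eta> > 0" using sm by (simp add: \<eta>_def)
  have \<eta>4: "4 * \<eta> = 2 * s - 2 * real m + (d0 + \<theta> * real m)" by (simp add: \<eta>_def)
  \<comment> \<open>So many derivatives that those of order at least \<open>r\<close> of the scaled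
    singular function are square integrable at infinity against the growing weight.\<close>
  obtain r :: nat where r: "(2 * s + 2 * \<eta> + d0) / (2 - \<theta>) < real r" using reals_Archimedean2 by blast
  have r': "2 * s + 2 * \<eta> + d0 < (2 - \<theta>) * real r"
    using r th2 by (simp add: pos_divide_less_eq mult.commute)
  \<comment> \<open>A generous choice serving three purposes: decay of \<open>R\<close> at infinity,
    integrability of the derivatives of \<open>G\<close> at \<open>z\<close>, and differentiability
    of \<open>G\<close> at \<open>z\<close> up to order \<open>m + r\<close>.\<close>
  define K where "K = \<bar>s\<bar> + \<eta> + d0 + \<theta> * real m + real m + real r + 4"
  have tm: "\<theta> * real m \<ge> 0" using th by simp
  have K: "K > 0" using \<eta> d0 tm by (simp add: K_def)
  define aG where "aG = (\<lambda>i y. leib i (\<lambda>k. sfam s Q k y) (\<lambda>k. chid K k y))"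
  define aR where "aR = (\<lambda>i y. leib i (\<lambda>k. sfam s Q k y) (\<lambda>k. cutd K k y))"
  define G where "G = fam aG Dg z s"
  define R where "R = fam aR Dg z s"
  have sum: "F Q e q x = G e q x + R e q x" for e q x
  proof -
    have "aG i y + aR i y = sfam s Q i y" for i y
      unfolding aG_def aR_def leib_add_right[symmetric]
      using cutd_plus_chid[of K _ y] leib_delta[of i "\<lambda>k. sfam s Q k y"] by (simp add: add.commute)
    then show ?thesis unfolding G_def R_def fam_add[symmetric] by (simp add: fam_def)
  qed
  have bG: "\<exists>C. \<forall>y. y \<noteq> 0 \<longrightarrow> \<bar>aG i y\<bar> \<le> C * (logb s \<eta> y * (1 - vcut K y)) / \<bar>y\<bar> ^ i" for i
    unfolding aG_def by (rule leib_sfam_bound[OF \<eta> cutd_chid_bound(2)])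
  have bR: "\<exists>C. \<forall>y. y \<noteq> 0 \<longrightarrow> \<bar>aR i y\<bar> \<le> C * (logb s \<eta> y * vcut K y) / \<bar>y\<bar> ^ i" for i
    unfolding aR_def by (rule leib_sfam_bound[OF \<eta> cutd_chid_bound(1)])
  have nnG: "logb s \<eta> y * (1 - vcut K y) \<ge> 0" and nnR: "logb s \<eta> y * vcut K y \<ge> 0" for y
    using vcut_bounds[of K y] logb_nonneg[of s \<eta> y] by auto
  have FG: "\<exists>C\<ge>0. \<forall>e>0. \<forall>x\<in>{-1..1}. x \<noteq> z \<longrightarrow>
      \<bar>G e q x\<bar> \<le> C * (e powr s * (logb s \<eta> ((x - z) / e) * (1 - vcut K ((x - z) / e))) / \<bar>x - z\<bar> ^ q)" for q
    unfolding G_def by (rule fam_bound[OF bG Dg_bounded z nnG])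
  have FR: "\<exists>C\<ge>0. \<forall>e>0. \<forall>x\<in>{-1..1}. x \<noteq> z \<longrightarrow>
      \<bar>R e q x\<bar> \<le> C * (e powr s * (logb s \<eta> ((x - z) / e) * vcut K ((x - z) / e)) / \<bar>x - z\<bar> ^ q)" for q
    unfolding R_def by (rule fam_bound[OF bR Dg_bounded z nnR])
  have mG: "G e q \<in> borel_measurable (jac c)" and mR: "R e q \<in> borel_measurable (jac c)" for e q c
    unfolding G_def R_def
    by (auto intro!: fam_measurable Dg_measurable leib_measurable sfam_measurable cutd_chid_measurable
        simp: aG_def[abs_def] aR_def[abs_def])
  have smooth: "(G e i has_real_derivative G e (Suc i) x) (at x within {-1..1})"
    if e: "e > 0" and i: "i \<le> m + r" and x: "x \<in> {-1..1}" for e i x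
  proof (cases "x = z")
    case False
    have "(aG i has_real_derivative aG (Suc i) y) (at y)" if "y \<noteq> 0" for i y
      unfolding aG_def by (rule leib_deriv[where A = "sfam s Q" and B = "chid K", OF sfam_deriv[OF that] chid_deriv[OF that]])
    then show ?thesis unfolding G_def
      by (intro fam_deriv[OF e] Dg x False) auto
  next
    case True
    have z0: "G e q z = 0" for q by (simp add: G_def fam_def aG_def sfam_def)
    obtain C where C: "C \<ge> 0" "\<And>x. x \<in> {-1..1} \<Longrightarrow> x \<noteq> z \<Longrightarrow>
      \<bar>G e i x\<bar> \<le> C * (e powr s * (logb s \<eta> ((x - z) / e) * (1 - vcut K ((x - z) / e))) / \<bar>x - z\<bar> ^ i)"
      using FG[of i] e by blast
    \<comment> \<open>The order of vanishing of the derivative \<open>i\<close> at \<open>z\<close>: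
      the complement of the cut-off contributes \<open>K\<close>, each derivative costs 1 and the
      logarithms cost \<open>\<eta>\<close>.\<close>
    let ?p = "s - \<eta> - real i + K"
    have p: "?p > 1" using i d0 tm unfolding K_def by (simp add: abs_if split: if_splits)
    have "(G e i has_real_derivative 0) (at z within {-1..1})"
    proof (rule DERIV_zero_of_power_bound[where \<phi> = "G e i", OF z0 p e])
      fix x assume x: "x \<in> {-1..1}" "x \<noteq> z" "\<bar>x - z\<bar> \<le> e"
      let ?y = "(x - z) / e"
      have y: "?y \<noteq> 0" "\<bar>?y\<bar> = \<bar>x - z\<bar> / e" "\<bar>?y\<bar> \<le> 1" using x e by auto
      have h: "\<bar>x - z\<bar> ^ i = e ^ i * \<bar>?y\<bar> ^ i" using e by (simp add: power_divide)
      have "\<bar>G e i x\<bar> \<le> C * (e powr s * (logb s \<eta> ?y * (1 - vcut K ?y)) / \<bar>x - z\<bar> ^ i)"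
        by (rule C) (use x in auto)
      also have "\<dots> = C * (e powr s / e ^ i * (logb s \<eta> ?y * (1 - vcut K ?y) / \<bar>?y\<bar> ^ i))" unfolding h by simp
      also have "\<dots> \<le> C * (e powr s / e ^ i * (2 * twopow ?p (s + \<eta> - real i) \<bar>?y\<bar>))"
        using C(1) e \<eta> by (intro mult_left_mono logb_cut_twopow(2)[OF y(1)]) auto
      also have "twopow ?p (s + \<eta> - real i) \<bar>?y\<bar> = \<bar>x - z\<bar> powr ?p / e powr ?p"
        using y e by (simp add: twopow_def powr_divide)
      finally show "\<bar>G e i x\<bar> \<le> (C * (e powr s / e ^ i * (2 / e powr ?p))) * \<bar>x - z\<bar> powr ?p"
        by (simp add: mult_ac)
    qed
    then show ?thesis using True z0 by simp
  qed
  have PR: "decay q (\<lambda>e. R e q)" if q: "q \<le> m" for q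
  proof -
    obtain C where C: "C \<ge> 0" "\<And>e x. e > 0 \<Longrightarrow> x \<in> {-1..1} \<Longrightarrow> x \<noteq> z \<Longrightarrow>
      \<bar>R e q x\<bar> \<le> C * (e powr s * (logb s \<eta> ((x - z) / e) * vcut K ((x - z) / e)) / \<bar>x - z\<bar> ^ q)"
      using FR[of q] by blast
    have tq: "0 \<le> \<theta> * real q" "\<theta> * real q \<le> \<theta> * real m" using th q by (auto intro: mult_left_mono)
    have "(2 - \<theta>) * real q \<le> (2 - \<theta>) * real m" using th2 q by (intro mult_left_mono) auto
    then have a1: "2 * (s - \<eta> - real q) + (d0 + \<theta> * real q) > 0"
      using \<eta> \<eta>4 by (simp add: left_diff_distrib right_diff_distrib)
    have a2: "2 * (s + \<eta> - real q - K) + (d0 + \<theta> * real q) < 0"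
      using tq \<eta> d0 unfolding K_def by (simp add: abs_if split: if_splits)
    show ?thesis
      by (rule scaled_norm_bound[where B = "\<lambda>y. logb s \<eta> y * vcut K y", OF b_plus wg _ a1 a2 mR])
        (use C tq d0 \<eta> in \<open>auto intro!: logb_cut_twopow(1)\<close>)
  qed
  have PG: "decay (q + r) (\<lambda>e. G e (q + r))" if q: "q \<le> m" for q
  proof -
    obtain C where C: "C \<ge> 0" "\<And>e x. e > 0 \<Longrightarrow> x \<in> {-1..1} \<Longrightarrow> x \<noteq> z \<Longrightarrow>
      \<bar>G e (q + r) x\<bar> \<le> C * (e powr s * (logb s \<eta> ((x - z) / e) * (1 - vcut K ((x - z) / e))) / \<bar>x - z\<bar> ^ (q + r))"
      using FG[of "q + r"] by blast
    have tq: "0 \<le> \<theta> * real (q + r)" using th by simp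
    have a1: "2 * (s - \<eta> - real (q + r) + K) + (d0 + \<theta> * real (q + r)) > 0"
      using tq \<eta> d0 tm q unfolding K_def by (simp add: abs_if split: if_splits)
    \<comment> \<open>Further derivatives only help: each changes the exponent in the scaled
      variable by \<theta> - 2, which is negative.\<close>
    have "(2 - \<theta>) * real (q + r) \<ge> (2 - \<theta>) * real r" using th2 by (intro mult_left_mono) auto
    then have a2: "2 * (s + \<eta> - real (q + r)) + (d0 + \<theta> * real (q + r)) < 0"
      using r' by (simp add: algebra_simps)
    show ?thesis
      by (rule scaled_norm_bound[where B = "\<lambda>y. logb s \<eta> y * (1 - vcut K y)", OF b_plus wg _ a1 a2 mG])
        (use C tq d0 \<eta> in \<open>auto intro!: logb_cut_twopow(2) simp del: of_nat_add\<close>)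
  qed
  show ?thesis
    by (intro exI[of _ G] exI[of _ R] exI[of _ r] conjI allI ballI impI sum smooth PR PG) assumption+
qed

abbreviation eps :: "nat \<Rightarrow> real" where
  "eps N \<equiv> real N powr - \<kappa>"

abbreviation rate :: "nat \<Rightarrow> nat \<Rightarrow> real" where
  "rate q N \<equiv> real N powr (2 * real q - \<kappa> * (2 * s + d0))"

text \<open>By \<open>\<kappa> * (2 - \<theta>) = 2\<close> each derivative costs exactly N^2 in the
  squared norm, in both geometries.\<close>

lemma rate_eps:
  assumes "N > 0"
  shows "eps N powr (2 * s - 2 * real q + (d0 + \<theta> * real q)) = rate q N"
proof -
  have "\<kappa> * (2 * s - 2 * real q + (d0 + \<theta> * real q)) = \<kappa> * (2 * s + d0) - \<kappa> * (2 - \<theta>) * real q"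
    by (simp add: algebra_simps)
  then have "- \<kappa> * (2 * s - 2 * real q + (d0 + \<theta> * real q)) = 2 * real q - \<kappa> * (2 * s + d0)"
    unfolding kap(2) by simp
  then show ?thesis unfolding powr_powr by (simp only:)
qed

lemma eventually_eps_le: "r0 > 0 \<Longrightarrow> \<forall>\<^sub>F N in sequentially. 0 < N \<and> eps N \<le> r0 \<and> eps N > 0"
proof -
  assume r0: "r0 > 0"
  have "((\<lambda>N. eps N) \<longlongrightarrow> 0) sequentially"
    using kap by (intro tendsto_neg_powr filterlim_real_sequentially) auto
  from order_tendstoD(2)[OF this r0] eventually_gt_at_top[of 0]
  show ?thesis by eventually_elim auto
qed

abbreviation approx_at :: "real poly \<Rightarrow> (real \<Rightarrow> nat \<Rightarrow> real \<Rightarrow> real) \<Rightarrow> nat \<Rightarrow> real \<Rightarrow> nat \<Rightarrow> bool" where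
  "approx_at Q G q C N \<equiv> L2 (b + real q) (F Q (eps N) q) \<and>
     sqd (b + real q) (F Q (eps N) q) (G (eps N) q) \<le> C * rate q N \<and>
     (\<exists>p. degree p \<le> N - q \<and> sqd (b + real q) (F Q (eps N) q) (poly p) \<le> C * rate q N)"

text \<open>The singular part \<open>R\<close> is already small enough and is approximated by 0;
  only \<open>G\<close> needs a polynomial. The distance to \<open>G\<close> itself is recorded too,
  since weak derivatives are later obtained as limits of such smooth functions.\<close>

lemma approx_F:
  "\<exists>G C. smooth_upto m G \<and> (\<forall>q\<le>m. C q \<ge> 0 \<and> (\<forall>\<^sub>F N in sequentially. approx_at Q G q (C q) N))"
proof -
  obtain G R r where sum: "\<And>e q x. F Q e q x = G e q x + R e q x"
    and G: "\<And>e i x. e > 0 \<Longrightarrow> i \<le> m + r \<Longrightarrow> x \<in> {-1..1} \<Longrightarrow> (G e i has_real_derivative G e (Suc i) x) (at x within {-1..1})"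
    and nR: "\<And>q. q \<le> m \<Longrightarrow> decay q (\<lambda>e. R e q)"
    and nG: "\<And>q. q \<le> m \<Longrightarrow> decay (q + r) (\<lambda>e. G e (q + r))"
    using split_F[of Q] by (elim exE conjE) blast
  have ex: "\<exists>C\<ge>0. \<forall>\<^sub>F N in sequentially. approx_at Q G q C N" if q: "q \<le> m" for q
  proof -
    obtain r1 C1 where 1: "0 < r1" "0 \<le> C1" "\<And>e. 0 < e \<Longrightarrow> e \<le> r1 \<Longrightarrow> L2 (b + real q) (R e q)"
       "\<And>e. 0 < e \<Longrightarrow> e \<le> r1 \<Longrightarrow> sqn (b + real q) (R e q) \<le> C1 * e powr (2 * s - 2 * real q + (d0 + \<theta> * real q))"
      using nR[OF q] by blast
    obtain r2 C2 where 2: "0 < r2" "0 \<le> C2"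
       "\<And>e. 0 < e \<Longrightarrow> e \<le> r2 \<Longrightarrow> sqn (b + real (q + r)) (G e (q + r))
         \<le> C2 * e powr (2 * s - 2 * real (q + r) + (d0 + \<theta> * real (q + r)))"
      using nG[OF q] by blast
    define C where "C = 2 * C1 + 2 * (4 ^ (2 * r) * C2)"
    have C: "C \<ge> 0" "C1 \<le> C" using 1 2 by (auto simp: C_def)
    show ?thesis
    proof (rule exI[of _ C], rule conjI[OF C(1)], use eventually_eps_le[OF 1(1)] eventually_eps_le[OF 2(1)]
        eventually_ge_at_top[of "4 * (q + r)"] in eventually_elim)
      case (elim N)
      define e where "e = eps N"
      have e: "e > 0" "e \<le> r1" "e \<le> r2" and N: "N > 0" "N \<ge> 4 * (q + r)" using elim by (auto simp: e_def)
      have LR: "L2 (b + real q) (R e q)" by (rule 1) (use e in auto)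
      have "continuous_on {-1..1} (G e q)" by (rule DERIV_continuous_on[OF G[OF e(1)]]) (use q in auto)
      then have LG: "L2 (b + real q) (G e q)" by (rule L2_continuous[OF b_plus])
      have Feq: "F Q e q = (\<lambda>x. G e q x + R e q x)" using sum by auto
      have LF: "L2 (b + real q) (F Q e q)" unfolding Feq by (rule L2_add[OF LG LR])
      have R1: "sqn (b + real q) (R e q) \<le> C1 * rate q N"
        using 1(4)[OF e(1,2)] rate_eps[OF N(1), of q] by (simp add: e_def)
      have "(\<lambda>x. F Q e q x - G e q x) = R e q" using sum by auto
      then have A: "sqd (b + real q) (F Q e q) (G e q) \<le> C * rate q N"
        using R1 mult_right_mono[OF C(2), of "rate q N"] by simp
      obtain p where p: "degree p \<le> N - q"
        "sqd (b + real q) (G e q) (poly p)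
           \<le> 4 ^ (2 * r) * real N powr (- 2 * real r) * sqn (b + real q + real r) (G e (q + r))"
        using Jackson_approx[OF b_plus N(2,1), of "\<lambda>i. G e (q + i)" q] G[OF e(1)] q by auto
      have "sqn (b + real q + real r) (G e (q + r)) \<le> C2 * rate (q + r) N"
        using 2(3)[OF e(1,3)] rate_eps[OF N(1), of "q + r"] by (simp add: e_def add.assoc)
      then have "4 ^ (2 * r) * real N powr (- 2 * real r) * sqn (b + real q + real r) (G e (q + r))
         \<le> 4 ^ (2 * r) * real N powr (- 2 * real r) * (C2 * rate (q + r) N)"
        by (intro mult_left_mono) auto
      also have "\<dots> = 4 ^ (2 * r) * C2 * (real N powr (- 2 * real r) * rate (q + r) N)" by simp
      \<comment> \<open>The gain N^(-2 r) of the Jackson estimate exactly compensates the cost of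
        \<open>r\<close> further derivatives.\<close>
      also have "real N powr (- 2 * real r) * rate (q + r) N = rate q N"
        unfolding powr_add[symmetric] by (simp add: algebra_simps)
      finally have G1: "sqd (b + real q) (G e q) (poly p) \<le> 4 ^ (2 * r) * C2 * rate q N"
        using p(2) by (rule order_trans[rotated])
      have "(\<lambda>x. F Q e q x - poly p x) = (\<lambda>x. (G e q x - poly p x) + R e q x)" using sum by auto
      then have "sqd (b + real q) (F Q e q) (poly p)
          \<le> 2 * sqd (b + real q) (G e q) (poly p)
            + 2 * sqn (b + real q) (R e q)"
        using ip_self_add_le[OF L2_diff[OF LG L2_poly[OF b_plus]] LR, of p] by simp
      also have "\<dots> \<le> C * rate q N" using G1 R1 by (simp add: C_def algebra_simps)
      finally show ?case using LF A p(1) unfolding e_def by blast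
    qed
  qed
  have "\<forall>q. \<exists>C. q \<le> m \<longrightarrow> C \<ge> 0 \<and> (\<forall>\<^sub>F N in sequentially. approx_at Q G q C N)"
    using ex by blast
  from choice[OF this] obtain C where
    "\<forall>q\<le>m. C q \<ge> 0 \<and> (\<forall>\<^sub>F N in sequentially. approx_at Q G q (C q) N)" by blast
  with G show ?thesis by (intro exI[of _ G] exI[of _ C]) auto
qed

end

section \<open>Identification of derivatives, and limits of weak derivatives\<close>

lemma deriv_family_unique:
  fixes A B :: "nat \<Rightarrow> real \<Rightarrow> real"
  assumes S: "open S"
    and A: "\<And>i x. x \<in> S \<Longrightarrow> (A i has_real_derivative A (Suc i) x) (at x)"
    and B: "\<And>i x. x \<in> S \<Longrightarrow> (B i has_real_derivative B (Suc i) x) (at x)"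
    and eq: "\<And>x. x \<in> S \<Longrightarrow> A 0 x = B 0 x" and x: "x \<in> S"
  shows "A q x = B q x"
  using x
proof (induction q arbitrary: x)
  case 0 then show ?case by (rule eq)
next
  case (Suc q)
  have "(B q has_real_derivative A (Suc q) x) (at x)"
    by (rule has_field_derivative_transform_within_open[OF A[OF Suc.prems] S Suc.prems]) (rule Suc.IH)
  then show ?case using B[OF Suc.prems] by (rule DERIV_unique)
qed

lemma higher_deriv_eq:
  fixes U :: "nat \<Rightarrow> real \<Rightarrow> real"
  assumes S: "open S"
    and U: "\<And>i x. i < k \<Longrightarrow> x \<in> S \<Longrightarrow> (U i has_real_derivative U (Suc i) x) (at x)"
    and u: "\<And>x. x \<in> S \<Longrightarrow> u x = U 0 x"
  shows "i \<le> k \<Longrightarrow> x \<in> S \<Longrightarrow> (deriv ^^ i) u x = U i x"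
proof (induction i arbitrary: x)
  case 0 then show ?case using u by simp
next
  case (Suc i)
  have "((deriv ^^ i) u has_real_derivative U (Suc i) x) (at x)"
    by (rule has_field_derivative_transform_within_open[OF U S Suc.prems(2)]) (use Suc in auto)
  then show ?case by (simp add: DERIV_imp_deriv)
qed

lemma ip_sum_self_le:
  assumes "\<And>j. j \<le> n \<Longrightarrow> L2 b (u j)"
  shows "sqn b (\<lambda>x. \<Sum>j\<le>n. c j * u j x) \<le> 2 ^ n * (\<Sum>j\<le>n. (c j)\<^sup>2 * sqn b (u j))"
  using assms
proof (induction n)
  case 0 then show ?case by (simp add: ip_cmult_left ip_cmult_right power2_eq_square)
next
  case (Suc n)
  have L: "L2 b (\<lambda>x. \<Sum>j\<le>n. c j * u j x)" by (intro L2_sum L2_cmult) (use Suc.prems in auto)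
  have "sqn b (\<lambda>x. \<Sum>j\<le>Suc n. c j * u j x)
     \<le> 2 * sqn b (\<lambda>x. \<Sum>j\<le>n. c j * u j x)
      + 2 * sqn b (\<lambda>x. c (Suc n) * u (Suc n) x)"
    using ip_self_add_le[OF L L2_cmult[OF Suc.prems[of "Suc n"]]] by simp
  also have "sqn b (\<lambda>x. c (Suc n) * u (Suc n) x)
      = (c (Suc n))\<^sup>2 * sqn b (u (Suc n))"
    by (simp add: ip_cmult_left ip_cmult_right power2_eq_square)
  also have "2 * sqn b (\<lambda>x. \<Sum>j\<le>n. c j * u j x)
      \<le> 2 * (2 ^ n * (\<Sum>j\<le>n. (c j)\<^sup>2 * sqn b (u j)))"
    using Suc by simp
  also have "2 * ((c (Suc n))\<^sup>2 * sqn b (u (Suc n)))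
      \<le> 2 * (2 ^ n * ((c (Suc n))\<^sup>2 * sqn b (u (Suc n))))"
  proof -
    have "1 * ((c (Suc n))\<^sup>2 * sqn b (u (Suc n))) \<le> 2 ^ n * ((c (Suc n))\<^sup>2 * sqn b (u (Suc n)))"
      by (intro mult_right_mono mult_nonneg_nonneg ip_self_nonneg) auto
    then show ?thesis by simp
  qed
  finally show ?case by (simp add: algebra_simps)
qed

lemma ln_power_powr_tendsto:
  assumes "a > 0"
  shows "(\<lambda>N. real N powr (- a) * ln (real N) ^ k) \<longlonglongrightarrow> 0"
proof -
  obtain C where C: "C \<ge> 0" "\<And>y. y > 0 \<Longrightarrow> \<bar>poly (monom 1 k) (ln y)\<bar> \<le> C * (y powr (a/2) + y powr (-(a/2)))"
    using poly_ln_bound[of "a/2" "monom 1 k"] assms by auto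
  show ?thesis
  proof (rule Lim_null_comparison)
    show "\<forall>\<^sub>F N in sequentially. norm (real N powr (- a) * ln (real N) ^ k) \<le> 2 * C * real N powr (- (a / 2))"
      using eventually_gt_at_top[of 0]
    proof eventually_elim
      case (elim N)
      then have N: "real N > 0" "real N \<ge> 1" by auto
      have "\<bar>ln (real N) ^ k\<bar> \<le> C * (real N powr (a/2) + real N powr (-(a/2)))"
        using C(2)[OF N(1)] by (simp add: poly_monom)
      also have "\<dots> \<le> C * (real N powr (a/2) + real N powr (a/2))"
        using N C assms by (intro mult_left_mono add_mono powr_mono) auto
      finally have "real N powr (- a) * \<bar>ln (real N) ^ k\<bar> \<le> real N powr (- a) * (C * (real N powr (a/2) + real N powr (a/2)))"
        by (intro mult_left_mono) auto
      also have "\<dots> = 2 * C * (real N powr (- a) * real N powr (a/2))" by simp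
      also have "real N powr (- a) * real N powr (a/2) = real N powr (- (a / 2))"
        unfolding powr_add[symmetric] by simp
      finally show ?case by (simp add: abs_mult)
    qed
    have "(\<lambda>N. real N powr (- (a / 2))) \<longlonglongrightarrow> 0"
      using assms by (intro tendsto_neg_powr filterlim_real_sequentially) auto
    then show "(\<lambda>N. 2 * C * real N powr (- (a / 2))) \<longlonglongrightarrow> 0"
      using tendsto_mult_left[of _ 0 _ "2 * C"] by fastforce
  qed
qed

lemma ip_tendsto:
  assumes L: "L2 b u" "L2 b w" and Ln: "\<forall>\<^sub>F n in sequentially. L2 b (v n)"
    and lim: "(\<lambda>n. sqd b u (v n)) \<longlonglongrightarrow> 0"
  shows "(\<lambda>n. ip b (v n) w) \<longlonglongrightarrow> ip b u w"
proof -
  have "(\<lambda>n. (ip b u w - ip b (v n) w)\<^sup>2) \<longlonglongrightarrow> 0"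
  proof (rule Lim_null_comparison)
    show "\<forall>\<^sub>F n in sequentially. norm ((ip b u w - ip b (v n) w)\<^sup>2)
        \<le> sqd b u (v n) * sqn b w"
      using Ln
    proof eventually_elim
      case (elim n)
      then show ?case using ip_Cauchy_Schwarz[OF L2_diff[OF L(1) elim] L(2)] L by (simp add: ip_diff_left)
    qed
    show "(\<lambda>n. sqd b u (v n) * sqn b w) \<longlonglongrightarrow> 0"
      using tendsto_mult_right[OF lim, of "sqn b w"] by simp
  qed
  from tendsto_real_sqrt[OF this] have "(\<lambda>n. ip b u w - ip b (v n) w) \<longlonglongrightarrow> 0"
    by (simp add: tendsto_rabs_zero_iff)
  from tendsto_diff[OF tendsto_const[of "ip b u w"] this] show ?thesis by simp
qed

text \<open>The defining identity is an equality of inner products with fixed polynomials, hence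
  closed under convergence of both functions in their weighted norms.\<close>

lemma weakder_limit:
  assumes b: "b > -1" and L: "L2 b u" "L2 (b + 1) u1"
    and Ln: "\<forall>\<^sub>F n in sequentially. L2 b (v n)" "\<forall>\<^sub>F n in sequentially. L2 (b + 1) (v1 n)"
    and w: "\<forall>\<^sub>F n in sequentially. weakder b (v n) (v1 n)"
    and lim: "(\<lambda>n. sqd b u (v n)) \<longlonglongrightarrow> 0"
      "(\<lambda>n. sqd (b + 1) u1 (v1 n)) \<longlonglongrightarrow> 0"
  shows "weakder b u u1"
  unfolding weakder_def
proof
  fix p
  have b1: "b + 1 > -1" using b by simp
  have 1: "(\<lambda>n. ip (b + 1) (v1 n) (poly p)) \<longlonglongrightarrow> ip (b + 1) u1 (poly p)"
    by (rule ip_tendsto[OF L(2) L2_poly[OF b1] Ln(2) lim(2)])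
  have 2: "(\<lambda>n. ip b (v n) (poly (jop b p))) \<longlonglongrightarrow> ip b u (poly (jop b p))"
    by (rule ip_tendsto[OF L(1) L2_poly[OF b] Ln(1) lim(1)])
  have "\<forall>\<^sub>F n in sequentially. ip (b + 1) (v1 n) (poly p) = ip b (v n) (poly (jop b p))"
    using w by eventually_elim (simp add: weakder_def)
  with 1 have "(\<lambda>n. ip b (v n) (poly (jop b p))) \<longlonglongrightarrow> ip (b + 1) u1 (poly p)"
    by (rule Lim_transform_eventually)
  then show "ip (b + 1) u1 (poly p) = ip b u (poly (jop b p))"
    using 2 by (rule LIMSEQ_unique)
qed

text \<open>On a compact subinterval the inverse weight is bounded, and weighted square
  integrability gives integrability of \<open>u\<close> times the weight by pairing with the
  constant 1.\<close>

lemma L2_set_integrable: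
  assumes b: "b > -1" and L: "L2 b u" and ac: "-1 < a" "c < 1"
  shows "set_integrable lborel {a..c} u"
proof (cases "a \<le> c")
  case False then show ?thesis by (simp add: set_integrable_def)
next
  case True
  have one: "L2 b (\<lambda>x. 1)" by (rule L2_continuous[OF b]) auto
  have i: "set_integrable lborel {-1<..<1} (\<lambda>x. (1 - x\<^sup>2) powr b * (u x * 1))"
    by (rule ip_lebesgue(1)[OF L one])
  then have "set_integrable lborel {a..c} (\<lambda>x. (1 - x\<^sup>2) powr b * (u x * 1))"
    by (rule set_integrable_subset) (use ac in auto)
  then have i': "integrable lborel (\<lambda>x. indicator {a..c} x *\<^sub>R ((1 - x\<^sup>2) powr b * u x))"
    by (simp add: set_integrable_def)
  have pos: "1 - x\<^sup>2 > 0" if "x \<in> {a..c}" for x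
    using that ac by (simp add: abs_square_less_1 abs_less_iff)
  have "continuous_on {a..c} (\<lambda>x. (1 - x\<^sup>2) powr (- b))"
    using pos by (intro continuous_intros) force
  then have "bounded ((\<lambda>x. (1 - x\<^sup>2) powr (- b)) ` {a..c})"
    by (intro compact_imp_bounded compact_continuous_image) auto
  then obtain K where "\<And>x. x \<in> {a..c} \<Longrightarrow> \<bar>(1 - x\<^sup>2) powr (- b)\<bar> \<le> K"
    unfolding bounded_iff real_norm_def by blast
  then have K: "\<And>x. x \<in> {a..c} \<Longrightarrow> (1 - x\<^sup>2) powr (- b) \<le> K" by (auto dest: abs_le_D1)
  have m: "(\<lambda>x. indicator {a..c} x *\<^sub>R u x) \<in> borel_measurable lborel"
  proof -
    have "(\<lambda>x. indicator {-1<..<1} x *\<^sub>R u x) \<in> borel_measurable lborel"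
      using L2_measurable[OF L] unfolding measurable_jac_iff set_borel_measurable_def .
    then have "(\<lambda>x. indicator {a..c} x *\<^sub>R (indicator {-1<..<1} x *\<^sub>R u x)) \<in> borel_measurable lborel"
      by measurable
    also have "(\<lambda>x. indicator {a..c} x *\<^sub>R (indicator {-1<..<1} x *\<^sub>R u x)) = (\<lambda>x. indicator {a..c} x *\<^sub>R u x)"
      using ac by (auto simp: fun_eq_iff indicator_def)
    finally show ?thesis .
  qed
  have le: "norm (indicator {a..c} x *\<^sub>R u x) \<le> norm (K * (indicator {a..c} x *\<^sub>R ((1 - x\<^sup>2) powr b * u x)))" for x
  proof (cases "x \<in> {a..c}")
    case x: True
    have "1 = (1 - x\<^sup>2) powr (- b) * (1 - x\<^sup>2) powr b"
      unfolding powr_add[symmetric] using pos[OF x] by simp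
    also have "\<dots> \<le> K * (1 - x\<^sup>2) powr b" by (intro mult_right_mono K x) auto
    finally have "1 * \<bar>u x\<bar> \<le> (K * (1 - x\<^sup>2) powr b) * \<bar>u x\<bar>" by (intro mult_right_mono) auto
    also have "\<dots> \<le> \<bar>K\<bar> * (1 - x\<^sup>2) powr b * \<bar>u x\<bar>" by (intro mult_right_mono) auto
    finally show ?thesis using x by (simp add: abs_mult mult.assoc)
  qed auto
  show ?thesis unfolding set_integrable_def
    by (rule Bochner_Integration.integrable_bound[OF integrable_mult_right[OF i'] m AE_I2[OF le]])
qed

section \<open>Expansion of the logarithm at the scale of the degree\<close>

context singular_point begin

abbreviation Fl :: "nat \<Rightarrow> real \<Rightarrow> nat \<Rightarrow> real \<Rightarrow> real" where
  "Fl j \<equiv> F (monom 1 j)"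

definition cj :: "nat \<Rightarrow> real \<Rightarrow> nat \<Rightarrow> real" where
  "cj \<mu> e j = real (\<mu> choose j) * ln e ^ (\<mu> - j)"

text \<open>The contribution of one term of the expansion, its coefficient included. The smooth term
  can thus be supplied by a different argument than the others.\<close>

abbreviation term_rate :: "nat \<Rightarrow> nat \<Rightarrow> nat \<Rightarrow> (nat \<Rightarrow> real) \<Rightarrow> bool" where
  "term_rate \<mu> j q \<rho> \<equiv> \<exists>C. \<forall>\<^sub>F N in sequentially. L2 (b + real q) (Fl j (eps N) q) \<and>
     (\<exists>p. degree p \<le> N - q \<and>
       (cj \<mu> (eps N) j)\<^sup>2 * sqd (b + real q) (Fl j (eps N) q) (poly p) \<le> C * \<rho> N)"

lemma F_0: "e > 0 \<Longrightarrow> x \<noteq> z \<Longrightarrow> F Q e 0 x = \<bar>x - z\<bar> powr s * poly Q (ln \<bar>x - z\<bar> - ln e) * Dg 0 x"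
  by (simp add: fam_def sfam_def powr_divide ln_div)

lemma F_deriv_at:
  assumes "e > 0" "x \<in> {-1<..<1}" "x \<noteq> z"
  shows "(F Q e q has_real_derivative F Q e (Suc q) x) (at x)"
  using F_deriv[of e x Q q] assms by (simp add: at_within_Icc_at)

text \<open>The left side lives at scale 1 and does not involve \<open>e\<close>, so
  \<open>e\<close> may vary with the degree. The identity is algebraic for \<open>q = 0\<close>; the
  higher orders follow because a family of successive derivatives is determined by its first member,
  and at \<open>z\<close> both sides are 0.\<close>

lemma F_expand:
  assumes e: "e > 0" and x: "x \<in> {-1<..<1}"
  shows "Fl \<mu> 1 q x = (\<Sum>j\<le>\<mu>. cj \<mu> e j * Fl j e q x)"
proof (cases "x = z")
  case True
  then show ?thesis by (simp add: F_at_z)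
next
  case False
  let ?S = "{-1<..<1} - {z}"
  show ?thesis
  proof (rule deriv_family_unique[where S = ?S and A = "Fl \<mu> 1" and
        B = "\<lambda>q x. \<Sum>j\<le>\<mu>. cj \<mu> e j * Fl j e q x"])
    show "open ?S" by (intro open_Diff) auto
    show "x \<in> ?S" using x False by simp
    fix i x assume x: "x \<in> ?S"
    show "(Fl \<mu> 1 i has_real_derivative Fl \<mu> 1 (Suc i) x) (at x)"
      by (rule F_deriv_at) (use x in auto)
    show "((\<lambda>x. \<Sum>j\<le>\<mu>. cj \<mu> e j * Fl j e i x) has_real_derivative
         (\<Sum>j\<le>\<mu>. cj \<mu> e j * Fl j e (Suc i) x)) (at x)"
      by (intro DERIV_sum DERIV_cmult F_deriv_at) (use x e in auto)
  next
    fix x assume x: "x \<in> ?S"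
    let ?L = "ln \<bar>x - z\<bar>"
    have "?L ^ \<mu> = ((?L - ln e) + ln e) ^ \<mu>" by simp
    also have "\<dots> = (\<Sum>j\<le>\<mu>. real (\<mu> choose j) * (?L - ln e) ^ j * ln e ^ (\<mu> - j))"
      by (rule binomial_ring)
    finally show "Fl \<mu> 1 0 x = (\<Sum>j\<le>\<mu>. cj \<mu> e j * Fl j e 0 x)"
      using x e by (simp add: F_0 poly_monom cj_def sum_distrib_left sum_distrib_right mult_ac)
  qed
qed

text \<open>For N at least 3 one has ln N at least 1, so any larger power of the logarithm is also a
  bound. Leaving \<open>k\<close> free serves both the exponent \<open>\<mu>\<close> and the
  improved exponent \<open>\<mu> - 1\<close>.\<close>

lemma cj_sq_le:
  "\<exists>C\<ge>0. \<forall>\<^sub>F N in sequentially. \<forall>k. \<mu> - j \<le> k \<longrightarrow> (cj \<mu> (eps N) j)\<^sup>2 \<le> C * ln (real N) ^ (2 * k)"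
proof (rule exI[of _ "(real (\<mu> choose j) * \<kappa> ^ (\<mu> - j))\<^sup>2"], rule conjI)
  show "\<forall>\<^sub>F N in sequentially. \<forall>k. \<mu> - j \<le> k \<longrightarrow>
     (cj \<mu> (eps N) j)\<^sup>2 \<le> (real (\<mu> choose j) * \<kappa> ^ (\<mu> - j))\<^sup>2 * ln (real N) ^ (2 * k)"
    using eventually_ge_at_top[of 3]
  proof (eventually_elim, intro allI impI)
    fix N :: nat and k assume N: "3 \<le> N" and k: "\<mu> - j \<le> k"
    have "1 \<le> ln (3::real)" using ln3_gt_1 by simp
    also have "\<dots> \<le> ln (real N)" using N by simp
    finally have l1: "1 \<le> ln (real N)" .
    have "cj \<mu> (eps N) j = real (\<mu> choose j) * (- \<kappa> * ln (real N)) ^ (\<mu> - j)"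
      using N by (simp add: cj_def ln_powr)
    then have "(cj \<mu> (eps N) j)\<^sup>2 = (real (\<mu> choose j) * \<kappa> ^ (\<mu> - j))\<^sup>2 * ln (real N) ^ (2 * (\<mu> - j))"
    proof -
      have "((- \<kappa> * L) ^ n)\<^sup>2 = (\<kappa> ^ n)\<^sup>2 * L ^ (2 * n)" for L :: real and n
      proof -
        have "((- \<kappa> * L) ^ n)\<^sup>2 = ((- \<kappa> * L)\<^sup>2) ^ n" by (simp only: power_mult[symmetric] mult.commute)
        also have "(- \<kappa> * L)\<^sup>2 = \<kappa>\<^sup>2 * L\<^sup>2" by (simp add: power_mult_distrib)
        also have "(\<kappa>\<^sup>2 * L\<^sup>2) ^ n = (\<kappa> ^ n)\<^sup>2 * L ^ (2 * n)"
          by (simp add: power_mult_distrib power_mult[symmetric] mult.commute)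
        finally show ?thesis .
      qed
      then show ?thesis using \<open>cj \<mu> (eps N) j = _\<close> by (simp only: power_mult_distrib mult.assoc)
    qed
    also have "\<dots> \<le> (real (\<mu> choose j) * \<kappa> ^ (\<mu> - j))\<^sup>2 * ln (real N) ^ (2 * k)"
      using l1 k by (intro mult_left_mono power_increasing) auto
    finally show "(cj \<mu> (eps N) j)\<^sup>2 \<le> (real (\<mu> choose j) * \<kappa> ^ (\<mu> - j))\<^sup>2 * ln (real N) ^ (2 * k)" .
  qed
qed simp

lemma rate_exponent_neg: "q \<le> m \<Longrightarrow> 2 * real q - \<kappa> * (2 * s + d0) < 0"
proof -
  assume q: "q \<le> m"
  have "(2 - \<theta>) * real q \<le> (2 - \<theta>) * real m" using th2 q by (intro mult_left_mono) auto
  then have "(2 - \<theta>) * real q < 2 * s + d0" using sm by (simp add: left_diff_distrib)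
  then have "\<kappa> * ((2 - \<theta>) * real q) < \<kappa> * (2 * s + d0)" using kap by simp
  then show ?thesis using kap(2) by (simp add: mult.assoc[symmetric])
qed

lemma combine_at:
  assumes e: "e > 0" and F: "\<And>j. j \<le> \<mu> \<Longrightarrow> L2 c (Fl j e q)" and A: "\<And>j. j \<le> \<mu> \<Longrightarrow> L2 c (A j)"
  shows "sqn c (\<lambda>x. Fl \<mu> 1 q x - (\<Sum>j\<le>\<mu>. cj \<mu> e j * A j x))
    \<le> 2 ^ \<mu> * (\<Sum>j\<le>\<mu>. (cj \<mu> e j)\<^sup>2 *
        sqd c (Fl j e q) (A j))"
proof -
  have "sqn c (\<lambda>x. Fl \<mu> 1 q x - (\<Sum>j\<le>\<mu>. cj \<mu> e j * A j x)) =
    sqn c (\<lambda>x. \<Sum>j\<le>\<mu>. cj \<mu> e j * (Fl j e q x - A j x))"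
    by (rule ip_cong) (simp_all add: F_expand[OF e] right_diff_distrib sum_subtractf)
  also have "\<dots> \<le> 2 ^ \<mu> * (\<Sum>j\<le>\<mu>. (cj \<mu> e j)\<^sup>2 *
        sqd c (Fl j e q) (A j))"
    by (rule ip_sum_self_le) (intro L2_diff F A)
  finally show ?thesis .
qed

text \<open>The scaled estimates hold only for small scales; a single admissible scale in the
  expansion transfers square integrability to scale 1.\<close>

lemma L2_F:
  assumes q: "q \<le> m"
  shows "L2 (b + real q) (Fl \<mu> 1 q)"
proof -
  have "\<forall>\<^sub>F N in sequentially. \<forall>j\<in>{..\<mu>}. L2 (b + real q) (Fl j (eps N) q)"
  proof (rule eventually_ball_finite)
    show "\<forall>j\<in>{..\<mu>}. \<forall>\<^sub>F N in sequentially. L2 (b + real q) (Fl j (eps N) q)"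
    proof
      fix j
      show "\<forall>\<^sub>F N in sequentially. L2 (b + real q) (Fl j (eps N) q)"
        using approx_F[of "monom 1 j"] q unfolding eventually_conj_iff by blast
    qed
  qed simp
  from eventually_happens'[OF sequentially_bot eventually_conj[OF this eventually_gt_at_top[of 0]]]
  obtain N where N: "N > 0" "\<And>j. j \<le> \<mu> \<Longrightarrow> L2 (b + real q) (Fl j (eps N) q)" by auto
  have e: "eps N > 0" using N by simp
  have "L2 (b + real q) (\<lambda>x. \<Sum>j\<le>\<mu>. cj \<mu> (eps N) j * Fl j (eps N) q x)"
    by (intro L2_sum L2_cmult N) auto
  then show ?thesis by (subst L2_cong[OF F_expand[OF e]])
qed

text \<open>Passing to the limit from the smooth parts avoids all boundary terms at \<open>\<plusminus>1\<close> and at \<open>z\<close>.\<close>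
lemma weakder_F:
  assumes q: "Suc q \<le> m"
  shows "weakder (b + real q) (Fl \<mu> 1 q) (Fl \<mu> 1 (Suc q))"
proof -
  let ?P = "\<lambda>j G C. smooth_upto m G \<and>
    (\<forall>q\<le>m. C q \<ge> 0 \<and> (\<forall>\<^sub>F N in sequentially. approx_at (monom 1 j) G q (C q) N))"
  have "\<forall>j. \<exists>G C. ?P j G C" by (intro allI approx_F)
  from choice[OF this] obtain G where "\<forall>j. \<exists>C. ?P j (G j) C" by blast
  from choice[OF this] obtain C where GC: "\<forall>j. ?P j (G j) (C j)" by blast
  then have G: "\<And>j e i x. e > 0 \<Longrightarrow> i \<le> m \<Longrightarrow> x \<in> {-1..1} \<Longrightarrow>
      (G j e i has_real_derivative G j e (Suc i) x) (at x within {-1..1})" by blast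
  \<comment> \<open>The smooth approximants: the expansion with every term replaced by its smooth
    part, in each order of derivative.\<close>
  define v where "v = (\<lambda>q N x. \<Sum>j\<le>\<mu>. cj \<mu> (eps N) j * G j (eps N) q x)"
  have Gc: "continuous_on {-1..1} (G j e i)" if "e > 0" "i \<le> m" for j e i
    by (rule DERIV_continuous_on[OF G[OF that(1)]]) (use that in auto)
  have GL: "L2 (b + real p) (G j e i)" if "e > 0" "i \<le> m" for j e i p
    by (rule L2_continuous[OF b_plus Gc[OF that]])
  have ev0: "\<forall>\<^sub>F N in sequentially. eps N > 0"
    using eventually_gt_at_top[of 0] by eventually_elim simp
  have vL: "\<forall>\<^sub>F N in sequentially. L2 (b + real i) (v i N)" if "i \<le> m" for i
    using ev0 by eventually_elim (auto simp: v_def intro!: L2_sum L2_cmult GL that)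
  have lim: "(\<lambda>N. sqd (b + real i) (Fl \<mu> 1 i) (v i N)) \<longlonglongrightarrow> 0"
    if i: "i \<le> m" for i
  proof -
    have C: "\<And>j. C j i \<ge> 0" "\<And>j. \<forall>\<^sub>F N in sequentially. approx_at (monom 1 j) (G j) i (C j i) N"
      using GC i by blast+
    have "\<forall>j. \<exists>D. D \<ge> 0 \<and> (\<forall>\<^sub>F N in sequentially. \<forall>k. \<mu> - j \<le> k \<longrightarrow> (cj \<mu> (eps N) j)\<^sup>2 \<le> D * ln (real N) ^ (2 * k))"
      by (intro allI cj_sq_le)
    from choice[OF this] obtain D where D: "\<And>j. D j \<ge> 0"
      "\<And>j. \<forall>\<^sub>F N in sequentially. \<forall>k. \<mu> - j \<le> k \<longrightarrow> (cj \<mu> (eps N) j)\<^sup>2 \<le> D j * ln (real N) ^ (2 * k)"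
      by blast
    have "\<forall>\<^sub>F N in sequentially. \<forall>j\<in>{..\<mu>}. approx_at (monom 1 j) (G j) i (C j i) N \<and>
       (\<forall>k. \<mu> - j \<le> k \<longrightarrow> (cj \<mu> (eps N) j)\<^sup>2 \<le> D j * ln (real N) ^ (2 * k))"
      by (intro eventually_ball_finite ballI eventually_conj C D) simp
    then have ev: "\<forall>\<^sub>F N in sequentially. norm (sqd (b + real i) (Fl \<mu> 1 i) (v i N))
        \<le> 2 ^ \<mu> * (\<Sum>j\<le>\<mu>. D j * C j i) * (rate i N * ln (real N) ^ (2 * \<mu>))"
      using ev0
    proof eventually_elim
      case (elim N)
      have "sqd (b + real i) (Fl \<mu> 1 i) (v i N)
        \<le> 2 ^ \<mu> * (\<Sum>j\<le>\<mu>. (cj \<mu> (eps N) j)\<^sup>2 * sqd (b + real i) (Fl j (eps N) i) (G j (eps N) i))"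
        unfolding v_def by (rule combine_at) (use elim GL i in auto)
      also have "\<dots> \<le> 2 ^ \<mu> * (\<Sum>j\<le>\<mu>. (D j * ln (real N) ^ (2 * \<mu>)) * (C j i * rate i N))"
        using elim D C by (intro mult_left_mono sum_mono mult_mono ip_self_nonneg) auto
      also have "\<dots> = 2 ^ \<mu> * (\<Sum>j\<le>\<mu>. D j * C j i) * (rate i N * ln (real N) ^ (2 * \<mu>))"
        unfolding sum_distrib_left sum_distrib_right by (intro sum.cong refl) (simp only: mult_ac)
      finally show ?case by (simp add: ip_self_nonneg)
    qed
    \<comment> \<open>For the mere convergence a crude power of ln N suffices, since the exponent of
      \<open>rate\<close> is negative for all orders up to \<open>m\<close>.\<close>
    have "(\<lambda>N. 2 ^ \<mu> * (\<Sum>j\<le>\<mu>. D j * C j i) * (rate i N * ln (real N) ^ (2 * \<mu>))) \<longlonglongrightarrow> 2 ^ \<mu> * (\<Sum>j\<le>\<mu>. D j * C j i) * 0"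
      using ln_power_powr_tendsto[of "- (2 * real i - \<kappa> * (2 * s + d0))" "2 * \<mu>"] rate_exponent_neg[OF i]
      by (intro tendsto_mult_left) simp
    then show ?thesis by (intro Lim_null_comparison[OF ev]) simp
  qed
  have bS: "b + real q + 1 = b + real (Suc q)" by simp
  show ?thesis
  proof (rule weakder_limit[where v = "v q" and ?v1.0 = "v (Suc q)", OF b_plus])
    show "\<forall>\<^sub>F n in sequentially. weakder (b + real q) (v q n) (v (Suc q) n)"
      using ev0
    proof eventually_elim
      case (elim n)
      show ?case
      proof (rule weakder_C1[OF b_plus])
        show "continuous_on {-1..1} (v q n)" "continuous_on {-1..1} (v (Suc q) n)"
          unfolding v_def using q by (auto intro!: continuous_on_sum continuous_on_mult continuous_on_const Gc elim)
        fix x :: real assume x: "x \<in> {-1<..<1}"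
        have "(G j (eps n) q has_real_derivative G j (eps n) (Suc q) x) (at x)" for j
          using G[OF elim, of q x j] x q by (simp add: at_within_Icc_at)
        then show "(v q n has_real_derivative v (Suc q) n x) (at x)"
          unfolding v_def by (intro DERIV_sum DERIV_cmult)
      qed
    qed
  qed (unfold bS, use q in \<open>auto intro!: vL lim L2_F simp del: of_nat_Suc\<close>)
qed

lemma proj_of_iter:
  assumes P: "proj_of b N (Fl \<mu> 1 0) P" and q: "q \<le> m" "q \<le> N"
  shows "proj_of (b + real q) (N - q) (Fl \<mu> 1 q) ((pderiv ^^ q) P)"
  using q
proof (induction q)
  case 0 then show ?case using P by simp
next
  case (Suc q)
  have "proj_of (b + real q + 1) (N - q - 1) (Fl \<mu> 1 (Suc q)) (pderiv ((pderiv ^^ q) P))"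
    by (rule proj_of_pderiv[OF b_plus L2_F _ weakder_F])
      (use Suc L2_F[of "Suc q"] in \<open>auto simp: add_ac\<close>)
  then show ?case by (simp add: add_ac)
qed

text \<open>The competitor is the combination of the polynomials of the single terms with the same
  coefficients, and the differentiated projection beats it. \<open>P\<close> is quantified inside,
  so the threshold for \<open>N\<close> does not depend on it.\<close>

lemma error_bound:
  assumes q: "q \<le> m"
    and H: "\<And>j. j \<le> \<mu> \<Longrightarrow> term_rate \<mu> j q \<rho>"
  shows "\<exists>C. \<forall>\<^sub>F N in sequentially. \<forall>P. proj_of b N (Fl \<mu> 1 0) P \<longrightarrow>
    sqd (b + real q) (Fl \<mu> 1 q) (poly ((pderiv ^^ q) P)) \<le> C * \<rho> N"
proof -
  define E where "E = (\<lambda>N j p. sqd (b + real q) (Fl j (eps N) q) (poly p))"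
  have "\<forall>j. \<exists>C. j \<le> \<mu> \<longrightarrow> (\<forall>\<^sub>F N in sequentially. L2 (b + real q) (Fl j (eps N) q) \<and>
      (\<exists>p. degree p \<le> N - q \<and> (cj \<mu> (eps N) j)\<^sup>2 * E N j p \<le> C * \<rho> N))"
  proof
    fix j
    show "\<exists>C. j \<le> \<mu> \<longrightarrow> (\<forall>\<^sub>F N in sequentially. L2 (b + real q) (Fl j (eps N) q) \<and>
      (\<exists>p. degree p \<le> N - q \<and> (cj \<mu> (eps N) j)\<^sup>2 * E N j p \<le> C * \<rho> N))"
      using H[of j] unfolding E_def by (cases "j \<le> \<mu>") simp_all
  qed
  from choice[OF this] obtain C where C: "\<And>j. j \<le> \<mu> \<Longrightarrow> \<forall>\<^sub>F N in sequentially. L2 (b + real q) (Fl j (eps N) q) \<and>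
      (\<exists>p. degree p \<le> N - q \<and> (cj \<mu> (eps N) j)\<^sup>2 * E N j p \<le> C j * \<rho> N)"
    by blast
  have "\<forall>\<^sub>F N in sequentially. \<forall>j\<in>{..\<mu>}. L2 (b + real q) (Fl j (eps N) q) \<and>
      (\<exists>p. degree p \<le> N - q \<and> (cj \<mu> (eps N) j)\<^sup>2 * E N j p \<le> C j * \<rho> N)"
    by (intro eventually_ball_finite ballI C) auto
  then have "\<forall>\<^sub>F N in sequentially. \<forall>P. proj_of b N (Fl \<mu> 1 0) P \<longrightarrow>
    sqd (b + real q) (Fl \<mu> 1 q) (poly ((pderiv ^^ q) P)) \<le> (2 ^ \<mu> * (\<Sum>j\<le>\<mu>. C j)) * \<rho> N"
    using eventually_gt_at_top[of m]
  proof (eventually_elim, intro allI impI)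
    fix N P
    assume A: "\<forall>j\<in>{..\<mu>}. L2 (b + real q) (Fl j (eps N) q) \<and>
      (\<exists>p. degree p \<le> N - q \<and> (cj \<mu> (eps N) j)\<^sup>2 * E N j p \<le> C j * \<rho> N)"
      and N: "m < N" and P: "proj_of b N (Fl \<mu> 1 0) P"
    have e: "eps N > 0" using N by simp
    have "\<forall>j. \<exists>p. j \<le> \<mu> \<longrightarrow> degree p \<le> N - q \<and> (cj \<mu> (eps N) j)\<^sup>2 * E N j p \<le> C j * \<rho> N"
      using A by auto
    from choice[OF this] obtain p where p: "\<And>j. j \<le> \<mu> \<Longrightarrow> degree (p j) \<le> N - q"
      "\<And>j. j \<le> \<mu> \<Longrightarrow> (cj \<mu> (eps N) j)\<^sup>2 * E N j (p j) \<le> C j * \<rho> N"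
      by blast
    define r where "r = (\<Sum>j\<le>\<mu>. smult (cj \<mu> (eps N) j) (p j))"
    have dr: "degree r \<le> N - q"
      unfolding r_def by (intro degree_sum_le) (auto intro: order_trans[OF degree_smult_le] p)
    have "sqd (b + real q) (Fl \<mu> 1 q) (poly ((pderiv ^^ q) P))
       \<le> sqd (b + real q) (Fl \<mu> 1 q) (poly r)"
      by (rule proj_of_best[OF b_plus L2_F[OF q] proj_of_iter[OF P q] dr]) (use N q in auto)
    also have "\<dots> \<le> 2 ^ \<mu> * (\<Sum>j\<le>\<mu>. (cj \<mu> (eps N) j)\<^sup>2 * E N j (p j))"
      unfolding r_def poly_sum_smult_fun E_def
      by (rule combine_at[OF e]) (use A L2_poly[OF b_plus] in auto)
    also have "\<dots> \<le> 2 ^ \<mu> * (\<Sum>j\<le>\<mu>. C j * \<rho> N)"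
      by (intro mult_left_mono sum_mono p(2)) auto
    finally show "sqd (b + real q) (Fl \<mu> 1 q) (poly ((pderiv ^^ q) P)) \<le> (2 ^ \<mu> * (\<Sum>j\<le>\<mu>. C j)) * \<rho> N"
      by (simp add: sum_distrib_right mult.assoc)
  qed
  then show ?thesis by blast
qed

text \<open>The cost of derivatives is monotone in \<open>q\<close>, so the highest order
  \<open>m\<close> dictates the common rate.\<close>

lemma term_bound:
  assumes q: "q \<le> m" and k: "\<mu> - j \<le> k"
  shows "term_rate \<mu> j q (\<lambda>N. rate m N * ln (real N) ^ (2 * k))"
proof -
  obtain D where D: "D \<ge> 0" "\<forall>\<^sub>F N in sequentially. \<forall>k. \<mu> - j \<le> k \<longrightarrow> (cj \<mu> (eps N) j)\<^sup>2 \<le> D * ln (real N) ^ (2 * k)"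
    using cj_sq_le by blast
  define E where "E = (\<lambda>N p. sqd (b + real q) (Fl j (eps N) q) (poly p))"
  obtain C where C: "C \<ge> 0" "\<forall>\<^sub>F N in sequentially. L2 (b + real q) (Fl j (eps N) q)"
      "\<forall>\<^sub>F N in sequentially. \<exists>p. degree p \<le> N - q \<and> E N p \<le> C * rate q N"
    using approx_F[of "monom 1 j"] q unfolding E_def eventually_conj_iff by blast
  have "\<forall>\<^sub>F N in sequentially. L2 (b + real q) (Fl j (eps N) q) \<and>
      (\<exists>p. degree p \<le> N - q \<and> (cj \<mu> (eps N) j)\<^sup>2 * E N p \<le> (D * C) * (rate m N * ln (real N) ^ (2 * k)))"
    using C(2,3) D(2) eventually_gt_at_top[of 0]
  proof eventually_elim
    case (elim N)
    obtain p where p: "degree p \<le> N - q" "E N p \<le> C * rate q N" using elim by blast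
    have "rate q N \<le> rate m N" using elim q by (intro powr_mono) auto
    then have "E N p \<le> C * rate m N" using p(2) mult_left_mono[OF _ C(1)] order_trans by blast
    moreover have "(cj \<mu> (eps N) j)\<^sup>2 \<le> D * ln (real N) ^ (2 * k)" using elim k by simp
    ultimately have "(cj \<mu> (eps N) j)\<^sup>2 * E N p \<le> (D * ln (real N) ^ (2 * k)) * (C * rate m N)"
      using D(1) by (intro mult_mono) (auto simp: E_def ip_self_nonneg)
    then show ?case using elim p(1) by (intro conjI exI[of _ p]) (auto simp: mult_ac)
  qed
  then show ?thesis unfolding E_def by blast
qed

text \<open>When \<open>H\<close> extends smoothly to the closed interval the Jackson estimate
  applies with any number of derivatives and no cut-off. The rate therefore holds with every
  exponent \<open>k\<close> of the logarithm, although the coefficient still has size ln^\<mu>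
  N.\<close>

lemma smooth_term_bound:
  assumes zo: "z \<notin> {-1<..<1}"
    and H: "\<And>i x. x \<in> {-1..1} \<Longrightarrow> (H i has_real_derivative H (Suc i) x) (at x within {-1..1})"
    and H0: "\<And>x. x \<in> {-1<..<1} \<Longrightarrow> H 0 x = \<bar>x - z\<bar> powr s * Dg 0 x"
    and q: "q \<le> m"
  shows "term_rate \<mu> 0 q (\<lambda>N. rate m N * ln (real N) ^ (2 * k))"
proof -
  obtain D where D: "D \<ge> 0" "\<forall>\<^sub>F N in sequentially. \<forall>k. \<mu> - 0 \<le> k \<longrightarrow> (cj \<mu> (eps N) 0)\<^sup>2 \<le> D * ln (real N) ^ (2 * k)"
    using cj_sq_le[of \<mu> 0] by blast
  have FH: "Fl 0 e i x = H i x" if "e > 0" "x \<in> {-1<..<1}" for e i x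
  proof (rule deriv_family_unique[where S = "{-1<..<1}" and A = "Fl 0 e" and B = H])
    fix i x assume x: "x \<in> {-1<..<1::real}"
    then have xz: "x \<noteq> z" using zo by auto
    show "(Fl 0 e i has_real_derivative Fl 0 e (Suc i) x) (at x)"
      by (rule F_deriv_at[OF that(1) x xz])
    show "(H i has_real_derivative H (Suc i) x) (at x)"
      using H[of x i] x by (simp add: at_within_Icc_at)
  next
    fix x assume x: "x \<in> {-1<..<1::real}"
    then have xz: "x \<noteq> z" using zo by auto
    show "Fl 0 e 0 x = H 0 x" using F_0[OF that(1) xz, of "monom 1 0"] H0[OF x] by (simp add: poly_monom)
  qed (use that in auto)
  \<comment> \<open>The additional 1 provides a spare factor 1/N, which swallows the power of ln N
    in the coefficient.\<close>
  obtain r :: nat where "(\<kappa> * (2 * s + d0) + 1) / 2 \<le> real r" using real_arch_simple by blast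
  then have r: "\<kappa> * (2 * s + d0) + 1 \<le> 2 * real r"
    by (simp only: pos_divide_le_eq zero_less_numeral mult.commute[of _ "2 :: real"])
  define I where "I = 4 ^ (2 * r) * sqn (b + real q + real r) (H (q + r))"
  have I: "I \<ge> 0" by (simp add: I_def ip_self_nonneg)
  have cH: "continuous_on {-1..1} (H i)" for i by (rule DERIV_continuous_on[OF H])
  have lim: "(\<lambda>N. real N powr (- 1) * ln (real N) ^ (2 * \<mu>)) \<longlonglongrightarrow> 0" by (rule ln_power_powr_tendsto) simp
  have "\<forall>\<^sub>F N in sequentially. real N powr (- 1) * ln (real N) ^ (2 * \<mu>) < 1"
    by (rule order_tendstoD(2)[OF lim]) simp
  then have "\<forall>\<^sub>F N in sequentially. L2 (b + real q) (Fl 0 (eps N) q) \<and>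
      (\<exists>p. degree p \<le> N - q \<and> (cj \<mu> (eps N) 0)\<^sup>2 *
         sqd (b + real q) (Fl 0 (eps N) q) (poly p) \<le> (D * I) * (rate m N * ln (real N) ^ (2 * k)))"
    using D(2) eventually_ge_at_top[of "max 3 (4 * (q + r))"]
  proof eventually_elim
    case (elim N)
    have N: "N \<ge> 3" "N \<ge> 4 * (q + r)" "N > 0" using elim by auto
    have e: "eps N > 0" using N by simp
    have "1 \<le> ln (3::real)" using ln3_gt_1 by simp
    also have "\<dots> \<le> ln (real N)" using N by simp
    finally have l1: "1 \<le> ln (real N)" .
    have L: "L2 (b + real q) (Fl 0 (eps N) q)"
      by (rule L2_cong[THEN iffD2, OF FH[OF e] L2_continuous[OF b_plus cH]])
    obtain p where p: "degree p \<le> N - q" "sqd (b + real q) (H q) (poly p)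
       \<le> 4 ^ (2 * r) * real N powr (- 2 * real r) * sqn (b + real q + real r) (H (q + r))"
      using Jackson_approx[OF b_plus N(2,3), of "\<lambda>i. H (q + i)" q] H by auto
    have "sqd (b + real q) (Fl 0 (eps N) q) (poly p)
       = sqd (b + real q) (H q) (poly p)"
      by (rule ip_cong) (simp_all only: FH[OF e])
    also have "\<dots> \<le> I * real N powr (- 2 * real r)" using p(2) by (simp add: I_def mult_ac)
    finally have E: "sqd (b + real q) (Fl 0 (eps N) q) (poly p)
        \<le> I * real N powr (- 2 * real r)" .
    have "(cj \<mu> (eps N) 0)\<^sup>2 \<le> D * ln (real N) ^ (2 * \<mu>)" using elim by simp
    then have "(cj \<mu> (eps N) 0)\<^sup>2 * sqd (b + real q) (Fl 0 (eps N) q) (poly p)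
       \<le> (D * ln (real N) ^ (2 * \<mu>)) * (I * real N powr (- 2 * real r))"
      using E D(1) l1 by (intro mult_mono) (auto simp: ip_self_nonneg)
    also have "\<dots> = (D * I) * (ln (real N) ^ (2 * \<mu>) * real N powr (- 2 * real r))" by simp
    also have "\<dots> \<le> (D * I) * (rate m N * ln (real N) ^ (2 * k))"
    proof (rule mult_left_mono)
      have "real N powr (- 2 * real r) \<le> real N powr (-1 + (2 * real m - \<kappa> * (2 * s + d0)))"
        using N r by (intro powr_mono) auto
      also have "\<dots> = real N powr (-1) * rate m N" by (rule powr_add)
      finally have "ln (real N) ^ (2 * \<mu>) * real N powr (- 2 * real r) \<le> ln (real N) ^ (2 * \<mu>) * (real N powr (-1) * rate m N)"
        using l1 by (intro mult_left_mono) auto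
      also have "\<dots> = (real N powr (- 1) * ln (real N) ^ (2 * \<mu>)) * rate m N" by simp
      also have "\<dots> \<le> 1 * rate m N" using elim by (intro mult_right_mono) auto
      also have "\<dots> \<le> ln (real N) ^ (2 * k) * rate m N"
        using l1 by (intro mult_right_mono one_le_power) auto
      finally show "ln (real N) ^ (2 * \<mu>) * real N powr (- 2 * real r) \<le> rate m N * ln (real N) ^ (2 * k)"
        by (simp add: mult.commute)
    qed (use D I in auto)
    finally show ?case using L p(1) by blast
  qed
  then show ?thesis by blast
qed

end

section \<open>The Sobolev error\<close>

text \<open>The pointwise \<open>deriv\<close> of order \<open>m\<close> has no useful value at
  \<open>z\<close>, so it agrees with the explicit derivative only elsewhere. Redefining a function
  at one point affects neither measurability nor the integral.\<close>

lemma L2_cong_neq: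
  assumes U: "L2 b U" and eq: "\<And>x. x \<in> {-1<..<1} \<Longrightarrow> x \<noteq> z \<Longrightarrow> W x = U x"
  shows "L2 b W"
proof -
  have Um: "U \<in> borel_measurable (jac b)" by (rule L2_measurable[OF U])
  have "(\<lambda>x. if x = z then W z else U x) \<in> borel_measurable (jac b)"
  proof (rule measurable_If[OF _ Um])
    have "(\<lambda>x. x = z) \<in> measurable (restrict_space borel {-1<..<1}) (count_space UNIV)"
      by (rule measurable_restrict_space1) simp
    then have "Measurable.pred (jac b) (\<lambda>x. x = z)"
      using measurable_cong_sets[OF sets_jac[of b] refl, of "count_space UNIV"] by blast
    then show "{x \<in> space (jac b). x = z} \<in> sets (jac b)" by (rule predE)
  qed simp
  then have Wm: "W \<in> borel_measurable (jac b)"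
    by (rule measurable_cong[THEN iffD1, rotated]) (use eq in auto)
  have "integrable (jac b) (\<lambda>x. (W x)\<^sup>2)"
  proof (rule Bochner_Integration.integrable_bound)
    show "integrable (jac b) (\<lambda>x. (U x)\<^sup>2)" using U by (simp add: L2_def)
    show "(\<lambda>x. (W x)\<^sup>2) \<in> borel_measurable (jac b)" using Wm by measurable
    show "AE x in jac b. norm ((W x)\<^sup>2) \<le> norm ((U x)\<^sup>2)"
      using AE_jac_neq[of z b] AE_space[of "jac b"] by eventually_elim (use eq in auto)
  qed
  with Wm show ?thesis by (simp add: L2_def)
qed

lemma L2_cong_neq_ip:
  assumes U: "L2 b U" and eq: "\<And>x. x \<in> {-1<..<1} \<Longrightarrow> x \<noteq> z \<Longrightarrow> W x = U x"
  shows "sqn b W = sqn b U"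
  by (rule ip_cong_neq[where z = z]) (use eq U L2_cong_neq[OF U eq] in auto)

context singular_point begin

text \<open>The loss 1/4 pays for the logarithms. Being below 1/2, it still leaves, for
  \<open>s > m - 1/2\<close>, continuity of the derivatives below order \<open>m\<close> and
  differentiability below order \<open>m - 1\<close> at an interior \<open>z\<close>.\<close>

lemma F_near_z:
  "\<exists>C. \<forall>x\<in>{-1..1}. x \<noteq> z \<longrightarrow> \<bar>x - z\<bar> \<le> 1 \<longrightarrow> \<bar>F Q 1 q x\<bar> \<le> C * \<bar>x - z\<bar> powr (s - 1/4 - real q)"
proof -
  have "\<exists>C\<ge>0. \<forall>e>0. \<forall>x\<in>{-1..1}. x \<noteq> z \<longrightarrow>
    \<bar>F Q e q x\<bar> \<le> C * (e powr s * logb s (1/4) ((x - z) / e) / \<bar>x - z\<bar> ^ q)"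
    by (rule fam_bound[OF sfam_bound Dg_bounded z logb_nonneg]) simp
  then obtain C where C: "C \<ge> 0" "\<And>x. x \<in> {-1..1} \<Longrightarrow> x \<noteq> z \<Longrightarrow>
    \<bar>F Q 1 q x\<bar> \<le> C * (1 powr s * logb s (1/4) ((x - z) / 1) / \<bar>x - z\<bar> ^ q)"
    by (metis zero_less_one)
  have "\<bar>F Q 1 q x\<bar> \<le> (C * 2) * \<bar>x - z\<bar> powr (s - 1/4 - real q)"
    if "x \<in> {-1..1}" "x \<noteq> z" "\<bar>x - z\<bar> \<le> 1" for x
  proof -
    have "\<bar>F Q 1 q x\<bar> \<le> C * (logb s (1/4) (x - z) / \<bar>x - z\<bar> ^ q)" using C(2)[OF that(1,2)] by simp
    also have "\<dots> \<le> C * (2 * \<bar>x - z\<bar> powr (s - 1/4 - real q))"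
      using C(1) that by (intro mult_left_mono logb_bounds(1)) auto
    finally show ?thesis by simp
  qed
  then show ?thesis by blast
qed

lemma F_deriv_z:
  assumes "s - 1/4 - real q > 1" "z \<in> {-1<..<1}"
  shows "(F Q 1 q has_real_derivative F Q 1 (Suc q) z) (at z)"
proof -
  obtain C where "\<And>x. x \<in> {-1..1} \<Longrightarrow> x \<noteq> z \<Longrightarrow> \<bar>x - z\<bar> \<le> 1 \<Longrightarrow> \<bar>F Q 1 q x\<bar> \<le> C * \<bar>x - z\<bar> powr (s - 1/4 - real q)"
    using F_near_z by blast
  then have "(F Q 1 q has_real_derivative 0) (at z within {-1..1})"
    by (intro DERIV_zero_of_power_bound[where \<phi> = "F Q 1 q", OF F_at_z assms(1) zero_less_one])
  then show ?thesis using assms(2) by (simp add: F_at_z at_within_Icc_at)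
qed

lemma F_isCont_z:
  assumes "s - 1/4 - real q > 0" "z \<in> {-1<..<1}"
  shows "isCont (F Q 1 q) z"
proof -
  obtain C where C: "\<And>x. x \<in> {-1..1} \<Longrightarrow> x \<noteq> z \<Longrightarrow> \<bar>x - z\<bar> \<le> 1 \<Longrightarrow> \<bar>F Q 1 q x\<bar> \<le> C * \<bar>x - z\<bar> powr (s - 1/4 - real q)"
    using F_near_z by blast
  have "(F Q 1 q \<longlongrightarrow> 0) (at z)"
  proof (rule Lim_null_comparison)
    have 1: "\<forall>\<^sub>F x in at z. x \<in> {-1<..<1}"
      using assms(2) by (intro eventually_at_in_open') auto
    have 2: "\<forall>\<^sub>F x in at z. x \<in> {z - 1<..<z + 1}" by (intro eventually_at_in_open') auto
    have 3: "\<forall>\<^sub>F x in at z. x \<noteq> z" by (simp add: eventually_at_filter)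
    show "\<forall>\<^sub>F x in at z. norm (F Q 1 q x) \<le> C * \<bar>x - z\<bar> powr (s - 1/4 - real q)"
      using 1 2 3
    proof eventually_elim
      case (elim x)
      then have "\<bar>F Q 1 q x\<bar> \<le> C * \<bar>x - z\<bar> powr (s - 1/4 - real q)" by (intro C) auto
      then show ?case by simp
    qed
    have "((\<lambda>x. \<bar>x - z\<bar> powr (s - 1/4 - real q)) \<longlongrightarrow> \<bar>z - z\<bar> powr (s - 1/4 - real q)) (at z)"
      using assms by (intro tendsto_powr' tendsto_intros) auto
    then show "((\<lambda>x. C * \<bar>x - z\<bar> powr (s - 1/4 - real q)) \<longlongrightarrow> 0) (at z)"
      using tendsto_mult_left[of "\<lambda>x. \<bar>x - z\<bar> powr (s - 1/4 - real q)" 0 _ C] by simp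
  qed
  then show ?thesis by (simp add: isCont_def F_at_z)
qed

text \<open>The explicit family \<open>U\<close> has to be matched with iterated pointwise
  derivatives: off \<open>z\<close> in all orders, and at an interior \<open>z\<close> only below
  order \<open>m\<close>. Order \<open>m\<close> is reached through the fundamental theorem of
  calculus with one exceptional point, as membership in the Sobolev space demands.\<close>

lemma sobolev_error:
  assumes f: "\<And>x. x \<in> {-1<..<1} \<Longrightarrow> f x = \<bar>x - z\<bar> powr s * ln \<bar>x - z\<bar> ^ \<mu> * Dg 0 x"
    and zi: "z \<in> {-1<..<1} \<Longrightarrow> s > real m - 1/2"
    and Pr: "\<And>N. L2 b f \<Longrightarrow> \<exists>p. Pr N = poly p \<and> proj_of b N f p"
    and H: "\<And>q j. q \<le> m \<Longrightarrow> j \<le> \<mu> \<Longrightarrow> term_rate \<mu> j q (\<lambda>N. rate m N * ln (real N) ^ (2 * k))"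
  shows "sobolev_error_bigo m b b f Pr (real m - \<kappa> * (s + d0 / 2)) k"
proof -
  let ?F = "Fl \<mu> 1"
  have f0: "f x = ?F 0 x" if "x \<in> {-1<..<1}" for x
    using f[OF that] F_0[of 1 x "monom 1 \<mu>"] by (cases "x = z") (simp_all add: F_at_z poly_monom)
  have LF0: "L2 b (?F 0)" using L2_F[of 0 \<mu>] by simp
  have Lf: "L2 b f" by (rule L2_cong[THEN iffD2, OF f0 LF0])
  obtain P where P: "\<And>N. Pr N = poly (P N)" and Pf: "\<And>N. proj_of b N f (P N)"
  proof -
    have "\<forall>N. \<exists>p. Pr N = poly p \<and> proj_of b N f p" using Pr[OF Lf] by blast
    from choice[OF this] show thesis using that by blast
  qed
  have PF: "proj_of b N (?F 0) (P N)" for N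
  proof -
    have "ip b (\<lambda>x. ?F 0 x - poly (P N) x) (poly r) = ip b (\<lambda>x. f x - poly (P N) x) (poly r)" for r
      by (rule ip_cong) (simp_all add: f0)
    then show ?thesis using Pf[of N] by (simp add: proj_of_def)
  qed
  define U where "U = (\<lambda>N q x. ?F q x - poly ((pderiv ^^ q) (P N)) x)"
  define u where "u = (\<lambda>N x. f x - Pr N x)"
  have u0: "u N x = U N 0 x" if "x \<in> {-1<..<1}" for N x using f0[OF that] by (simp add: u_def U_def P)
  have dpoly: "(poly ((pderiv ^^ q) p) has_real_derivative poly ((pderiv ^^ Suc q) p) x) (at x)" for p :: "real poly" and q x
    using poly_DERIV[of "(pderiv ^^ q) p" x] by simp
  have Ud: "(U N q has_real_derivative U N (Suc q) x) (at x)" if "x \<in> {-1<..<1}" "x \<noteq> z" for N q x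
    unfolding U_def by (intro DERIV_diff dpoly F_deriv_at) (use that in auto)
  have D1: "(deriv ^^ q) (u N) x = U N q x" if "x \<in> {-1<..<1}" "x \<noteq> z" for N q x
    by (rule higher_deriv_eq[where S = "{-1<..<1} - {z}" and k = q]) (use that Ud u0 in \<open>auto intro: open_Diff\<close>)
  have D2: "(deriv ^^ q) (u N) x = U N q x" if "x \<in> {-1<..<1}" "q < m" for N q x
  \<comment> \<open>With \<open>k = m - 1\<close> differentiability at \<open>z\<close> is asked
    only for orders up to \<open>m - 2\<close>, where the exponent left after the loss 1/4 still
    exceeds 1.\<close>
  proof (rule higher_deriv_eq[where S = "{-1<..<1}" and k = "m - 1"])
    fix i y assume i: "i < m - 1" and y: "y \<in> {-1<..<1::real}"
    show "(U N i has_real_derivative U N (Suc i) y) (at y)"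
    proof (cases "y = z")
      case True
      then have zo: "z \<in> {-1<..<1}" using y by simp
      have "real i \<le> real m - 2" using i by linarith
      then have "s - 1/4 - real i > 1" using zi[OF zo] by linarith
      then show ?thesis unfolding U_def True by (intro DERIV_diff dpoly F_deriv_z zo)
    qed (rule Ud[OF y])
  qed (use that u0 in auto)
  have LU: "L2 (b + real q) (U N q)" if "q \<le> m" for N q
    unfolding U_def by (intro L2_diff L2_F L2_poly b_plus that)
  have LW: "L2 (b + real q) ((deriv ^^ q) (u N))" if "q \<le> m" for N q
    by (rule L2_cong_neq[OF LU[OF that]]) (rule D1)
  have ipW: "sqn (b + real q) ((deriv ^^ q) (u N)) = sqn (b + real q) (U N q)" if "q \<le> m" for N q
    by (rule L2_cong_neq_ip[OF LU[OF that]]) (rule D1)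
  have sob: "sobolev_integrand b b (u N) q x = (1 - x\<^sup>2) powr (b + real q) * ((deriv ^^ q) (u N) x * (deriv ^^ q) (u N) x)"
    if "x \<in> {-1<..<1}" for N q x
  proof -
    have "(1 - x\<^sup>2) powr (b + real q) = (1 - x) powr (b + real q) * (1 + x) powr (b + real q)"
      using that by (subst powr_mult[symmetric]) (auto simp: power2_eq_square algebra_simps)
    then show ?thesis by (simp add: sobolev_integrand_def power2_eq_square)
  qed
  have int: "set_integrable lborel {-1<..<1} (sobolev_integrand b b (u N) q)" if "q \<le> m" for N q
    by (subst set_integrable_cong[OF refl refl sob]) (simp_all add: ip_lebesgue(1)[OF LW[OF that] LW[OF that]])
  have val: "(LINT x:{-1<..<1}|lborel. sobolev_integrand b b (u N) q x) = sqn (b + real q) (U N q)" if "q \<le> m" for N q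
  proof -
    have "(LINT x:{-1<..<1}|lborel. sobolev_integrand b b (u N) q x) =
      (LINT x:{-1<..<1}|lborel. (1 - x\<^sup>2) powr (b + real q) * ((deriv ^^ q) (u N) x * (deriv ^^ q) (u N) x))"
      by (rule set_lebesgue_integral_cong) (auto simp: sob)
    then show ?thesis using ip_lebesgue(2)[OF LW[OF that] LW[OF that], of N N] ipW[OF that] by simp
  qed
  have Ucont: "isCont (U N q) x" if x: "x \<in> {-1<..<1}" and q: "q < m" for N q x
  proof (cases "x = z")
    case False
    then show ?thesis by (intro DERIV_isCont[OF Ud[OF x]])
  next
    case True
    then have zo: "z \<in> {-1<..<1}" using x by simp
    have "real q \<le> real m - 1" using q by linarith
    then have "s - 1/4 - real q > 0" using zi[OF zo] by linarith
    then show ?thesis unfolding U_def True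
      by (intro continuous_diff F_isCont_z zo) (auto intro: DERIV_isCont[OF dpoly])
  qed
  have "u N \<in> sobolev_space m b b" for N
    unfolding sobolev_space_def
  proof (intro CollectI conjI allI impI)
    fix q a c assume q: "q < m" and ac: "-1 < a" "a \<le> c" "c < (1::real)"
    have Lq: "L2 (b + real (Suc q)) ((deriv ^^ Suc q) (u N))" using LW[of "Suc q"] q by simp
    show si: "set_integrable lborel {a..c} ((deriv ^^ Suc q) (u N))"
      by (rule L2_set_integrable[OF b_plus Lq ac(1,3)])
    have "((deriv ^^ Suc q) (u N) has_integral U N q c - U N q a) {a..c}"
    \<comment> \<open>For \<open>q = m - 1\<close> the function \<open>U N q\<close> may fail to be
      differentiable at \<open>z\<close>; its continuity there is enough.\<close>
    proof (rule fundamental_theorem_of_calculus_interior_strong[where S = "{z}"])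
      fix x assume x: "x \<in> {a<..<c} - {z}"
      then have xi: "x \<in> {-1<..<1}" "x \<noteq> z" using ac by auto
      show "(U N q has_vector_derivative (deriv ^^ Suc q) (u N) x) (at x)"
        using Ud[OF xi, of N q] D1[OF xi, of "Suc q" N]
        by (simp add: has_real_derivative_iff_has_vector_derivative)
    next
      show "continuous_on {a..c} (U N q)"
        by (intro continuous_at_imp_continuous_on ballI Ucont q) (use ac in auto)
    qed (use ac in auto)
    moreover have "(deriv ^^ q) (u N) c = U N q c" "(deriv ^^ q) (u N) a = U N q a"
      using D2[OF _ q] ac by auto
    ultimately show "(LINT x:{a..c}|lborel. (deriv ^^ Suc q) (u N) x) = (deriv ^^ q) (u N) c - (deriv ^^ q) (u N) a"
      using set_borel_integral_eq_integral(2)[OF si] by (simp add: integral_unique)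
  next
    fix q assume q: "q \<le> m"
    show "set_borel_measurable lborel {-1<..<1} ((deriv ^^ q) (u N))"
      using L2_measurable[OF LW[OF q]] unfolding measurable_jac_iff .
    show "set_integrable lborel {-1<..<1} (sobolev_integrand b b (u N) q)" by (rule int[OF q])
  qed
  moreover have "(\<lambda>N. sobolev_norm m b b (u N)) \<in> O(\<lambda>N. real N powr (real m - \<kappa> * (s + d0 / 2)) * ln (real N) ^ k)"
  proof -
    define \<rho> where "\<rho> = (\<lambda>N. rate m N * ln (real N) ^ (2 * k))"
    have "\<forall>q. \<exists>C. q \<le> m \<longrightarrow> (\<forall>\<^sub>F N in sequentially. sqn (b + real q) (U N q) \<le> C * \<rho> N)"
    proof
      fix q
      show "\<exists>C. q \<le> m \<longrightarrow> (\<forall>\<^sub>F N in sequentially. sqn (b + real q) (U N q) \<le> C * \<rho> N)"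
      proof (cases "q \<le> m")
        case True
        obtain C where "\<forall>\<^sub>F N in sequentially. \<forall>P. proj_of b N (?F 0) P \<longrightarrow>
            sqd (b + real q) (?F q) (poly ((pderiv ^^ q) P)) \<le> C * \<rho> N"
          using error_bound[OF True H[OF True]] unfolding \<rho>_def by blast
        then have "\<forall>\<^sub>F N in sequentially. sqn (b + real q) (U N q) \<le> C * \<rho> N"
          by eventually_elim (use PF in \<open>simp add: U_def\<close>)
        then show ?thesis by blast
      qed simp
    qed
    from choice[OF this] obtain C where C: "\<And>q. q \<le> m \<Longrightarrow> \<forall>\<^sub>F N in sequentially. sqn (b + real q) (U N q) \<le> C q * \<rho> N"
      by blast
    define X where "X = (\<lambda>N. real N powr (real m - \<kappa> * (s + d0 / 2)) * ln (real N) ^ k)"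
    have "\<forall>\<^sub>F N in sequentially. \<forall>q\<in>{..m}. sqn (b + real q) (U N q) \<le> C q * \<rho> N"
      by (intro eventually_ball_finite ballI C) auto
    then have "\<forall>\<^sub>F N in sequentially. norm (sobolev_norm m b b (u N)) \<le> sqrt (\<bar>\<Sum>q\<le>m. C q\<bar>) * norm (X N)"
      using eventually_gt_at_top[of 0]
    proof eventually_elim
      case (elim N)
      \<comment> \<open>All bounds so far concern squared norms; the square root halves both
        exponents.\<close>
      have X2: "(X N)\<^sup>2 = \<rho> N"
      proof -
        have "(real N powr (real m - \<kappa> * (s + d0 / 2)))\<^sup>2 = rate m N"
          using elim by (simp add: powr_power algebra_simps)
        then show ?thesis by (simp add: X_def \<rho>_def power_mult_distrib power_mult[symmetric] mult.commute)
      qed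
      have "(\<Sum>q\<le>m. (LINT x:{-1<..<1}|lborel. sobolev_integrand b b (u N) q x)) = (\<Sum>q\<le>m. sqn (b + real q) (U N q))"
        by (intro sum.cong refl val) simp
      also have "\<dots> \<le> (\<Sum>q\<le>m. C q * \<rho> N)" using elim by (intro sum_mono) auto
      also have "\<dots> = (\<Sum>q\<le>m. C q) * (X N)\<^sup>2" by (simp add: sum_distrib_right X2)
      also have "\<dots> \<le> \<bar>\<Sum>q\<le>m. C q\<bar> * (X N)\<^sup>2" by (intro mult_right_mono) auto
      finally have "sobolev_norm m b b (u N) \<le> sqrt (\<bar>\<Sum>q\<le>m. C q\<bar> * (X N)\<^sup>2)"
        unfolding sobolev_norm_def by (rule real_sqrt_le_mono)
      also have "\<dots> = sqrt (\<bar>\<Sum>q\<le>m. C q\<bar>) * norm (X N)" by (simp add: real_sqrt_mult)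
      finally have "sobolev_norm m b b (u N) \<le> sqrt (\<bar>\<Sum>q\<le>m. C q\<bar>) * norm (X N)" .
      moreover have "sobolev_norm m b b (u N) \<ge> 0"
      proof -
        have "0 \<le> (\<Sum>q\<le>m. (LINT x:{-1<..<1}|lborel. sobolev_integrand b b (u N) q x))"
          by (intro sum_nonneg) (simp add: val ip_self_nonneg)
        then show ?thesis by (simp add: sobolev_norm_def)
      qed
      ultimately show ?case by simp
    qed
    then show ?thesis unfolding X_def by (rule bigoI)
  qed
  ultimately show ?thesis unfolding sobolev_error_bigo_def u_def by blast
qed

end

section \<open>The two geometries and the theorem\<close>

lemma weight_growth_endpoint:
  assumes "z \<in> {-1, 1}"
  shows "weight_growth z b (b + 1)"
  unfolding weight_growth_def
proof (rule exI[of _ 1], rule exI[of _ "2 powr \<bar>b\<bar>"], intro conjI ballI impI)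
  fix x :: real assume x: "x \<in> {-1<..<1}" "\<bar>x - z\<bar> \<le> 1"
  \<comment> \<open>The distance to the opposite end point, bounded away from 0 near
    \<open>z\<close>.\<close>
  define t where "t = 2 - \<bar>x - z\<bar>"
  have t: "1 \<le> t" "t \<le> 2" using x by (auto simp: t_def)
  have "1 - x\<^sup>2 = t * \<bar>x - z\<bar>"
    using assms x by (auto simp: t_def power2_eq_square algebra_simps abs_if)
  then have "(1 - x\<^sup>2) powr b = t powr b * \<bar>x - z\<bar> powr b" using t by (simp add: powr_mult)
  also have "t powr b \<le> t powr \<bar>b\<bar>" using t by (intro powr_mono) auto
  also have "t powr \<bar>b\<bar> \<le> 2 powr \<bar>b\<bar>" using t by (intro powr_mono2) auto
  finally show "(1 - x\<^sup>2) powr b \<le> 2 powr \<bar>b\<bar> * \<bar>x - z\<bar> powr (b + 1 - 1)"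
    by (simp add: mult_right_mono)
qed auto

lemma weight_growth_interior:
  assumes z: "z \<in> {-1<..<1}"
  shows "weight_growth z b 1"
proof -
  define r where "r = (1 - \<bar>z\<bar>) / 2"
  have r: "0 < r" "r \<le> 1" using z by (auto simp: r_def)
  have i: "-1 < x \<and> x < 1" if "x \<in> cball z r" for x
    using that z by (auto simp: r_def dist_real_def abs_if field_simps split: if_splits)
  have "1 - x\<^sup>2 \<noteq> 0" if "x \<in> cball z r" for x
    using i[OF that] by (auto simp: power2_eq_1_iff)
  then have "continuous_on (cball z r) (\<lambda>x. (1 - x\<^sup>2) powr b)" by (intro continuous_intros) auto
  then have "bounded ((\<lambda>x. (1 - x\<^sup>2) powr b) ` cball z r)"
    by (intro compact_imp_bounded compact_continuous_image) auto
  then obtain C where C: "\<And>x. x \<in> cball z r \<Longrightarrow> \<bar>(1 - x\<^sup>2) powr b\<bar> \<le> C"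
    unfolding bounded_iff real_norm_def by blast
  show ?thesis unfolding weight_growth_def
  proof (rule exI[of _ r], rule exI[of _ C], intro conjI ballI impI r)
    fix x :: real assume x: "x \<noteq> z" "\<bar>x - z\<bar> \<le> r"
    then have "\<bar>(1 - x\<^sup>2) powr b\<bar> \<le> C" by (intro C) (simp add: dist_real_def abs_minus_commute)
    then show "(1 - x\<^sup>2) powr b \<le> C * \<bar>x - z\<bar> powr (1 - 1)" using x by simp
  qed
qed

text \<open>With \<open>\<kappa> = 2\<close>, \<open>\<theta> = 1\<close> and
  \<open>d0 = b + 1\<close> the locale condition \<open>sm\<close> is exactly \<open>cond\<close>.
  For natural \<open>\<gamma>\<close> the power of the distance is a polynomial on the interval, and
  only the terms with \<open>j \<ge> 1\<close> remain singular; their coefficients carry at most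
  \<open>\<mu> - 1\<close> logarithms.\<close>

lemma endpoint_error:
  assumes b: "b > -1" and z: "z \<in> {-1, 1}" and g: "smooth_on_Icc g"
    and cond: "b + 1 + 2 * \<gamma> > real m"
    and f: "\<And>x. x \<in> {-1<..<1} \<Longrightarrow> f x = \<bar>x - z\<bar> powr \<gamma> * ln \<bar>x - z\<bar> ^ \<mu> * g x"
    and Pr: "\<And>N. L2 b f \<Longrightarrow> \<exists>p. Pr N = poly p \<and> proj_of b N f p"
  shows "sobolev_error_bigo m b b f Pr (real m - b - 2 * \<gamma> - 1) \<mu>"
    and "\<mu> \<ge> 1 \<Longrightarrow> \<gamma> \<in> \<nat> \<Longrightarrow> sobolev_error_bigo m b b f Pr (real m - b - 2 * \<gamma> - 1) (\<mu> - 1)"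
proof -
  obtain Dg where Dg0: "\<And>x. x \<in> {-1..1} \<Longrightarrow> Dg 0 x = g x"
    and Dg: "\<And>i x. x \<in> {-1..1} \<Longrightarrow> (Dg i has_real_derivative Dg (Suc i) x) (at x within {-1..1})"
    using g unfolding smooth_on_Icc_def by blast
  interpret singular_point b z 2 1 "b + 1" \<gamma> m Dg
  proof
    show "weight_growth z (b + real p) (b + 1 + 1 * real p)" for p
      using weight_growth_endpoint[OF z, of "b + real p"] by (simp add: add_ac)
  qed (use b z cond Dg in auto)
  have f': "f x = \<bar>x - z\<bar> powr \<gamma> * ln \<bar>x - z\<bar> ^ \<mu> * Dg 0 x" if "x \<in> {-1<..<1}" for x
    using f[OF that] Dg0[of x] that by simp
  have zo: "z \<notin> {-1<..<1}" using assms(2) by auto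
  have ex: "real m - 2 * (\<gamma> + (b + 1) / 2) = real m - b - 2 * \<gamma> - 1" by (simp add: field_simps)
  show "sobolev_error_bigo m b b f Pr (real m - b - 2 * \<gamma> - 1) \<mu>"
    by (rule sobolev_error[OF f' _ Pr, unfolded ex], assumption, use zo in blast, assumption,
        erule term_bound, simp)
  assume \<mu>: "\<mu> \<ge> 1" and "\<gamma> \<in> \<nat>"
  then obtain n where n: "\<gamma> = real n" by (auto elim: Nats_cases)
  \<comment> \<open>At either end point the distance to \<open>z\<close> equals 1 - z x on the
    interval, which treats both by one linear polynomial.\<close>
  define H where "H = (\<lambda>q x. leib q (\<lambda>i. poly ((pderiv ^^ i) ([:1, -z:] ^ n)) x) (\<lambda>i. Dg i x))"
  have H: "(H i has_real_derivative H (Suc i) x) (at x within {-1..1})" if "x \<in> {-1..1}" for i x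
    unfolding H_def
  proof (rule leib_deriv)
    show "(poly ((pderiv ^^ i) ([:1, - z:] ^ n)) has_real_derivative poly ((pderiv ^^ Suc i) ([:1, - z:] ^ n)) x) (at x within {-1..1})" for i
      using DERIV_subset[OF poly_DERIV[of "(pderiv ^^ i) ([:1, - z:] ^ n)" x]] by simp
  qed (rule Dg[OF that])
  have H0: "H 0 x = \<bar>x - z\<bar> powr \<gamma> * Dg 0 x" if "x \<in> {-1<..<1}" for x
  proof -
    have "\<bar>x - z\<bar> = 1 - z * x" using assms(2) that by auto
    moreover have "\<bar>x - z\<bar> > 0" using zo that by auto
    ultimately show ?thesis by (simp add: H_def n powr_realpow mult.commute)
  qed
  show "sobolev_error_bigo m b b f Pr (real m - b - 2 * \<gamma> - 1) (\<mu> - 1)"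
  proof (rule sobolev_error[OF f' _ Pr, unfolded ex])
    fix q j assume q: "q \<le> m" and j: "j \<le> \<mu>"
    show "term_rate \<mu> j q (\<lambda>N. rate m N * ln (real N) ^ (2 * (\<mu> - 1)))"
    proof (cases "j = 0")
      case True
      show ?thesis unfolding True by (rule smooth_term_bound[OF zo H H0 q])
    next
      case False
      then show ?thesis by (intro term_bound q) auto
    qed
  qed (use zo in auto)
qed

text \<open>Here the weight is bounded near \<open>z\<close>, whatever its exponent, so
  \<open>\<theta> = 0\<close>, \<open>d0 = 1\<close>, \<open>\<kappa> = 1\<close>, and
  \<open>sm\<close> becomes the condition on \<open>s\<close>.\<close>

lemma interior_error:
  assumes b: "b > -1" and z: "z \<in> {-1<..<1}" and g: "smooth_on_Icc g"
    and cond: "s > real m - 1/2"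
    and f: "\<And>x. x \<in> {-1<..<1} \<Longrightarrow> f x = \<bar>x - z\<bar> powr s * ln \<bar>x - z\<bar> ^ \<mu> * g x"
    and Pr: "\<And>N. L2 b f \<Longrightarrow> \<exists>p. Pr N = poly p \<and> proj_of b N f p"
  shows "sobolev_error_bigo m b b f Pr (real m - s - 1/2) \<mu>"
proof -
  obtain Dg where Dg0: "\<And>x. x \<in> {-1..1} \<Longrightarrow> Dg 0 x = g x"
    and Dg: "\<And>i x. x \<in> {-1..1} \<Longrightarrow> (Dg i has_real_derivative Dg (Suc i) x) (at x within {-1..1})"
    using g unfolding smooth_on_Icc_def by blast
  interpret singular_point b z 1 0 1 s m Dg
  proof
    show "weight_growth z (b + real p) (1 + 0 * real p)" for p
      using weight_growth_interior[OF z, of "b + real p"] by simp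
  qed (use b z cond Dg in auto)
  have f': "f x = \<bar>x - z\<bar> powr s * ln \<bar>x - z\<bar> ^ \<mu> * Dg 0 x" if "x \<in> {-1<..<1}" for x
    using f[OF that] Dg0[of x] that by simp
  have ex: "real m - 1 * (s + 1 / 2) = real m - s - 1/2" by simp
  show ?thesis
    by (rule sobolev_error[OF f' _ Pr, unfolded ex], assumption, rule cond, assumption, erule term_bound, simp)
qed

theorem corollary5:
  fixes m \<mu> :: nat and g :: "real \<Rightarrow> real" and lam :: real
  assumes g: "smooth_on_Icc g"
    and lam: "lam > -1/2"
  shows
    "(lam \<noteq> 0 \<longrightarrow>
        (\<forall>\<gamma> f. (\<forall>x\<in>{-1<..<1}. f x = (1 - x) powr \<gamma> * ln (1 - x) ^ \<mu> * g x) \<longrightarrow>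
          min (lam + \<gamma>) (lam + 2 * \<gamma>) > real m - 1/2 \<longrightarrow>
          sobolev_error_bigo m (lam - 1/2) (lam - 1/2) f (gegenbauer_proj lam f)
            (real m - lam - 2 * \<gamma> - 1/2) \<mu> \<and>
          (\<mu> \<ge> 1 \<and> \<gamma> \<in> \<nat> \<longrightarrow>
            sobolev_error_bigo m (lam - 1/2) (lam - 1/2) f (gegenbauer_proj lam f)
              (real m - lam - 2 * \<gamma> - 1/2) (\<mu> - 1)))
        \<and> (\<forall>z0 s f. z0 \<in> {-1<..<1} \<longrightarrow>
          (\<forall>x\<in>{-1<..<1}. f x = \<bar>x - z0\<bar> powr s * ln \<bar>x - z0\<bar> ^ \<mu> * g x) \<longrightarrow>
          s > real m - 1/2 \<longrightarrow> lam \<ge> 0 \<longrightarrow>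
          sobolev_error_bigo m (lam - 1/2) (lam - 1/2) f (gegenbauer_proj lam f)
            (real m - s - 1/2) \<mu>)
        \<and> (\<forall>\<delta> f. (\<forall>x\<in>{-1<..<1}. f x = (1 + x) powr \<delta> * ln (1 + x) ^ \<mu> * g x) \<longrightarrow>
          min (lam + \<delta>) (lam + 2 * \<delta>) > real m - 1/2 \<longrightarrow>
          sobolev_error_bigo m (lam - 1/2) (lam - 1/2) f (gegenbauer_proj lam f)
            (real m - lam - 2 * \<delta> - 1/2) \<mu> \<and>
          (\<mu> \<ge> 1 \<and> \<delta> \<in> \<nat> \<longrightarrow>
            sobolev_error_bigo m (lam - 1/2) (lam - 1/2) f (gegenbauer_proj lam f)
              (real m - lam - 2 * \<delta> - 1/2) (\<mu> - 1))))
     \<and> ((\<forall>\<gamma> f. (\<forall>x\<in>{-1<..<1}. f x = (1 - x) powr \<gamma> * ln (1 - x) ^ \<mu> * g x) \<longrightarrow>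
          min \<gamma> (2 * \<gamma>) > real m - 1/2 \<longrightarrow>
          sobolev_error_bigo m (-1/2) (-1/2) f (chebyshev_proj f)
            (real m - 1/2 - 2 * \<gamma>) \<mu> \<and>
          (\<mu> \<ge> 1 \<and> \<gamma> \<in> \<int> \<longrightarrow>
            sobolev_error_bigo m (-1/2) (-1/2) f (chebyshev_proj f)
              (real m - 1/2 - 2 * \<gamma>) (\<mu> - 1)))
        \<and> (\<forall>z0 s f. z0 \<in> {-1<..<1} \<longrightarrow>
          (\<forall>x\<in>{-1<..<1}. f x = \<bar>x - z0\<bar> powr s * ln \<bar>x - z0\<bar> ^ \<mu> * g x) \<longrightarrow>
          s > real m - 1/2 \<longrightarrow>
          sobolev_error_bigo m (-1/2) (-1/2) f (chebyshev_proj f)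
            (real m - s - 1/2) \<mu>)
        \<and> (\<forall>\<delta> f. (\<forall>x\<in>{-1<..<1}. f x = (1 + x) powr \<delta> * ln (1 + x) ^ \<mu> * g x) \<longrightarrow>
          min \<delta> (2 * \<delta>) > real m - 1/2 \<longrightarrow>
          sobolev_error_bigo m (-1/2) (-1/2) f (chebyshev_proj f)
            (real m - 1/2 - 2 * \<delta>) \<mu> \<and>
          (\<mu> \<ge> 1 \<and> \<delta> \<in> \<int> \<longrightarrow>
            sobolev_error_bigo m (-1/2) (-1/2) f (chebyshev_proj f)
              (real m - 1/2 - 2 * \<delta>) (\<mu> - 1))))"
proof -
  have b: "lam - 1/2 > -1" and b0: "-1/2 > (-1::real)" using lam by auto
  have ex: "real m - lam - 2 * \<gamma> - 1/2 = real m - (lam - 1/2) - 2 * \<gamma> - 1"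
    "real m - 1/2 - 2 * \<gamma> = real m - (-1/2) - 2 * \<gamma> - 1" for \<gamma> by simp_all
  have a1: "\<bar>x - 1\<bar> = 1 - x" "\<bar>x - (-1)\<bar> = 1 + x" if "x \<in> {-1<..<1}" for x :: real using that by auto
  have nat: "\<gamma> \<in> \<nat>" if "\<gamma> \<in> \<int>" "min \<gamma> (2 * \<gamma>) > real m - 1/2" for \<gamma> :: real
  proof -
    have "\<gamma> > -1" using that(2) by (auto simp: min_def split: if_splits)
    then show ?thesis using that(1) by (auto simp: Nats_altdef2 elim!: Ints_cases)
  qed
  have G: "\<exists>p. gegenbauer_proj lam f N = poly p \<and> proj_of (lam - 1/2) N f p"
    if "lam \<noteq> 0" "L2 (lam - 1/2) f" for f N
    by (rule gegenbauer_proj_of[OF lam that])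
  show ?thesis
  proof (intro conjI impI allI; (elim conjE)?)
    fix \<gamma> f
    assume l: "lam \<noteq> 0" and f: "\<forall>x\<in>{-1<..<1}. f x = (1 - x) powr \<gamma> * ln (1 - x) ^ \<mu> * g x"
      and c: "min (lam + \<gamma>) (lam + 2 * \<gamma>) > real m - 1/2"
    have c': "lam - 1/2 + 1 + 2 * \<gamma> > real m" using c by simp
    have f': "f x = \<bar>x - 1\<bar> powr \<gamma> * ln \<bar>x - 1\<bar> ^ \<mu> * g x" if "x \<in> {-1<..<1}" for x
      using f that by (simp add: a1)
    show "sobolev_error_bigo m (lam - 1/2) (lam - 1/2) f (gegenbauer_proj lam f) (real m - lam - 2 * \<gamma> - 1/2) \<mu>"
      unfolding ex by (rule endpoint_error(1)[OF b _ g c' f' G[OF l]]) auto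
    assume "\<mu> \<ge> 1" "\<gamma> \<in> \<nat>"
    then show "sobolev_error_bigo m (lam - 1/2) (lam - 1/2) f (gegenbauer_proj lam f) (real m - lam - 2 * \<gamma> - 1/2) (\<mu> - 1)"
      unfolding ex by (intro endpoint_error(2)[OF b _ g c' f' G[OF l]]) auto
  next
    fix z0 s f
    assume l: "lam \<noteq> 0" and z: "z0 \<in> {-1<..<1}"
      and f: "\<forall>x\<in>{-1<..<1}. f x = \<bar>x - z0\<bar> powr s * ln \<bar>x - z0\<bar> ^ \<mu> * g x" and c: "s > real m - 1/2"
    show "sobolev_error_bigo m (lam - 1/2) (lam - 1/2) f (gegenbauer_proj lam f) (real m - s - 1/2) \<mu>"
      by (rule interior_error[OF b z g c _ G[OF l]]) (use f in auto)
  next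
    fix \<delta> f
    assume l: "lam \<noteq> 0" and f: "\<forall>x\<in>{-1<..<1}. f x = (1 + x) powr \<delta> * ln (1 + x) ^ \<mu> * g x"
      and c: "min (lam + \<delta>) (lam + 2 * \<delta>) > real m - 1/2"
    have c': "lam - 1/2 + 1 + 2 * \<delta> > real m" using c by simp
    have f': "f x = \<bar>x - (-1)\<bar> powr \<delta> * ln \<bar>x - (-1)\<bar> ^ \<mu> * g x" if "x \<in> {-1<..<1}" for x
      using f that by (simp only: a1)
    show "sobolev_error_bigo m (lam - 1/2) (lam - 1/2) f (gegenbauer_proj lam f) (real m - lam - 2 * \<delta> - 1/2) \<mu>"
      unfolding ex by (rule endpoint_error(1)[OF b _ g c' f' G[OF l]]) auto
    assume "\<mu> \<ge> 1" "\<delta> \<in> \<nat>"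
    then show "sobolev_error_bigo m (lam - 1/2) (lam - 1/2) f (gegenbauer_proj lam f) (real m - lam - 2 * \<delta> - 1/2) (\<mu> - 1)"
      unfolding ex by (intro endpoint_error(2)[OF b _ g c' f' G[OF l]]) auto
  next
    fix \<gamma> f
    assume f: "\<forall>x\<in>{-1<..<1}. f x = (1 - x) powr \<gamma> * ln (1 - x) ^ \<mu> * g x"
      and c: "min \<gamma> (2 * \<gamma>) > real m - 1/2"
    have c': "-1/2 + 1 + 2 * \<gamma> > real m" using c by simp
    have f': "f x = \<bar>x - 1\<bar> powr \<gamma> * ln \<bar>x - 1\<bar> ^ \<mu> * g x" if "x \<in> {-1<..<1}" for x
      using f that by (simp add: a1)
    show "sobolev_error_bigo m (-1/2) (-1/2) f (chebyshev_proj f) (real m - 1/2 - 2 * \<gamma>) \<mu>"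
      unfolding ex by (rule endpoint_error(1)[OF b0 _ g c' f' chebyshev_proj_of]) auto
    assume "\<mu> \<ge> 1" "\<gamma> \<in> \<int>"
    then show "sobolev_error_bigo m (-1/2) (-1/2) f (chebyshev_proj f) (real m - 1/2 - 2 * \<gamma>) (\<mu> - 1)"
      unfolding ex by (intro endpoint_error(2)[OF b0 _ g c' f' chebyshev_proj_of] nat c) auto
  next
    fix z0 s f
    assume z: "z0 \<in> {-1<..<1}"
      and f: "\<forall>x\<in>{-1<..<1}. f x = \<bar>x - z0\<bar> powr s * ln \<bar>x - z0\<bar> ^ \<mu> * g x" and c: "s > real m - 1/2"
    show "sobolev_error_bigo m (-1/2) (-1/2) f (chebyshev_proj f) (real m - s - 1/2) \<mu>"
      by (rule interior_error[OF b0 z g c _ chebyshev_proj_of]) (use f in auto)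
  next
    fix \<delta> f
    assume f: "\<forall>x\<in>{-1<..<1}. f x = (1 + x) powr \<delta> * ln (1 + x) ^ \<mu> * g x"
      and c: "min \<delta> (2 * \<delta>) > real m - 1/2"
    have c': "-1/2 + 1 + 2 * \<delta> > real m" using c by simp
    have f': "f x = \<bar>x - (-1)\<bar> powr \<delta> * ln \<bar>x - (-1)\<bar> ^ \<mu> * g x" if "x \<in> {-1<..<1}" for x
      using f that by (simp only: a1)
    show "sobolev_error_bigo m (-1/2) (-1/2) f (chebyshev_proj f) (real m - 1/2 - 2 * \<delta>) \<mu>"
      unfolding ex by (rule endpoint_error(1)[OF b0 _ g c' f' chebyshev_proj_of]) auto
    assume "\<mu> \<ge> 1" "\<delta> \<in> \<int>"
    then show "sobolev_error_bigo m (-1/2) (-1/2) f (chebyshev_proj f) (real m - 1/2 - 2 * \<delta>) (\<mu> - 1)"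
      unfolding ex by (intro endpoint_error(2)[OF b0 _ g c' f' chebyshev_proj_of] nat c) auto
  qed
qed

end
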